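(* Let $(R,\mathfrak{m})$ be a Noetherian local Cohen-Macaulay ring of prime characteristic $p>0$ with $\dim R=d$. Suppose that there exists a proper ideal $I\subsetneq R$ such that the projective dimension $\operatorname{pd}_R R/I$ is finite and every maximal regular sequence on $R/I$ is Frobenius closed (as a sequence in the ring $R/I$). Then every regular sequence on $R$ is Frobenius closed.
   Context: A ring has characteristic $p$ ($p$ prime) if it contains $\mathbb{F}_p$. For an ideal $J$ of a Noetherian ring $A$ of characteristic $p>0$ and $q=p^e$, $J^{[q]}$ is the ideal generated by all $x^q$ with $x\in J$. The Frobenius closure $J^F$ is the set of all $x\in A$ such that $x^q\in J^{[q]}$ for some $q=p^e$; $J$ is Frobenius closed if $J^F=J$. A sequence of elements of $A$ is called Frobenius closed if the ideal of $A$ it generates is Frobenius closed. Regular sequences in a local ring consist of elements of the maximal ideal; if $\operatorname{depth} R/I=0$, the maximal regular sequence on $R/I$ is the empty sequence, generating the zero ideal. *)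

theory Defs
  imports "HOL-Algebra.Algebra" "HOL-Library.Extended_Nat"
begin

section \<open>Local rings, Krull dimension, characteristic\<close>

definition local_ring :: "('a, 'b) ring_scheme \<Rightarrow> 'a set \<Rightarrow> bool" where
  "local_ring R \<mm> \<longleftrightarrow>
     cring R \<and> maximalideal \<mm> R \<and> (\<forall>\<nn>. maximalideal \<nn> R \<longrightarrow> \<nn> = \<mm>)"

text \<open>A chain \<open>Q 0 \<subset> \<dots> \<subset> Q n\<close> has length \<open>n\<close>.\<close>

definition krull_dim :: "('a, 'b) ring_scheme \<Rightarrow> enat" where
  "krull_dim R =
     Sup {enat n | n. \<exists>Q. (\<forall>i\<le>n. primeideal (Q i) R) \<and> (\<forall>i<n. Q i \<subset> Q (Suc i))}"

text \<open>\<open>R\<close> contains a field with \<open>p\<close> elements (a subfield contains the unity of \<open>R\<close>).\<close>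

definition has_prime_char :: "('a, 'b) ring_scheme \<Rightarrow> nat \<Rightarrow> bool" where
  "has_prime_char R p \<longleftrightarrow> Factorial_Ring.prime p \<and> (\<exists>K. subfield K R \<and> card K = p)"


section \<open>Modules\<close>

text \<open>The record type of modules has a multiplication and a unity, which the locale
  \<^locale>\<open>module\<close> ignores.\<close>

definition self_module :: "('a, 'b) ring_scheme \<Rightarrow> ('a, 'a) module" where
  "self_module R = \<lparr>carrier = carrier R, monoid.mult = monoid.mult R, one = one R,
     ring.zero = ring.zero R, ring.add = ring.add R, smult = monoid.mult R\<rparr>"

definition quot_module :: "('a, 'b) ring_scheme \<Rightarrow> 'a set \<Rightarrow> ('a, 'a set) module" where
  "quot_module R I = \<lparr>carrier = carrier (R Quot I), monoid.mult = monoid.mult (R Quot I),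
     one = one (R Quot I), ring.zero = ring.zero (R Quot I), ring.add = ring.add (R Quot I),
     smult = (\<lambda>a C. (I +>\<^bsub>R\<^esub> a) \<otimes>\<^bsub>R Quot I\<^esub> C)\<rparr>"

definition mod_hom ::
  "('a, 'b) ring_scheme \<Rightarrow> ('a, 'm) module \<Rightarrow> ('a, 'n) module \<Rightarrow> ('m \<Rightarrow> 'n) set" where
  "mod_hom R M N = {f \<in> carrier M \<rightarrow> carrier N.
     (\<forall>x\<in>carrier M. \<forall>y\<in>carrier M. f (x \<oplus>\<^bsub>M\<^esub> y) = f x \<oplus>\<^bsub>N\<^esub> f y) \<and>
     (\<forall>a\<in>carrier R. \<forall>x\<in>carrier M. f (a \<odot>\<^bsub>M\<^esub> x) = a \<odot>\<^bsub>N\<^esub> f x)}"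

text \<open>The submodule \<open>J M\<close> generated by all products of an element of \<open>J\<close> and one of \<open>M\<close>.\<close>

definition ideal_times :: "('a, 'b) ring_scheme \<Rightarrow> 'a set \<Rightarrow> ('a, 'm) module \<Rightarrow> 'm set" where
  "ideal_times R J M =
     \<Inter>{N. submodule N R M \<and> (\<forall>a\<in>J. \<forall>x\<in>carrier M. a \<odot>\<^bsub>M\<^esub> x \<in> N)}"


section \<open>Regular sequences and depth\<close>

text \<open>Each \<open>x\<^sub>i\<close> is a nonzerodivisor on \<open>M / (x\<^sub>1, \<dots>, x\<^bsub>i-1\<^esub>) M\<close>, and
  \<open>(x\<^sub>1, \<dots>, x\<^sub>n) M \<noteq> M\<close>. All elements lie in \<open>\<mm>\<close>.\<close>

definition regular_seq ::
  "('a, 'b) ring_scheme \<Rightarrow> 'a set \<Rightarrow> ('a, 'm) module \<Rightarrow> 'a list \<Rightarrow> bool" where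
  "regular_seq R \<mm> M xs \<longleftrightarrow>
     set xs \<subseteq> \<mm> \<and>
     (\<forall>i<length xs. \<forall>v\<in>carrier M.
        xs ! i \<odot>\<^bsub>M\<^esub> v \<in> ideal_times R (Idl\<^bsub>R\<^esub> (set (take i xs))) M \<longrightarrow>
        v \<in> ideal_times R (Idl\<^bsub>R\<^esub> (set (take i xs))) M) \<and>
     ideal_times R (Idl\<^bsub>R\<^esub> (set xs)) M \<noteq> carrier M"

definition maximal_regular_seq ::
  "('a, 'b) ring_scheme \<Rightarrow> 'a set \<Rightarrow> ('a, 'm) module \<Rightarrow> 'a list \<Rightarrow> bool" where
  "maximal_regular_seq R \<mm> M xs \<longleftrightarrow>
     regular_seq R \<mm> M xs \<and> (\<forall>y. \<not> regular_seq R \<mm> M (xs @ [y]))"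

definition depth :: "('a, 'b) ring_scheme \<Rightarrow> 'a set \<Rightarrow> ('a, 'm) module \<Rightarrow> enat" where
  "depth R \<mm> M = Sup {enat (length xs) | xs. regular_seq R \<mm> M xs}"

definition cohen_macaulay_local :: "('a, 'b) ring_scheme \<Rightarrow> 'a set \<Rightarrow> bool" where
  "cohen_macaulay_local R \<mm> \<longleftrightarrow>
     noetherian_ring R \<and> local_ring R \<mm> \<and> depth R \<mm> (self_module R) = krull_dim R"


section \<open>Projective dimension\<close>

text \<open>The lifting property. A definition cannot quantify over the carrier types of the test
  modules \<open>M\<close> and \<open>N\<close>; the types chosen here suffice for it to imply the lifting property against
  modules of every type, because they cover the surjection onto \<open>P\<close> from the free module on the
  carrier of \<open>P\<close>, that is, from the finitely supported functions of type \<^typ>\<open>'p \<Rightarrow> 'a\<close>: a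
  splitting of it makes \<open>P\<close> a direct summand of a free module.\<close>

definition projective_module :: "('a, 'b) ring_scheme \<Rightarrow> ('a, 'p) module \<Rightarrow> bool" where
  "projective_module R P \<longleftrightarrow> module R P \<and>
     (\<forall>(M :: ('a, 'p \<Rightarrow> 'a) module) (N :: ('a, 'p) module) g f.
        module R M \<longrightarrow> module R N \<longrightarrow>
        g \<in> mod_hom R M N \<longrightarrow> g ` carrier M = carrier N \<longrightarrow> f \<in> mod_hom R P N \<longrightarrow>
        (\<exists>h\<in>mod_hom R P M. \<forall>x\<in>carrier P. g (h x) = f x))"

text \<open>An exact sequence
  \<open>0 \<rightarrow> P n \<rightarrow> \<dots> \<rightarrow> P 1 \<rightarrow> P 0 \<rightarrow> M \<rightarrow> 0\<close> with projective \<open>P i\<close>, augmentation \<open>\<epsilon>\<close> and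
  differentials \<open>\<delta> i\<close> from \<open>P (Suc i)\<close> to \<open>P i\<close>, continued by zero modules beyond degree \<open>n\<close>.\<close>

definition projective_resolution ::
  "('a, 'b) ring_scheme \<Rightarrow> ('a, 'm) module \<Rightarrow> nat \<Rightarrow> (nat \<Rightarrow> ('a, 'p) module) \<Rightarrow>
     (nat \<Rightarrow> 'p \<Rightarrow> 'p) \<Rightarrow> ('p \<Rightarrow> 'm) \<Rightarrow> bool" where
  "projective_resolution R M n P \<delta> \<epsilon> \<longleftrightarrow>
     (\<forall>i. projective_module R (P i)) \<and>
     (\<forall>i>n. carrier (P i) = {\<zero>\<^bsub>P i\<^esub>}) \<and>
     \<epsilon> \<in> mod_hom R (P 0) M \<and> \<epsilon> ` carrier (P 0) = carrier M \<and>
     (\<forall>i. \<delta> i \<in> mod_hom R (P (Suc i)) (P i)) \<and>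
     {x \<in> carrier (P 0). \<epsilon> x = \<zero>\<^bsub>M\<^esub>} = \<delta> 0 ` carrier (P 1) \<and>
     (\<forall>i. {x \<in> carrier (P (Suc i)). \<delta> i x = \<zero>\<^bsub>P i\<^esub>} = \<delta> (Suc i) ` carrier (P (Suc (Suc i))))"

text \<open>The infimum of the lengths of the projective resolutions whose terms have carriers of type
  \<^typ>\<open>'p\<close> (\<open>\<infinity>\<close> if there is none). It can exceed the projective dimension if \<^typ>\<open>'p\<close> is too
  small. A theorem with hypothesis \<open>proj_dim TYPE('p) R M < \<infinity>\<close> and \<^typ>\<open>'p\<close> a free type variable
  covers resolutions by modules of every type.\<close>

definition proj_dim :: "'p itself \<Rightarrow> ('a, 'b) ring_scheme \<Rightarrow> ('a, 'm) module \<Rightarrow> enat" where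
  "proj_dim T R M = Inf {enat n | n.
     \<exists>(P :: nat \<Rightarrow> ('a, 'p) module) \<delta> \<epsilon>. projective_resolution R M n P \<delta> \<epsilon>}"


section \<open>Frobenius closure\<close>

definition frobenius_power :: "('a, 'b) ring_scheme \<Rightarrow> 'a set \<Rightarrow> nat \<Rightarrow> 'a set" where
  "frobenius_power A J q = Idl\<^bsub>A\<^esub> ((\<lambda>x. x [^]\<^bsub>A\<^esub> q) ` J)"

definition frobenius_closure :: "('a, 'b) ring_scheme \<Rightarrow> nat \<Rightarrow> 'a set \<Rightarrow> 'a set" where
  "frobenius_closure A p J =
     {x \<in> carrier A. \<exists>e::nat. x [^]\<^bsub>A\<^esub> (p ^ e) \<in> frobenius_power A J (p ^ e)}"

definition frobenius_closed :: "('a, 'b) ring_scheme \<Rightarrow> nat \<Rightarrow> 'a set \<Rightarrow> bool" where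
  "frobenius_closed A p J \<longleftrightarrow> frobenius_closure A p J = J"

definition frobenius_closed_seq :: "('a, 'b) ring_scheme \<Rightarrow> nat \<Rightarrow> 'a list \<Rightarrow> bool" where
  "frobenius_closed_seq A p xs \<longleftrightarrow> frobenius_closed A p (Idl\<^bsub>A\<^esub> (set xs))"

end

theory Submission
  imports Defs
begin

text \<open>
  The theorem is proved by transporting a failure of Frobenius closedness along a minimal free
  resolution \<open>F\<close> of \<open>R/I\<close>.

  Suppose that the ideal generated by a regular sequence \<open>y\<^sub>1, \<dots>, y\<^sub>d\<close> of full length is not Frobenius
  closed. As \<open>\<mm>\<close> is the only prime above it, there is an element \<open>v \<notin> (y)\<close> with \<open>\<mm> v \<subseteq> (y)\<close> and
  \<open>v\<^sup>q \<in> (y\<^sub>1\<^sup>q, \<dots>, y\<^sub>d\<^sup>q)\<close>. By prime avoidance the generators of \<open>(y)\<close> can be changed so that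
  \<open>y\<^sub>1, \<dots>, y\<^sub>t\<close> is a maximal regular sequence on \<open>R/I\<close> (\<open>regular_mod_adapt\<close>). Finite projective
  dimension makes \<open>F\<close> finite (\<open>finite_length\<close>); its length \<open>n\<close> satisfies \<open>t + n = d\<close> by the
  Auslander-Buchsbaum formula (\<open>auslander_buchsbaum_ge\<close>, \<open>auslander_buchsbaum_le\<close>).

  Let \<open>e\<close> be a basis vector of \<open>F\<^sub>n\<close>. The entries of the differentials lie in \<open>\<mm>\<close>, so the differential
  of \<open>w\<^sub>n = v e\<close> is zero modulo \<open>(y)\<close>. Going down from \<open>F\<^sub>i\<close> to \<open>F\<^bsub>i-1\<^esub>\<close> by dimension shifting uses up
  the last element of the sequence: \<open>D w\<^sub>i\<close> is a combination of \<open>y\<^sub>1, \<dots>, y\<^bsub>t+i\<^esub>\<close>, and \<open>w\<^bsub>i-1\<^esub>\<close> is the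
  coefficient of \<open>y\<^bsub>t+i\<^esub>\<close>. Exactness of \<open>F\<close> keeps these elements nonzero, and at the end
  \<open>w\<^sub>0 \<in> R\<close> is not in \<open>I + (y\<^sub>1, \<dots>, y\<^sub>t)\<close>. The equations of this zigzag are polynomial; additivity of
  the \<open>q\<close>-th power map turns them into equations for the vectors, matrices and sequence obtained by
  raising all entries to the power \<open>q\<close>. The new start is zero modulo \<open>(y\<^sub>1\<^sup>q, \<dots>, y\<^sub>d\<^sup>q)\<close>, and this property
  descends, because \<open>y\<^sub>1\<^sup>q, \<dots>, y\<^sub>d\<^sup>q\<close> is regular and the new matrices still compose to zero. It
  yields \<open>w\<^sub>0\<^sup>q \<in> I + (y\<^sub>1\<^sup>q, \<dots>, y\<^sub>t\<^sup>q)\<close> (\<open>zigzag\<close>, \<open>frobenius_witness\<close>), which contradicts the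
  hypothesis on the maximal regular sequence \<open>y\<^sub>1, \<dots>, y\<^sub>t\<close>.

  A shorter regular sequence can be extended to length \<open>d\<close>, since all maximal regular sequences on
  \<open>R\<close> have the same length (\<open>regular_mod_length_le\<close>). It is Frobenius closed by descending induction on
  its length and Nakayama's lemma (\<open>regular_sequence_frobenius_closed\<close>).

  Modules \<open>R/N\<close> are replaced by the ideals \<open>N\<close>, and quotients of submodules of free modules by pairs of
  submodules. The terms of the given projective resolution are arbitrary modules; they enter only through
  comparison maps with \<open>F\<close>.\<close>

section \<open>Ideals of commutative rings\<close>

lemma (in ring) add_minus_cancel:
  assumes "x \<in> carrier R" "y \<in> carrier R"
  shows "(x \<oplus> y) \<ominus> y = x" "(x \<ominus> y) \<oplus> y = x"
  using assms by (simp_all add: a_minus_def a_assoc l_neg r_neg)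

lemma (in cring) Idl_insert_iff:
  assumes "ideal N R" "x \<in> carrier R"
  shows "u \<in> Idl (insert x N) \<longleftrightarrow> (\<exists>n\<in>N. \<exists>r\<in>carrier R. u = n \<oplus> r \<otimes> x)"
proof -
  interpret N: ideal N R by fact
  let ?S = "N <+>\<^bsub>R\<^esub> PIdl x"
  have S: "ideal ?S R" by (simp add: add_ideals assms cgenideal_ideal)
  have "Idl (insert x N) = ?S"
  proof
    have "\<zero> \<oplus> x \<in> ?S"
      using N.zero_closed cgenideal_self[OF assms(2)] unfolding set_add_def' by blast
    hence "x \<in> ?S" using assms(2) by simp
    moreover have "N \<subseteq> ?S"
    proof
      fix n assume "n \<in> N"
      moreover have "\<zero> \<in> PIdl x"
        using cgenideal_ideal[OF assms(2)]
        by (simp add: additive_subgroup.zero_closed ideal.axioms(1))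
      ultimately have "n \<oplus> \<zero> \<in> ?S" unfolding set_add_def' by blast
      thus "n \<in> ?S" using N.Icarr[OF \<open>n \<in> N\<close>] by simp
    qed
    ultimately show "Idl (insert x N) \<subseteq> ?S" by (intro genideal_minimal S) auto
  next
    have sub: "insert x N \<subseteq> carrier R" using assms N.Icarr by auto
    interpret L: ideal "Idl (insert x N)" R by (rule genideal_ideal[OF sub])
    have "insert x N \<subseteq> Idl (insert x N)" by (rule genideal_self[OF sub])
    thus "?S \<subseteq> Idl (insert x N)"
      unfolding set_add_def' cgenideal_def using L.a_closed L.I_l_closed by auto
  qed
  thus ?thesis unfolding set_add_def' cgenideal_def by auto
qed

lemma (in ring) Idl_Un_Idl:
  assumes "A \<subseteq> carrier R" "B \<subseteq> carrier R"
  shows "Idl (A \<union> Idl B) = Idl (A \<union> B)"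
proof
  have B: "B \<subseteq> Idl B" "Idl B \<subseteq> carrier R"
    using genideal_self[OF assms(2)] ideal.Icarr[OF genideal_ideal[OF assms(2)]] by auto
  have sub: "A \<union> B \<subseteq> carrier R" "A \<union> Idl B \<subseteq> carrier R" using assms B by auto
  note AB = genideal_ideal[OF sub(1)] genideal_self[OF sub(1)]
  have "Idl B \<subseteq> Idl (A \<union> B)" using AB by (intro genideal_minimal) auto
  thus "Idl (A \<union> Idl B) \<subseteq> Idl (A \<union> B)" using AB by (intro genideal_minimal) auto
  show "Idl (A \<union> B) \<subseteq> Idl (A \<union> Idl B)"
    using genideal_ideal[OF sub(2)] genideal_self[OF sub(2)] B by (intro genideal_minimal) auto
qed

lemma (in ring) Idl_ideal: assumes "ideal L R" shows "Idl L = L"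
proof
  note L = assms
  show "Idl L \<subseteq> L" using L by (rule genideal_minimal) simp
  show "L \<subseteq> Idl L" using ideal.Icarr[OF L] by (intro genideal_self) auto
qed

lemma (in ring) Idl_mono:
  assumes "A \<subseteq> B" "B \<subseteq> carrier R" shows "Idl A \<subseteq> Idl B"
  by (rule genideal_minimal[OF genideal_ideal[OF assms(2)]])
    (use assms(1) genideal_self[OF assms(2)] in blast)

definition colon :: "('a, 'b) ring_scheme \<Rightarrow> 'a set \<Rightarrow> 'a \<Rightarrow> 'a set" where
  "colon R N s = {r \<in> carrier R. r \<otimes>\<^bsub>R\<^esub> s \<in> N}"

lemma (in cring) colon_ideal:
  assumes "ideal N R" "s \<in> carrier R" shows "ideal (colon R N s) R"
proof -
  interpret N: ideal N R by fact
  show ?thesis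
  proof (rule idealI[OF ring_axioms])
    show "subgroup (colon R N s) (add_monoid R)"
    proof (rule add.subgroupI)
      show "colon R N s \<subseteq> carrier R" by (auto simp: colon_def)
      show "colon R N s \<noteq> {}" using assms(2) by (auto simp: colon_def intro!: exI[of _ \<zero>])
    next
      fix a assume "a \<in> colon R N s"
      thus "\<ominus> a \<in> colon R N s" using assms(2) by (auto simp: colon_def l_minus)
    next
      fix a b assume "a \<in> colon R N s" "b \<in> colon R N s"
      thus "a \<oplus> b \<in> colon R N s" using assms(2) by (auto simp: colon_def l_distr)
    qed
  next
    fix a x assume a: "a \<in> colon R N s" "x \<in> carrier R"
    have "x \<otimes> a \<otimes> s = x \<otimes> (a \<otimes> s)" using a assms by (simp add: colon_def m_assoc)
    thus 1: "x \<otimes> a \<in> colon R N s" using a by (auto simp: colon_def N.I_l_closed)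
    show "a \<otimes> x \<in> colon R N s" using 1 a by (simp add: m_comm colon_def)
  qed
qed

text \<open>The ascending chain condition in the form in which it is used throughout: by Zorn's lemma, since
  the union of a chain of ideals belongs to the chain.\<close>

lemma (in noetherian_ring) exists_maximal_ideal_of:
  assumes "\<F> \<noteq> {}" "\<And>L. L \<in> \<F> \<Longrightarrow> ideal L R"
  shows "\<exists>M\<in>\<F>. \<forall>W\<in>\<F>. M \<subseteq> W \<longrightarrow> W = M"
proof (rule subset_Zorn)
  fix C assume C: "subset.chain \<F> C"
  show "\<exists>U\<in>\<F>. \<forall>W\<in>C. W \<subseteq> U"
  proof (cases "C = {}")
    case True thus ?thesis using assms(1) by auto
  next
    case False
    have "subset.chain {I. ideal I R} C" using C assms(2) by (auto simp: pred_on.chain_def)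
    hence "\<Union>C \<in> C" by (rule ideal_chain_is_trivial[OF False])
    thus ?thesis using C by (auto simp: pred_on.chain_def)
  qed
qed

section \<open>Annihilators modulo an ideal and prime avoidance\<close>

text \<open>If \<open>a b\<close> annihilates \<open>w\<close> modulo \<open>N\<close> but \<open>b\<close> does not, then \<open>b w\<close> is again a nonzero
  element with at least as large an annihilator; by maximality the two annihilators agree, and \<open>a\<close>
  belongs to them. The set \<open>K\<close> makes it possible to find \<open>w\<close> among the multiples that share a
  property with \<open>s\<close>, such as lying in a Frobenius closure.\<close>

lemma (in noetherian_ring) maximal_annihilator_prime:
  assumes "cring R" "ideal N R" "K \<subseteq> carrier R" "\<And>r k. r \<in> carrier R \<Longrightarrow> k \<in> K \<Longrightarrow> r \<otimes> k \<in> K"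
    and "s \<in> K" "s \<notin> N"
  obtains w where "w \<in> K" "w \<notin> N" "primeideal (colon R N w) R" "colon R N s \<subseteq> colon R N w"
    "\<And>v. v \<in> K \<Longrightarrow> v \<notin> N \<Longrightarrow> colon R N w \<subseteq> colon R N v \<Longrightarrow> colon R N v = colon R N w"
proof -
  interpret cring R by fact
  interpret N: ideal N R by fact
  let ?S = "{colon R N w | w. w \<in> K \<and> w \<notin> N \<and> colon R N s \<subseteq> colon R N w}"
  have ne: "?S \<noteq> {}" using assms(5,6) by auto
  have id: "ideal L R" if "L \<in> ?S" for L
    using that assms(3) by (auto intro!: colon_ideal[OF assms(2)])
  from exists_maximal_ideal_of[OF ne id]
  obtain M where M: "M \<in> ?S" "\<forall>L\<in>?S. M \<subseteq> L \<longrightarrow> L = M" by (rule bexE)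
  from M(1) obtain w where w: "w \<in> K" "w \<notin> N" "colon R N s \<subseteq> colon R N w" "M = colon R N w" by auto
  have wc: "w \<in> carrier R" using w assms(3) by auto
  have max: "colon R N v = colon R N w" if "v \<in> K" "v \<notin> N" "colon R N w \<subseteq> colon R N v" for v
    using M(2)[rule_format, of "colon R N v"] that w by auto
  have "primeideal (colon R N w) R"
  proof (rule primeidealI[OF colon_ideal[OF assms(2) wc] assms(1)])
    show "carrier R \<noteq> colon R N w"
    proof
      assume "carrier R = colon R N w"
      hence "\<one> \<in> colon R N w" by auto
      thus False using w(2) wc by (simp add: colon_def)
    qed
  next
    fix a b assume ab: "a \<in> carrier R" "b \<in> carrier R" "a \<otimes> b \<in> colon R N w"
    show "a \<in> colon R N w \<or> b \<in> colon R N w"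
    proof (cases "b \<otimes> w \<in> N")
      case False
      have bw: "b \<otimes> w \<in> K" using assms(4) ab w by auto
      have "colon R N w \<subseteq> colon R N (b \<otimes> w)"
      proof
        fix r assume r: "r \<in> colon R N w"
        have "r \<otimes> (b \<otimes> w) = b \<otimes> (r \<otimes> w)" using r ab wc by (simp add: colon_def m_lcomm)
        thus "r \<in> colon R N (b \<otimes> w)" using r ab by (auto simp: colon_def N.I_l_closed)
      qed
      hence "colon R N (b \<otimes> w) = colon R N w" using max[OF bw False] by blast
      moreover have "a \<in> colon R N (b \<otimes> w)" using ab wc by (simp add: colon_def m_assoc)
      ultimately show ?thesis by auto
    qed (use ab in \<open>auto simp: colon_def\<close>)
  qed
  thus ?thesis using that w max by blast
qed

definition zero_divisors_mod :: "('a, 'b) ring_scheme \<Rightarrow> 'a set \<Rightarrow> 'a set" where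
  "zero_divisors_mod R N = {r \<in> carrier R. \<exists>s\<in>carrier R. s \<notin> N \<and> r \<otimes>\<^bsub>R\<^esub> s \<in> N}"

text \<open>A product of elements outside \<open>P\<close>, one from each ideal, lies in the intersection and outside \<open>P\<close>.\<close>

lemma (in cring) prime_contains_finite_Inter:
  assumes "primeideal P R" "finite T" "\<And>L. L \<in> T \<Longrightarrow> ideal L R" "carrier R \<inter> \<Inter>T \<subseteq> P"
  shows "\<exists>L\<in>T. L \<subseteq> P"
proof (rule ccontr)
  interpret P: primeideal P R by fact
  assume neg: "\<not> ?thesis"
  have "\<exists>x\<in>carrier R. x \<in> \<Inter>T \<and> x \<notin> P" using assms(2) assms(3) neg
  proof (induction T)
    case empty
    show ?case using P.I_notcarr P.Icarr by auto
  next
    case (insert L T)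
    then obtain x where x: "x \<in> carrier R" "x \<in> \<Inter>T" "x \<notin> P" by auto
    from insert obtain j where j: "j \<in> L" "j \<notin> P" by auto
    have L: "ideal L R" using insert by auto
    hence jc: "j \<in> carrier R" using j ideal.Icarr by metis
    have "x \<otimes> j \<notin> P" using P.I_prime x j jc by auto
    moreover have "x \<otimes> j \<in> L" using ideal.I_l_closed[OF L] x j by auto
    moreover have "x \<otimes> j \<in> L'" if "L' \<in> T" for L'
      using that insert.prems(1)[of L'] x jc by (auto intro!: ideal.I_r_closed)
    ultimately show ?case using x jc by (intro bexI[of _ "x \<otimes> j"]) auto
  qed
  thus False using assms(4) by auto
qed

text \<open>Every annihilator is contained in a maximal one, which is prime. Only finitely many of these occur:
  the elements \<open>s\<close> with maximal annihilator generate an ideal that is already generated by a finite set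
  \<open>T\<close> of them. So what annihilates \<open>T\<close> annihilates each such \<open>s\<close>, and the prime annihilator of \<open>s\<close>
  contains that of some \<open>t \<in> T\<close>. By maximality they are equal.\<close>

lemma (in noetherian_ring) finite_associated_primes:
  assumes "cring R" "ideal N R"
  obtains \<P> where "finite \<P>" "zero_divisors_mod R N = \<Union>\<P>"
    "\<And>P. P \<in> \<P> \<Longrightarrow> primeideal P R \<and> (\<exists>s\<in>carrier R. s \<notin> N \<and> P = colon R N s)"
proof -
  interpret cring R by fact
  interpret N: ideal N R by fact
  define top where "top s \<longleftrightarrow> s \<in> carrier R \<and> s \<notin> N \<and> primeideal (colon R N s) R \<and>
      (\<forall>v\<in>carrier R. v \<notin> N \<longrightarrow> colon R N s \<subseteq> colon R N v \<longrightarrow> colon R N v = colon R N s)" for s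
  let ?S = "{Idl T | T. finite T \<and> T \<subseteq> Collect top}"
  have sub: "T \<subseteq> carrier R" if "T \<subseteq> Collect top" for T using that by (auto simp: top_def)
  have ne: "?S \<noteq> {}" by auto
  have id: "ideal L R" if "L \<in> ?S" for L using that sub by (auto intro!: genideal_ideal)
  from exists_maximal_ideal_of[OF ne id]
  obtain M where M: "M \<in> ?S" "\<forall>L\<in>?S. M \<subseteq> L \<longrightarrow> L = M" by (rule bexE)
  from M(1) obtain T where T: "finite T" "T \<subseteq> Collect top" "M = Idl T" by auto
  have all: "s \<in> Idl T" if "top s" for s
  proof -
    have i: "insert s T \<subseteq> Collect top" using that T by auto
    have "Idl T \<subseteq> Idl (insert s T)" using sub[OF i] by (intro Idl_mono) auto
    hence "Idl (insert s T) = Idl T" using M(2)[rule_format, of "Idl (insert s T)"] T i by auto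
    thus ?thesis using genideal_self[OF sub[OF i]] by simp
  qed
  let ?P = "colon R N ` T"
  show thesis
  proof
    show "finite ?P" using T by simp
    fix P assume "P \<in> ?P"
    then obtain t where t: "t \<in> T" "P = colon R N t" by auto
    hence "top t" using T by auto
    thus "primeideal P R \<and> (\<exists>s\<in>carrier R. s \<notin> N \<and> P = colon R N s)"
      using t(2) unfolding top_def by blast
  next
    show "zero_divisors_mod R N = \<Union>?P"
    proof
      show "\<Union>?P \<subseteq> zero_divisors_mod R N"
        using T(2) unfolding zero_divisors_mod_def colon_def top_def by blast
      show "zero_divisors_mod R N \<subseteq> \<Union>?P"
      proof
        fix r assume "r \<in> zero_divisors_mod R N"
        then obtain s where s: "s \<in> carrier R" "s \<notin> N" "r \<in> colon R N s"
          by (auto simp: zero_divisors_mod_def colon_def)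
        obtain w where w: "w \<in> carrier R" "w \<notin> N" "primeideal (colon R N w) R"
          "colon R N s \<subseteq> colon R N w"
          "\<And>v. v \<in> carrier R \<Longrightarrow> v \<notin> N \<Longrightarrow> colon R N w \<subseteq> colon R N v \<Longrightarrow> colon R N v = colon R N w"
          using maximal_annihilator_prime[OF assms, of "carrier R" s] s by auto
        hence "top w" by (auto simp: top_def)
        hence wT: "w \<in> Idl T" by (rule all)
        have "carrier R \<inter> \<Inter>?P \<subseteq> colon R N w"
        proof
          fix u assume u: "u \<in> carrier R \<inter> \<Inter>?P"
          have "Idl T \<subseteq> colon R N u"
          proof (rule genideal_minimal)
            show "ideal (colon R N u) R" using u colon_ideal[OF assms(2)] by simp
            show "T \<subseteq> colon R N u" 
            using u sub[OF T(2)] m_comm[of u] by (auto simp: colon_def subset_iff)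
          qed
          thus "u \<in> colon R N w" using wT w u by (auto simp: colon_def m_comm)
        qed
        then obtain L where L: "L \<in> ?P" "L \<subseteq> colon R N w"
          using prime_contains_finite_Inter[OF w(3), of ?P] T(1) sub[OF T(2)] colon_ideal[OF assms(2)]
          by blast
        then obtain t where t: "t \<in> T" "L = colon R N t" by auto
        moreover from t have "top t" using T by auto
        ultimately have "colon R N w = L" using L(2) w(1,2) unfolding top_def by blast
        thus "r \<in> \<Union>?P" using s w t by auto
      qed
    qed
  qed
qed

text \<open>Induction on the number of primes. A minimal member \<open>P\<close> is treated last: if the element \<open>x + a\<close>
  found for the others lies in \<open>P\<close>, add \<open>b c\<close> with \<open>b \<in> L - P\<close> and with \<open>c\<close> in all the other primes
  but not in \<open>P\<close>. Such a \<open>c\<close> exists because no other prime is contained in \<open>P\<close>.\<close>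

lemma (in cring) coset_prime_avoidance:
  assumes "finite \<P>" "\<And>P. P \<in> \<P> \<Longrightarrow> primeideal P R" "ideal L R" "x \<in> carrier R"
    "\<And>P. P \<in> \<P> \<Longrightarrow> x \<in> P \<Longrightarrow> \<not> L \<subseteq> P"
  shows "\<exists>a\<in>L. x \<oplus> a \<notin> \<Union>\<P>"
  using assms(1,2,5)
proof (induction \<P> rule: finite_psubset_induct)
  case (psubset \<P>)
  interpret L: ideal L R by fact
  show ?case
  proof (cases "\<P> = {}")
    case True thus ?thesis using L.zero_closed by blast
  next
    case False
    then obtain P where P: "P \<in> \<P>" and min: "\<And>Q. Q \<in> \<P> \<Longrightarrow> Q \<subseteq> P \<Longrightarrow> Q = P"
      using finite_has_minimal[OF psubset.hyps(1) False] by metis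
    let ?Q = "\<P> - {P}"
    have "\<exists>a\<in>L. x \<oplus> a \<notin> \<Union>?Q"
      using P psubset.prems by (intro psubset.IH) auto
    then obtain a where a: "a \<in> L" "x \<oplus> a \<notin> \<Union>?Q" by auto
    have Pp: "primeideal P R" using P psubset.prems by auto
    interpret P: ideal P R using Pp by (rule primeideal.axioms(1))
    have ac: "a \<in> carrier R" using a L.Icarr by auto
    show ?thesis
    proof (cases "x \<oplus> a \<in> P")
      case False thus ?thesis using a by auto
    next
      case True
      have "\<not> L \<subseteq> P"
      proof
        assume JP: "L \<subseteq> P"
        have "(x \<oplus> a) \<ominus> a \<in> P" using True JP a ac assms(4) by (auto simp: a_minus_def)
        moreover have "(x \<oplus> a) \<ominus> a = x" using ac assms(4) by (intro add_minus_cancel)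
        ultimately show False using psubset.prems(2)[OF P] JP by auto
      qed
      then obtain b where b: "b \<in> L" "b \<notin> P" by auto
      have "\<not> (carrier R \<inter> \<Inter>?Q \<subseteq> P)"
      proof
        assume "carrier R \<inter> \<Inter>?Q \<subseteq> P"
        hence "\<exists>Q\<in>?Q. Q \<subseteq> P"
          using psubset by (intro prime_contains_finite_Inter)
            (auto intro: Pp primeideal.axioms(1))
        thus False using min by auto
      qed
      then obtain c where c: "c \<in> carrier R" "\<And>Q. Q \<in> \<P> \<Longrightarrow> Q \<noteq> P \<Longrightarrow> c \<in> Q" "c \<notin> P" by auto
      have bc: "b \<in> carrier R" using b L.Icarr by auto
      have "x \<oplus> (a \<oplus> b \<otimes> c) \<notin> Q" if Q: "Q \<in> \<P>" for Q
      proof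
        assume in_Q: "x \<oplus> (a \<oplus> b \<otimes> c) \<in> Q"
        interpret Q: ideal Q R using psubset.prems(1)[OF Q] by (rule primeideal.axioms(1))
        show False
        proof (cases "Q = P")
          case True
          have "x \<oplus> (a \<oplus> b \<otimes> c) \<ominus> (x \<oplus> a) \<in> P"
            using in_Q True \<open>x \<oplus> a \<in> P\<close> by (auto simp: a_minus_def)
          moreover have "x \<oplus> (a \<oplus> b \<otimes> c) \<ominus> (x \<oplus> a) = b \<otimes> c" using assms(4) ac bc c by algebra
          ultimately show False using primeideal.I_prime[OF Pp bc c(1)] b(2) c(3) by auto
        next
          case False
          have "x \<oplus> (a \<oplus> b \<otimes> c) \<ominus> b \<otimes> c \<in> Q"
            using in_Q c(2)[OF Q False] bc by (auto simp: a_minus_def intro!: Q.a_closed Q.I_l_closed)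
          moreover have "x \<oplus> (a \<oplus> b \<otimes> c) \<ominus> b \<otimes> c = x \<oplus> a" using assms(4) ac bc c by algebra
          ultimately show False using a Q False by auto
        qed
      qed
      moreover have "a \<oplus> b \<otimes> c \<in> L" using a b c by (auto intro!: L.a_closed L.I_r_closed)
      ultimately show ?thesis by blast
    qed
  qed
qed

section \<open>Noetherian local rings\<close>

locale noetherian_local_ring = noetherian_ring R + cring R for R (structure) +
  fixes \<mm>
  assumes local: "local_ring R \<mm>"
begin

lemma max_ideal: "maximalideal \<mm> R"
  using local by (simp add: local_ring_def)

sublocale max: ideal \<mm> R
  using max_ideal by (rule maximalideal.axioms(1))

lemma max_prime: "primeideal \<mm> R"
  using max_ideal by (rule maximalideal_prime)

lemma proper_ideal_subset_max:
  assumes "ideal N R" "N \<noteq> carrier R"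
  shows "N \<subseteq> \<mm>"
proof -
  let ?F = "{L. ideal L R \<and> N \<subseteq> L \<and> L \<noteq> carrier R}"
  have ne: "?F \<noteq> {}" using assms by auto
  have id: "ideal L R" if "L \<in> ?F" for L using that by auto
  from exists_maximal_ideal_of[OF ne id]
  obtain M where M: "M \<in> ?F" "\<forall>L\<in>?F. M \<subseteq> L \<longrightarrow> L = M" by (rule bexE)
  have "maximalideal M R"
  proof (rule maximalidealI)
    show "ideal M R" "carrier R \<noteq> M" using M by auto
    show "L = M \<or> L = carrier R" if "ideal L R" "M \<subseteq> L" for L
      using that M by auto
  qed
  hence "M = \<mm>" using local by (auto simp: local_ring_def)
  thus ?thesis using M by auto
qed

lemma prime_eq_max:
  assumes "primeideal P R" "\<mm> \<subseteq> P" shows "P = \<mm>"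
proof -
  interpret P: primeideal P R by fact
  show ?thesis
    using maximalideal.I_maximal[OF max_ideal P.is_ideal assms(2)] P.I_notcarr P.a_subset by auto
qed

lemma unit_if_not_in_max:
  assumes "r \<in> carrier R" "r \<notin> \<mm>"
  shows "\<exists>s\<in>carrier R. s \<otimes> r = \<one>"
proof -
  have "PIdl r = carrier R"
    using proper_ideal_subset_max[OF cgenideal_ideal[OF assms(1)]] cgenideal_self[OF assms(1)] assms(2)
    by auto
  hence "\<one> \<in> PIdl r" by simp
  thus ?thesis by (auto simp: cgenideal_def)
qed

lemma one_notin_max: "\<one> \<notin> \<mm>"
  using max.one_imp_carrier maximalideal.I_notcarr[OF max_ideal] by auto

text \<open>Otherwise choose \<open>M\<close> maximal among the ideals with \<open>N \<subseteq> M \<subset> K\<close>, and \<open>a \<in> K - M\<close>. Then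
  \<open>K = M + a R\<close>, and \<open>a \<in> N + x K\<close> gives \<open>(1 - x r) a \<in> M\<close> for some \<open>r\<close>, where \<open>1 - x r\<close> is a unit.\<close>

lemma nakayama_principal:
  assumes N: "ideal N R" and K: "ideal K R" and NK: "N \<subseteq> K" and x: "x \<in> \<mm>"
    and step: "\<And>k. k \<in> K \<Longrightarrow> \<exists>n\<in>N. \<exists>l\<in>K. k = n \<oplus> x \<otimes> l"
  shows "K = N"
proof (rule ccontr)
  assume "K \<noteq> N"
  let ?F = "{L. ideal L R \<and> N \<subseteq> L \<and> L \<subseteq> K \<and> L \<noteq> K}"
  have ne: "?F \<noteq> {}" using N NK \<open>K \<noteq> N\<close> by auto
  have id: "ideal L R" if "L \<in> ?F" for L using that by auto
  from exists_maximal_ideal_of[OF ne id]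
  obtain M where M: "M \<in> ?F" "\<forall>L\<in>?F. M \<subseteq> L \<longrightarrow> L = M" by (rule bexE)
  interpret M: ideal M R using M by auto
  interpret K: ideal K R by fact
  have xc: "x \<in> carrier R" using x max.Icarr by auto
  obtain a where a: "a \<in> K" "a \<notin> M" using M by auto
  have ac: "a \<in> carrier R" using a K.Icarr by auto
  have sub: "insert a M \<subseteq> carrier R" using ac M.a_subset by auto
  have aM: "insert a M \<subseteq> Idl (insert a M)" by (rule genideal_self[OF sub])
  have "Idl (insert a M) = K"
  proof (rule ccontr)
    assume "Idl (insert a M) \<noteq> K"
    moreover have "Idl (insert a M) \<subseteq> K" using a M by (intro genideal_minimal[OF K]) auto
    ultimately have "Idl (insert a M) = M"
      using M(2)[rule_format, of "Idl (insert a M)"] aM genideal_ideal[OF sub] M(1) by auto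
    thus False using a aM by auto
  qed
  hence IdlK: "Idl (insert a M) = K" .
  from step[OF a(1)] obtain n k where nk: "n \<in> N" "k \<in> K" "a = n \<oplus> x \<otimes> k" by blast
  have "k \<in> Idl (insert a M)" using nk IdlK by simp
  then obtain m r where mr: "m \<in> M" "r \<in> carrier R" "k = m \<oplus> r \<otimes> a"
    unfolding Idl_insert_iff[OF M.is_ideal ac] by blast
  have nc: "n \<in> M" "n \<in> carrier R" "m \<in> carrier R" using nk(1) M(1) M.Icarr mr(1) by auto
  have "\<one> \<ominus> x \<otimes> r \<notin> \<mm>"
  proof
    assume "\<one> \<ominus> x \<otimes> r \<in> \<mm>"
    moreover have "x \<otimes> r \<in> \<mm>" using x mr(2) by (simp add: max.I_r_closed)
    ultimately have "(\<one> \<ominus> x \<otimes> r) \<oplus> x \<otimes> r \<in> \<mm>" by (rule max.a_closed)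
    moreover have "(\<one> \<ominus> x \<otimes> r) \<oplus> x \<otimes> r = \<one>" using xc mr(2) by algebra
    ultimately show False using one_notin_max by simp
  qed
  then obtain s where s: "s \<in> carrier R" "s \<otimes> (\<one> \<ominus> x \<otimes> r) = \<one>"
    using unit_if_not_in_max[of "\<one> \<ominus> x \<otimes> r"] xc mr(2) by auto
  have aeq: "a = n \<oplus> x \<otimes> (m \<oplus> r \<otimes> a)" using nk(3) unfolding mr(3) .
  have "(\<one> \<ominus> x \<otimes> r) \<otimes> a = a \<ominus> x \<otimes> r \<otimes> a"
    using xc mr(2) ac by algebra
  also have "\<dots> = n \<oplus> x \<otimes> (m \<oplus> r \<otimes> a) \<ominus> x \<otimes> r \<otimes> a" by (subst (1) aeq) (rule refl)
  also have "\<dots> = n \<oplus> x \<otimes> m" using xc mr(2) ac nc by algebra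
  also have "\<dots> \<in> M" using nc xc mr(1) by (simp add: M.I_l_closed)
  finally have "s \<otimes> ((\<one> \<ominus> x \<otimes> r) \<otimes> a) \<in> M" using s by (simp add: M.I_l_closed)
  hence "(s \<otimes> (\<one> \<ominus> x \<otimes> r)) \<otimes> a \<in> M" 
    using m_assoc[OF s(1), of "\<one> \<ominus> x \<otimes> r" a] xc mr(2) ac by simp
  thus False using s ac a by simp
qed

end

section \<open>Regular sequences modulo an ideal\<close>

text \<open>Weak regularity on \<open>R/N\<close>, stated for ideals of \<open>R\<close> so that the successive quotients stay comparable.
  For a proper ideal \<open>N\<close> of a local ring and elements of the maximal ideal, \<open>N + (xs) \<noteq> R\<close> holds
  automatically.\<close>

primrec regular_mod :: "('a, 'b) ring_scheme \<Rightarrow> 'a set \<Rightarrow> 'a list \<Rightarrow> bool" where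
  "regular_mod R N [] \<longleftrightarrow> True"
| "regular_mod R N (x # xs) \<longleftrightarrow>
     (\<forall>v\<in>carrier R. x \<otimes>\<^bsub>R\<^esub> v \<in> N \<longrightarrow> v \<in> N) \<and> regular_mod R (Idl\<^bsub>R\<^esub> (insert x N)) xs"

context cring
begin

lemma Idl_ideal_Un:
  assumes "ideal N R" "A \<subseteq> carrier R"
  shows "ideal (Idl (N \<union> A)) R" "N \<subseteq> Idl (N \<union> A)" "A \<subseteq> Idl (N \<union> A)"
proof -
  have sub: "N \<union> A \<subseteq> carrier R" using assms ideal.Icarr[OF assms(1)] by auto
  show "ideal (Idl (N \<union> A)) R" by (rule genideal_ideal[OF sub])
  show "N \<subseteq> Idl (N \<union> A)" "A \<subseteq> Idl (N \<union> A)" using genideal_self[OF sub] by auto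
qed

lemma Idl_ideal_insert:
  assumes "ideal N R" "x \<in> carrier R"
  shows "ideal (Idl (insert x N)) R" "N \<subseteq> Idl (insert x N)" "x \<in> Idl (insert x N)"
  using Idl_ideal_Un[of N "{x}"] assms by auto

lemma Idl_Idl_Un:
  assumes "ideal N R" "A \<subseteq> carrier R" "B \<subseteq> carrier R"
  shows "Idl (Idl (N \<union> A) \<union> B) = Idl (N \<union> A \<union> B)"
proof -
  have "Idl (B \<union> Idl (N \<union> A)) = Idl (B \<union> (N \<union> A))"
    using assms ideal.Icarr[OF assms(1)] by (intro Idl_Un_Idl) auto
  thus ?thesis by (simp add: ac_simps Un_commute)
qed

lemma Idl_insert_Idl:
  assumes "ideal N R" "A \<subseteq> carrier R" "x \<in> carrier R"
  shows "Idl (insert x (Idl (N \<union> A))) = Idl (N \<union> insert x A)"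
  using Idl_Idl_Un[of N A "{x}"] assms by simp

lemma Idl_Idl_insert_Un:
  assumes "ideal N R" "A \<subseteq> carrier R" "x \<in> carrier R"
  shows "Idl (Idl (insert x N) \<union> A) = Idl (N \<union> insert x A)"
  using Idl_Idl_Un[of N "{x}" A] assms by simp

lemma regular_mod_append:
  assumes "ideal N R" "set xs \<subseteq> carrier R" "set ys \<subseteq> carrier R"
  shows "regular_mod R N (xs @ ys) \<longleftrightarrow> regular_mod R N xs \<and> regular_mod R (Idl (N \<union> set xs)) ys"
  using assms
proof (induction xs arbitrary: N)
  case Nil thus ?case by (simp add: Idl_ideal)
next
  case (Cons x xs)
  have "ideal (Idl (insert x N)) R" using Cons.prems by (intro Idl_ideal_insert) auto
  thus ?case using Cons Idl_Idl_insert_Un[of N "set xs" x] by simp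
qed

lemma regular_mod_snoc:
  assumes "ideal N R" "set xs \<subseteq> carrier R" "x \<in> carrier R"
  shows "regular_mod R N (xs @ [x]) \<longleftrightarrow> regular_mod R N xs \<and>
    (\<forall>v\<in>carrier R. x \<otimes> v \<in> Idl (N \<union> set xs) \<longrightarrow> v \<in> Idl (N \<union> set xs))"
  using regular_mod_append[of N xs "[x]"] assms by simp

lemma regular_mod_nth:
  assumes "ideal N R" "set xs \<subseteq> carrier R"
  shows "regular_mod R N xs \<longleftrightarrow> (\<forall>i<length xs. \<forall>v\<in>carrier R.
    xs ! i \<otimes> v \<in> Idl (N \<union> set (take i xs)) \<longrightarrow> v \<in> Idl (N \<union> set (take i xs)))"
  using assms(2)
proof (induction xs rule: rev_induct)
  case Nil thus ?case by simp
next
  case (snoc x xs)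
  have sc: "set xs \<subseteq> carrier R" "x \<in> carrier R" using snoc.prems by auto
  have tk: "take i (xs @ [x]) = take i xs" "(xs @ [x]) ! i = xs ! i" if "i < length xs" for i
    using that by (simp_all add: nth_append)
  show ?case
    unfolding regular_mod_snoc[OF assms(1) sc] snoc.IH[OF sc(1)] length_append_singleton
      All_less_Suc by (auto simp: tk)
qed

text \<open>Here \<open>0 \<rightarrow> R/C \<rightarrow> R/A \<rightarrow> R/B \<rightarrow> 0\<close> is exact, its first map being multiplication by \<open>c\<close>: a sequence
  that is regular on the two outer modules is regular on the middle one. The hypotheses persist when
  the first element of the sequence is added to all three ideals.\<close>

lemma regular_mod_extension:
  assumes "ideal A R" "ideal C R" "c \<in> carrier R" "set zs \<subseteq> carrier R"
    and "B = Idl (insert c A)" "C = colon R A c"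
    and "regular_mod R C zs" "regular_mod R B zs"
  shows "regular_mod R A zs"
  using assms
proof (induction zs arbitrary: A B C)
  case Nil thus ?case by simp
next
  case (Cons z zs)
  interpret A: ideal A R by fact
  interpret C: ideal C R by fact
  have z: "z \<in> carrier R" using Cons.prems(4) by simp
  note c = \<open>c \<in> carrier R\<close>
  have B: "u \<in> B \<longleftrightarrow> (\<exists>a\<in>A. \<exists>r\<in>carrier R. u = a \<oplus> r \<otimes> c)" for u
    unfolding Cons.prems(5) by (rule Idl_insert_iff[OF A.is_ideal c])
  have Cm: "r \<in> C \<longleftrightarrow> r \<in> carrier R \<and> r \<otimes> c \<in> A" for r unfolding Cons.prems(6) colon_def by simp
  have Breg: "v \<in> B" if "v \<in> carrier R" "z \<otimes> v \<in> B" for v using Cons.prems(8) that by simp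
  have Creg: "v \<in> C" if "v \<in> carrier R" "z \<otimes> v \<in> C" for v using Cons.prems(7) that by simp
  have AB: "A \<subseteq> B" unfolding Cons.prems(5) by (rule Idl_ideal_insert(2)[OF A.is_ideal c])
  let ?A = "Idl (insert z A)"
  have Am: "u \<in> ?A \<longleftrightarrow> (\<exists>a\<in>A. \<exists>r\<in>carrier R. u = a \<oplus> r \<otimes> z)" for u
    by (rule Idl_insert_iff[OF A.is_ideal z])
  have first: "v \<in> A" if v: "v \<in> carrier R" "z \<otimes> v \<in> A" for v
  proof -
    obtain a r where ar: "a \<in> A" "r \<in> carrier R" "v = a \<oplus> r \<otimes> c"
      using Breg[OF v(1)] v(2) AB B by blast
    have ac: "a \<in> carrier R" using ar A.Icarr by auto
    have "z \<otimes> v \<ominus> z \<otimes> a \<in> A" 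
      using v(2) ar(1) z A.I_l_closed by (simp add: a_minus_def)
    moreover have "z \<otimes> v \<ominus> z \<otimes> a = z \<otimes> r \<otimes> c" unfolding ar(3) using z ac ar(2) c by algebra
    ultimately have "z \<otimes> r \<in> C" using z ar(2) Cm by simp
    hence "r \<otimes> c \<in> A" using Creg[OF ar(2)] Cm by blast
    thus ?thesis unfolding ar(3) using ar(1) by (rule A.a_closed[rotated])
  qed
  have "regular_mod R ?A zs"
  proof (rule Cons.IH)
    show "ideal ?A R" "ideal (Idl (insert z C)) R" "c \<in> carrier R" "set zs \<subseteq> carrier R"
      "Idl (insert c ?A) = Idl (insert c ?A)"
      using Idl_ideal_insert(1) A.is_ideal C.is_ideal z c Cons.prems(4) by auto
    show "regular_mod R (Idl (insert z C)) zs" using Cons.prems(7) by simp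
    have "Idl (insert c ?A) = Idl (insert z B)"
      using Cons.prems(5) Idl_Idl_Un[OF A.is_ideal, of "{z}" "{c}"]
        Idl_Idl_Un[OF A.is_ideal, of "{c}" "{z}"] z c by (simp add: insert_commute)
    thus "regular_mod R (Idl (insert c ?A)) zs" using Cons.prems(8) by simp
    show "Idl (insert z C) = colon R ?A c"
    proof (rule Set.set_eqI)
      fix r
      show "r \<in> Idl (insert z C) \<longleftrightarrow> r \<in> colon R ?A c"
      proof
        assume "r \<in> Idl (insert z C)"
        then obtain k s where ks: "k \<in> C" "s \<in> carrier R" "r = k \<oplus> s \<otimes> z"
          unfolding Idl_insert_iff[OF C.is_ideal z] by blast
        have kc: "k \<in> carrier R" "k \<otimes> c \<in> A" using ks Cm by auto
        have "r \<otimes> c = k \<otimes> c \<oplus> (s \<otimes> c) \<otimes> z" unfolding ks(3) using kc ks(2) z c by algebra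
        thus "r \<in> colon R ?A c" 
          using kc ks(1,2) c z Am unfolding colon_def
          by (metis (mono_tags, lifting) a_closed ks(3) m_closed mem_Collect_eq)
      next
        assume "r \<in> colon R ?A c"
        then obtain a s where as: "r \<in> carrier R" "a \<in> A" "s \<in> carrier R" "r \<otimes> c = a \<oplus> s \<otimes> z"
          using Am unfolding colon_def by blast
        have ac: "a \<in> carrier R" using as(2) A.Icarr by auto
        have "z \<otimes> s = (\<ominus> a) \<oplus> r \<otimes> c" unfolding as(4) using ac as(3) z by algebra
        hence "z \<otimes> s \<in> B" using B as(1,2) A.a_inv_closed by blast
        then obtain b t where bt: "b \<in> A" "t \<in> carrier R" "s = b \<oplus> t \<otimes> c"
          using Breg[OF as(3)] B by blast
        have bc: "b \<in> carrier R" using bt(1) A.Icarr by auto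
        have "(r \<ominus> t \<otimes> z) \<otimes> c = r \<otimes> c \<ominus> t \<otimes> c \<otimes> z" using as(1) bt(2) z c by algebra
        also have "\<dots> = a \<oplus> b \<otimes> z" unfolding as(4) bt(3) using ac bc bt(2) z c by algebra
        also have "\<dots> \<in> A" using as(2) bt(1) z by (simp add: A.I_r_closed)
        finally have "r \<ominus> t \<otimes> z \<in> C" using Cm as(1) bt(2) z by simp
        moreover have "r = (r \<ominus> t \<otimes> z) \<oplus> t \<otimes> z"
          using as(1) bt(2) z by (simp add: add_minus_cancel)
        ultimately show "r \<in> Idl (insert z C)"
          using Idl_insert_iff[OF C.is_ideal z] bt(2) by blast
      qed
    qed
  qed
  thus ?case using first by simp
qed

text \<open>Induction on \<open>n\<close>, with \<open>R/(N, x\<^sup>n\<^sup>+\<^sup>1)\<close> as an extension of \<open>R/(N, x\<^sup>n)\<close> by \<open>R/(N, x)\<close>.\<close>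

lemma regular_mod_pow_hd:
  fixes n :: nat
  assumes "ideal N R" "x \<in> carrier R" "set zs \<subseteq> carrier R" "regular_mod R N (x # zs)" "0 < n"
  shows "regular_mod R N (x [^] n # zs)"
  using assms(5)
proof (induction n rule: nat_induct_non_zero)
  case 1 thus ?case using assms by simp
next
  case (Suc n)
  note x = assms(2)
  interpret N: ideal N R by fact
  have nzd: "v \<in> N" if "v \<in> carrier R" "x \<otimes> v \<in> N" for v using assms(4) that by simp
  have nzd_pow: "v \<in> N" if "v \<in> carrier R" "x [^] n \<otimes> v \<in> N" for v
    using Suc.IH that by simp
  let ?A = "Idl (insert (x [^] Suc n) N)"
  have Am: "u \<in> ?A \<longleftrightarrow> (\<exists>a\<in>N. \<exists>r\<in>carrier R. u = a \<oplus> r \<otimes> (x [^] n \<otimes> x))" for u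
    using Idl_insert_iff[OF N.is_ideal, of "x [^] Suc n" u] x unfolding nat_pow_Suc by simp
  have A: "ideal ?A R" "N \<subseteq> ?A" "x [^] Suc n \<in> ?A"
    using Idl_ideal_insert[OF N.is_ideal, of "x [^] Suc n"] x by simp_all
  have "regular_mod R ?A zs"
  proof (rule regular_mod_extension)
    show "ideal ?A R" by fact
    show "ideal (Idl (insert x N)) R" using Idl_ideal_insert(1)[OF N.is_ideal x] .
    show "x [^] n \<in> carrier R" "set zs \<subseteq> carrier R" using x assms(3) by auto
    show "Idl (insert (x [^] n) N) = Idl (insert (x [^] n) ?A)"
    proof -
      let ?B = "Idl (insert (x [^] n) N)"
      have B: "ideal ?B R" "N \<subseteq> ?B" "x [^] n \<in> ?B"
        using Idl_ideal_insert[OF N.is_ideal, of "x [^] n"] x by simp_all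
      interpret B: ideal ?B R by fact
      have "x [^] Suc n \<in> ?B" using B(3) x by (simp add: B.I_r_closed)
      hence "?A \<subseteq> ?B" using B by (intro genideal_minimal) auto
      moreover have C: "ideal (Idl (insert (x [^] n) ?A)) R" "?A \<subseteq> Idl (insert (x [^] n) ?A)"
        "x [^] n \<in> Idl (insert (x [^] n) ?A)"
        using Idl_ideal_insert[OF A(1), of "x [^] n"] x by simp_all
      moreover have "?B \<subseteq> Idl (insert (x [^] n) ?A)" using A C by (intro genideal_minimal) auto
      moreover have "Idl (insert (x [^] n) ?A) \<subseteq> ?B" using B \<open>?A \<subseteq> ?B\<close> by (intro genideal_minimal) auto
      ultimately show ?thesis by auto
    qed
    show "regular_mod R (Idl (insert x N)) zs" "regular_mod R (Idl (insert (x [^] n) N)) zs"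
      using assms(4) Suc.IH by simp_all
    show "Idl (insert x N) = colon R ?A (x [^] n)"
    proof (rule Set.set_eqI)
      fix r
      show "r \<in> Idl (insert x N) \<longleftrightarrow> r \<in> colon R ?A (x [^] n)"
      proof
        assume "r \<in> Idl (insert x N)"
        then obtain k s where ks: "k \<in> N" "s \<in> carrier R" "r = k \<oplus> s \<otimes> x"
          unfolding Idl_insert_iff[OF N.is_ideal x] by blast
        have kc: "k \<in> carrier R" "k \<otimes> x [^] n \<in> N" using ks(1) x N.Icarr by (auto simp: N.I_r_closed)
        have p: "x [^] n \<in> carrier R" using x by simp
        have "r \<otimes> x [^] n = k \<otimes> x [^] n \<oplus> s \<otimes> (x [^] n \<otimes> x)"
          unfolding ks(3) using kc(1) ks(2) x p
          by (simp add: l_distr m_assoc m_comm[of x])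
        thus "r \<in> colon R ?A (x [^] n)" 
          using kc ks(1,2) x p Am unfolding colon_def
          by (metis (mono_tags, lifting) a_closed ks(3) m_closed mem_Collect_eq)
      next
        assume "r \<in> colon R ?A (x [^] n)"
        then obtain a s where as: "r \<in> carrier R" "a \<in> N" "s \<in> carrier R"
          "r \<otimes> x [^] n = a \<oplus> s \<otimes> (x [^] n \<otimes> x)"
          using Am unfolding colon_def by blast
        have ac: "a \<in> carrier R" using as(2) N.Icarr by auto
        obtain y where y: "y = x [^] n" by simp
        have yc: "y \<in> carrier R" using x y by simp
        have "y \<otimes> (r \<ominus> s \<otimes> x) = r \<otimes> y \<ominus> s \<otimes> (y \<otimes> x)" using as(1,3) x yc by algebra
        also have "\<dots> = a" unfolding y as(4) using ac as(3) x by (simp add: add_minus_cancel)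
        finally have "y \<otimes> (r \<ominus> s \<otimes> x) \<in> N" using as(2) by simp
        hence "r \<ominus> s \<otimes> x \<in> N" using nzd_pow[of "r \<ominus> s \<otimes> x"] as(1,3) x y by simp
        moreover have "r = (r \<ominus> s \<otimes> x) \<oplus> s \<otimes> x"
          using as(1,3) x by (simp add: add_minus_cancel)
        ultimately show "r \<in> Idl (insert x N)"
          using Idl_insert_iff[OF N.is_ideal x] as(3) by blast
      qed
    qed
  qed
  moreover have "v \<in> N" if v: "v \<in> carrier R" "x [^] Suc n \<otimes> v \<in> N" for v
  proof -
    have "x [^] n \<otimes> (x \<otimes> v) \<in> N" using v x by (simp add: m_assoc)
    hence "x \<otimes> v \<in> N" by (rule nzd_pow[rotated]) (use v x in simp)
    thus ?thesis by (rule nzd[OF v(1)])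
  qed
  ultimately show ?case unfolding regular_mod.simps by blast
qed

lemma regular_mod_pow:
  fixes n :: nat
  assumes "ideal N R" "set xs \<subseteq> carrier R" "regular_mod R N xs" "0 < n"
  shows "regular_mod R N (map (\<lambda>x. x [^] n) xs)"
  using assms(1-3)
proof (induction xs arbitrary: N)
  case (Cons x xs)
  have sc: "x \<in> carrier R" "set xs \<subseteq> carrier R" using Cons.prems(2) by auto
  have r: "regular_mod R N (x [^] n # xs)"
    using Cons.prems(1) sc Cons.prems(3) assms(4) by (rule regular_mod_pow_hd)
  have i: "ideal (Idl (insert (x [^] n) N)) R" using Cons.prems(1) sc by (intro Idl_ideal_insert) auto
  have "regular_mod R (Idl (insert (x [^] n) N)) (map (\<lambda>x. x [^] n) xs)"
    by (rule Cons.IH[OF i sc(2)]) (use r in simp)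
  thus ?case using r unfolding regular_mod.simps list.map by blast
qed simp

end

section \<open>Regular sequences in Noetherian local rings\<close>

text \<open>The socle of \<open>R/N\<close> is nonzero.\<close>

definition depth_zero_mod :: "('a, 'b) ring_scheme \<Rightarrow> 'a set \<Rightarrow> 'a set \<Rightarrow> bool" where
  "depth_zero_mod R \<mm> N \<longleftrightarrow> (\<exists>w\<in>carrier R. w \<notin> N \<and> (\<forall>u\<in>\<mm>. u \<otimes>\<^bsub>R\<^esub> w \<in> N))"

context noetherian_local_ring
begin

lemma max_carrier: "x \<in> \<mm> \<Longrightarrow> x \<in> carrier R"
  by (rule max.Icarr)

text \<open>If \<open>z v \<in> N\<close>, then \<open>v = n + x r\<close> with \<open>n \<in> N\<close> since \<open>z\<close> is regular modulo \<open>N + (x)\<close>, and \<open>z r \<in> N\<close>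
  since \<open>x\<close> is regular modulo \<open>N\<close>. So \<open>(N : z) \<subseteq> N + x (N : z)\<close>, and Nakayama's lemma applies.\<close>

lemma regular_mod_swap:
  assumes N: "ideal N R" and x: "x \<in> \<mm>" and z: "z \<in> \<mm>"
    and reg: "regular_mod R N (x # z # zs)"
  shows "regular_mod R N (z # x # zs)"
proof -
  interpret N: ideal N R by fact
  note c = max_carrier[OF x] max_carrier[OF z]
  have nx: "v \<in> N" if "v \<in> carrier R" "x \<otimes> v \<in> N" for v
    using reg that unfolding regular_mod.simps by blast
  have nz: "v \<in> Idl (insert x N)" if "v \<in> carrier R" "z \<otimes> v \<in> Idl (insert x N)" for v
    using reg that unfolding regular_mod.simps by blast
  have N_sub: "N \<subseteq> Idl (insert x N)" by (rule Idl_ideal_insert(2)[OF N c(1)])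
  have "colon R N z = N"
  proof (rule nakayama_principal[OF N colon_ideal[OF N c(2)] _ x])
    show "N \<subseteq> colon R N z" using c N.I_r_closed by (auto simp: colon_def)
  next
    fix k assume k: "k \<in> colon R N z"
    hence kc: "k \<in> carrier R" "z \<otimes> k \<in> N" using c by (auto simp: colon_def m_comm)
    hence "k \<in> Idl (insert x N)" using nz N_sub by blast
    then obtain n r where nr: "n \<in> N" "r \<in> carrier R" "k = n \<oplus> r \<otimes> x"
      unfolding Idl_insert_iff[OF N c(1)] by blast
    have nc: "n \<in> carrier R" using nr(1) by (rule N.Icarr)
    have "x \<otimes> (r \<otimes> z) = z \<otimes> k \<ominus> z \<otimes> n"
      unfolding nr(3) using nc nr(2) c by algebra
    also have "\<dots> \<in> N" using kc(2) nr(1) c by (simp add: a_minus_def N.I_l_closed)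
    finally have "r \<otimes> z \<in> N" by (rule nx[rotated]) (use nr(2) c in simp)
    hence "r \<in> colon R N z" using nr(2) by (simp add: colon_def)
    moreover have "k = n \<oplus> x \<otimes> r" unfolding nr(3) using nr(2) c by (simp add: m_comm)
    ultimately show "\<exists>n\<in>N. \<exists>l\<in>colon R N z. k = n \<oplus> x \<otimes> l" using nr(1) by blast
  qed
  hence 1: "v \<in> N" if "v \<in> carrier R" "z \<otimes> v \<in> N" for v
    using that c by (auto simp: colon_def m_comm)
  have 2: "v \<in> Idl (insert z N)" if v: "v \<in> carrier R" "x \<otimes> v \<in> Idl (insert z N)" for v
  proof -
    obtain n s where ns: "n \<in> N" "s \<in> carrier R" "x \<otimes> v = n \<oplus> s \<otimes> z"
      using v(2) unfolding Idl_insert_iff[OF N c(2)] by blast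
    have nc: "n \<in> carrier R" using ns(1) by (rule N.Icarr)
    have "z \<otimes> s = (\<ominus> n) \<oplus> v \<otimes> x"
      unfolding m_comm[OF v(1) c(1)] ns(3) using nc ns(2) c by algebra
    hence "z \<otimes> s \<in> Idl (insert x N)"
      unfolding Idl_insert_iff[OF N c(1)] using v(1) ns(1) by blast
    hence "s \<in> Idl (insert x N)" by (rule nz[OF ns(2)])
    then obtain k r where kr: "k \<in> N" "r \<in> carrier R" "s = k \<oplus> r \<otimes> x"
      unfolding Idl_insert_iff[OF N c(1)] by blast
    have kc: "k \<in> carrier R" using kr(1) by (rule N.Icarr)
    have "x \<otimes> (v \<ominus> r \<otimes> z) = x \<otimes> v \<ominus> r \<otimes> x \<otimes> z"
      using v(1) kr(2) c by algebra
    also have "\<dots> = n \<oplus> k \<otimes> z"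
      unfolding ns(3) kr(3) using nc kc kr(2) c by algebra
    also have "\<dots> \<in> N" using ns(1) kr(1) c by (simp add: N.I_r_closed)
    finally have "v \<ominus> r \<otimes> z \<in> N" by (rule nx[rotated]) (use v(1) kr(2) c in simp)
    moreover have "v = (v \<ominus> r \<otimes> z) \<oplus> r \<otimes> z" using v(1) kr(2) c by (simp add: add_minus_cancel)
    ultimately show ?thesis unfolding Idl_insert_iff[OF N c(2)] using kr(2) by blast
  qed
  have "Idl (insert x (Idl (insert z N))) = Idl (insert z (Idl (insert x N)))"
    using Idl_insert_Idl[OF N, of "{z}" x] Idl_insert_Idl[OF N, of "{x}" z] c
    by (simp add: insert_commute)
  hence "regular_mod R (Idl (insert x (Idl (insert z N)))) zs"
    using reg unfolding regular_mod.simps by simp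
  thus ?thesis unfolding regular_mod.simps using 1 2 by blast
qed

lemma regular_mod_rotate:
  assumes "ideal N R" "x \<in> \<mm>" "set zs \<subseteq> \<mm>"
  shows "regular_mod R N (x # zs) \<longleftrightarrow> regular_mod R N (zs @ [x])"
  using assms(1,3)
proof (induction zs arbitrary: N)
  case Nil thus ?case by simp
next
  case (Cons z zs)
  have z: "z \<in> \<mm>" "set zs \<subseteq> \<mm>" using Cons.prems by auto
  have N': "ideal (Idl (insert z N)) R"
    using Cons.prems(1) max_carrier[OF z(1)] by (rule Idl_ideal_insert)
  have "regular_mod R N (x # z # zs) \<longleftrightarrow> regular_mod R N (z # x # zs)"
    using regular_mod_swap[OF Cons.prems(1)] assms(2) z(1) by blast
  also have "\<dots> \<longleftrightarrow> regular_mod R N (z # zs @ [x])"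
    using Cons.IH[OF N' z(2)] unfolding regular_mod.simps(2)[of R N z] by blast
  finally show ?case by simp
qed

lemma set_carrier: "set xs \<subseteq> \<mm> \<Longrightarrow> set xs \<subseteq> carrier R"
  using max.Icarr by blast

text \<open>After \<open>x\<close> has been moved to the end, it acts on a quotient on which \<open>a\<close> acts as zero.\<close>

lemma regular_mod_translate_hd:
  assumes N: "ideal N R" and x: "x \<in> \<mm>" and zs: "set zs \<subseteq> \<mm>" and a: "a \<in> Idl (set zs)"
    and reg: "regular_mod R N (x # zs)"
  shows "regular_mod R N ((x \<oplus> a) # zs)"
proof -
  note zsc = set_carrier[OF zs]
  have "Idl (set zs) \<subseteq> \<mm>" using zs by (intro genideal_minimal max.is_ideal)
  hence am: "a \<in> \<mm>" using a by auto
  note c = max_carrier[OF x] max_carrier[OF am]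
  let ?L = "Idl (N \<union> set zs)"
  interpret L: ideal ?L R by (rule Idl_ideal_Un(1)[OF N zsc])
  have "Idl (set zs) \<subseteq> ?L"
    using Idl_ideal_Un(3)[OF N zsc] by (intro genideal_minimal L.is_ideal)
  hence aL: "a \<in> ?L" using a by auto
  have reg': "regular_mod R N zs" "\<And>v. v \<in> carrier R \<Longrightarrow> x \<otimes> v \<in> ?L \<Longrightarrow> v \<in> ?L"
    using reg unfolding regular_mod_rotate[OF N x zs] regular_mod_snoc[OF N zsc c(1)] by blast+
  have "v \<in> ?L" if v: "v \<in> carrier R" "(x \<oplus> a) \<otimes> v \<in> ?L" for v
  proof -
    have "x \<otimes> v = (x \<oplus> a) \<otimes> v \<ominus> a \<otimes> v"
      using v(1) c by algebra
    also have "\<dots> \<in> ?L" using v aL by (simp add: a_minus_def L.I_r_closed)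
    finally show ?thesis by (rule reg'(2)[OF v(1)])
  qed
  hence "regular_mod R N (zs @ [x \<oplus> a])"
    using reg'(1) unfolding regular_mod_snoc[OF N zsc a_closed[OF c]] by blast
  thus ?thesis unfolding regular_mod_rotate[OF N max.a_closed[OF x am] zs] .
qed

text \<open>If \<open>w\<close> represents a socle element modulo \<open>N + (x)\<close>, write \<open>z w = n + w' x\<close> with \<open>n \<in> N\<close>; then \<open>w'\<close>
  represents a socle element modulo \<open>N + (z)\<close>.\<close>

lemma depth_zero_mod_exchange:
  assumes N: "ideal N R" and x: "x \<in> \<mm>" and z: "z \<in> \<mm>"
    and nx: "\<forall>v\<in>carrier R. x \<otimes> v \<in> N \<longrightarrow> v \<in> N"
    and nz: "\<forall>v\<in>carrier R. z \<otimes> v \<in> N \<longrightarrow> v \<in> N"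
    and dz: "depth_zero_mod R \<mm> (Idl (insert x N))"
  shows "depth_zero_mod R \<mm> (Idl (insert z N))"
proof -
  interpret N: ideal N R by fact
  note c = max_carrier[OF x] max_carrier[OF z]
  obtain w where w: "w \<in> carrier R" "w \<notin> Idl (insert x N)" "\<And>u. u \<in> \<mm> \<Longrightarrow> u \<otimes> w \<in> Idl (insert x N)"
    using dz unfolding depth_zero_mod_def by blast
  obtain n w' where n: "n \<in> N" "w' \<in> carrier R" "z \<otimes> w = n \<oplus> w' \<otimes> x"
    using w(3)[OF z] unfolding Idl_insert_iff[OF N c(1)] by blast
  have nc: "n \<in> carrier R" using n(1) by (rule N.Icarr)
  have "w' \<notin> Idl (insert z N)"
  proof
    assume "w' \<in> Idl (insert z N)"
    then obtain k r where kr: "k \<in> N" "r \<in> carrier R" "w' = k \<oplus> r \<otimes> z"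
      unfolding Idl_insert_iff[OF N c(2)] by blast
    have kc: "k \<in> carrier R" using kr(1) by (rule N.Icarr)
    have "z \<otimes> (w \<ominus> r \<otimes> x) = z \<otimes> w \<ominus> r \<otimes> z \<otimes> x"
      using w(1) kr(2) c by algebra
    also have "\<dots> = n \<oplus> k \<otimes> x"
      unfolding n(3) kr(3) using nc kc kr(2) c by algebra
    also have "\<dots> \<in> N" using n(1) kr(1) c by (simp add: N.I_r_closed)
    finally have "w \<ominus> r \<otimes> x \<in> N" using nz w(1) kr(2) c by blast
    moreover have "w = (w \<ominus> r \<otimes> x) \<oplus> r \<otimes> x" using w(1) kr(2) c by (simp add: add_minus_cancel)
    ultimately have "w \<in> Idl (insert x N)" unfolding Idl_insert_iff[OF N c(1)] using kr(2) by blast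
    thus False using w(2) by simp
  qed
  moreover have "u \<otimes> w' \<in> Idl (insert z N)" if u: "u \<in> \<mm>" for u
  proof -
    have uc: "u \<in> carrier R" by (rule max_carrier[OF u])
    obtain k r where kr: "k \<in> N" "r \<in> carrier R" "u \<otimes> w = k \<oplus> r \<otimes> x"
      using w(3)[OF u] unfolding Idl_insert_iff[OF N c(1)] by blast
    have kc: "k \<in> carrier R" using kr(1) by (rule N.Icarr)
    have "x \<otimes> (u \<otimes> w' \<ominus> r \<otimes> z) = u \<otimes> (n \<oplus> w' \<otimes> x) \<ominus> u \<otimes> n \<ominus> z \<otimes> (r \<otimes> x)"
      using uc n(2) nc kr(2) c by algebra
    also have "\<dots> = z \<otimes> (u \<otimes> w) \<ominus> u \<otimes> n \<ominus> z \<otimes> (r \<otimes> x)"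
      unfolding n(3)[symmetric] using uc w(1) n(2) nc kr(2) c by algebra
    also have "\<dots> = z \<otimes> k \<ominus> u \<otimes> n"
      unfolding kr(3) using uc kc nc kr(2) c by algebra
    also have "\<dots> \<in> N" using kr(1) n(1) uc c by (simp add: a_minus_def N.I_l_closed)
    finally have "u \<otimes> w' \<ominus> r \<otimes> z \<in> N" using nx uc n(2) kr(2) c by blast
    moreover have "u \<otimes> w' = (u \<otimes> w' \<ominus> r \<otimes> z) \<oplus> r \<otimes> z"
      using uc n(2) kr(2) c by (simp add: add_minus_cancel)
    ultimately show ?thesis unfolding Idl_insert_iff[OF N c(2)] using kr(2) by blast
  qed
  ultimately show ?thesis unfolding depth_zero_mod_def using n(2) by blast
qed

text \<open>If \<open>R/N\<close> has no socle, the maximal ideal is not the annihilator of a nonzero element of \<open>R/N\<close>.\<close>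

lemma associated_primes_not_max:
  assumes N: "ideal N R" and nz: "\<not> depth_zero_mod R \<mm> N"
  obtains \<P> where "finite \<P>" "zero_divisors_mod R N = \<Union>\<P>"
    "\<And>P. P \<in> \<P> \<Longrightarrow> primeideal P R \<and> N \<subseteq> P \<and> P \<noteq> \<mm>"
proof -
  interpret N: ideal N R by fact
  obtain \<P> where \<P>: "finite \<P>" "zero_divisors_mod R N = \<Union>\<P>"
    "\<And>P. P \<in> \<P> \<Longrightarrow> primeideal P R \<and> (\<exists>s\<in>carrier R. s \<notin> N \<and> P = colon R N s)"
    by (rule finite_associated_primes[OF is_cring N]) blast
  have "primeideal P R \<and> N \<subseteq> P \<and> P \<noteq> \<mm>" if "P \<in> \<P>" for P
  proof -
    from \<P>(3)[OF that] obtain s where s: "primeideal P R" "s \<in> carrier R" "s \<notin> N" "P = colon R N s"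
      by blast
    have "N \<subseteq> P" unfolding s(4) colon_def using s(2) N.I_r_closed N.Icarr by blast
    moreover have "P \<noteq> \<mm>"
    proof
      assume "P = \<mm>"
      hence "\<forall>u\<in>\<mm>. u \<otimes> s \<in> N" unfolding s(4) colon_def by blast
      thus False using nz s unfolding depth_zero_mod_def by blast
    qed
    ultimately show ?thesis using s(1) by blast
  qed
  with \<P>(1,2) show ?thesis by (rule that)
qed

text \<open>Prime avoidance for the associated primes of both ideals together.\<close>

lemma exists_common_nonzerodivisor:
  assumes "ideal N R" "\<not> depth_zero_mod R \<mm> N" "ideal N' R" "\<not> depth_zero_mod R \<mm> N'"
  obtains c where "c \<in> \<mm>" "\<forall>v\<in>carrier R. c \<otimes> v \<in> N \<longrightarrow> v \<in> N" "\<forall>v\<in>carrier R. c \<otimes> v \<in> N' \<longrightarrow> v \<in> N'"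
proof -
  obtain \<P> where \<P>: "finite \<P>" "zero_divisors_mod R N = \<Union>\<P>"
    "\<And>P. P \<in> \<P> \<Longrightarrow> primeideal P R \<and> N \<subseteq> P \<and> P \<noteq> \<mm>"
    by (rule associated_primes_not_max[OF assms(1,2)]) blast
  obtain \<Q> where \<Q>: "finite \<Q>" "zero_divisors_mod R N' = \<Union>\<Q>"
    "\<And>P. P \<in> \<Q> \<Longrightarrow> primeideal P R \<and> N' \<subseteq> P \<and> P \<noteq> \<mm>"
    by (rule associated_primes_not_max[OF assms(3,4)]) blast
  have "\<exists>a\<in>\<mm>. \<zero> \<oplus> a \<notin> \<Union>(\<P> \<union> \<Q>)"
  proof (rule coset_prime_avoidance)
    show "finite (\<P> \<union> \<Q>)" using \<P>(1) \<Q>(1) by simp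
    show "primeideal P R" if "P \<in> \<P> \<union> \<Q>" for P using that \<P>(3) \<Q>(3) by blast
    show "\<not> \<mm> \<subseteq> P" if "P \<in> \<P> \<union> \<Q>" for P
      using that \<P>(3)[of P] \<Q>(3)[of P] prime_eq_max[of P] by blast
  qed (simp_all add: max.is_ideal)
  then obtain a where a: "a \<in> \<mm>" "\<zero> \<oplus> a \<notin> \<Union>(\<P> \<union> \<Q>)" by blast
  have ac: "a \<in> carrier R" using a(1) by (rule max_carrier)
  hence "a \<notin> zero_divisors_mod R N" "a \<notin> zero_divisors_mod R N'" using a(2) \<P>(2) \<Q>(2) by auto
  thus ?thesis using that[OF a(1)] ac unfolding zero_divisors_mod_def by blast
qed

lemma not_depth_zero_mod:
  assumes "x \<in> \<mm>" "\<forall>v\<in>carrier R. x \<otimes> v \<in> N \<longrightarrow> v \<in> N"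
  shows "\<not> depth_zero_mod R \<mm> N"
  using assms unfolding depth_zero_mod_def by blast

text \<open>A regular sequence that cannot be extended is at least as long as any other one. By exchange, the
  last elements of both sequences may be replaced by a common nonzerodivisor \<open>y\<close>; it is moved to the
  front, and the induction continues modulo \<open>N + (y)\<close>.\<close>

lemma regular_mod_length_le:
  assumes "ideal N R" "set xs \<subseteq> \<mm>" "set zs \<subseteq> \<mm>" "regular_mod R N xs" "regular_mod R N zs"
    and "depth_zero_mod R \<mm> (Idl (N \<union> set xs))"
  shows "length zs \<le> length xs"
  using assms
proof (induction "length xs" arbitrary: N xs zs)
  case 0
  hence dz: "depth_zero_mod R \<mm> N" by (simp add: Idl_ideal)
  show ?case
  proof (cases zs)
    case (Cons z zs')
    have "z \<in> \<mm>" using 0(4) Cons by simp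
    moreover have "\<forall>v\<in>carrier R. z \<otimes> v \<in> N \<longrightarrow> v \<in> N"
      using 0(6) unfolding Cons regular_mod.simps by blast
    ultimately show ?thesis using not_depth_zero_mod dz by blast
  qed simp
next
  case (Suc n)
  show ?case
  proof (cases zs rule: rev_cases)
    case Nil thus ?thesis by simp
  next
    case (snoc zs' z)
    note zs = snoc
    from Suc.hyps(2) obtain xs' x where xs: "xs = xs' @ [x]"
      by (cases xs rule: rev_cases) auto
    have N: "ideal N R" by fact
    have m: "set xs' \<subseteq> \<mm>" "x \<in> \<mm>" "set zs' \<subseteq> \<mm>" "z \<in> \<mm>"
      using Suc.prems(2,3) unfolding xs zs by auto
    note c = set_carrier[OF m(1)] set_carrier[OF m(3)] max_carrier[OF m(2)] max_carrier[OF m(4)]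
    let ?X = "Idl (N \<union> set xs')" and ?Z = "Idl (N \<union> set zs')"
    have idX: "ideal ?X R" and idZ: "ideal ?Z R" using Idl_ideal_Un(1)[OF N] c by blast+
    have rx: "regular_mod R N xs'" "\<forall>v\<in>carrier R. x \<otimes> v \<in> ?X \<longrightarrow> v \<in> ?X"
      using Suc.prems(4) unfolding xs regular_mod_snoc[OF N c(1,3)] by blast+
    have rz: "regular_mod R N zs'" "\<forall>v\<in>carrier R. z \<otimes> v \<in> ?Z \<longrightarrow> v \<in> ?Z"
      using Suc.prems(5) unfolding zs regular_mod_snoc[OF N c(2,4)] by blast+
    obtain y where y: "y \<in> \<mm>" "\<forall>v\<in>carrier R. y \<otimes> v \<in> ?X \<longrightarrow> v \<in> ?X"
      "\<forall>v\<in>carrier R. y \<otimes> v \<in> ?Z \<longrightarrow> v \<in> ?Z"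
      by (rule exists_common_nonzerodivisor[OF idX not_depth_zero_mod[OF m(2) rx(2)]
            idZ not_depth_zero_mod[OF m(4) rz(2)]])
    have yc: "y \<in> carrier R" using y(1) by (rule max_carrier)
    let ?N = "Idl (insert y N)"
    have idN: "ideal ?N R" using N yc by (rule Idl_ideal_insert)
    have "regular_mod R N (xs' @ [y])"
      unfolding regular_mod_snoc[OF N c(1) yc] using rx(1) y(2) by blast
    hence r1: "regular_mod R ?N xs'"
      unfolding regular_mod_rotate[OF N y(1) m(1), symmetric] regular_mod.simps by blast
    have "regular_mod R N (zs' @ [y])"
      unfolding regular_mod_snoc[OF N c(2) yc] using rz(1) y(3) by blast
    hence r2: "regular_mod R ?N zs'"
      unfolding regular_mod_rotate[OF N y(1) m(3), symmetric] regular_mod.simps by blast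
    have "depth_zero_mod R \<mm> (Idl (insert x ?X))"
      using Suc.prems(6) unfolding xs Idl_insert_Idl[OF N c(1,3)] by simp
    hence "depth_zero_mod R \<mm> (Idl (insert y ?X))"
      by (rule depth_zero_mod_exchange[OF idX m(2) y(1) rx(2) y(2)])
    hence "depth_zero_mod R \<mm> (Idl (?N \<union> set xs'))"
      unfolding Idl_insert_Idl[OF N c(1) yc] Idl_Idl_insert_Un[OF N c(1) yc] .
    hence "length zs' \<le> length xs'"
      using Suc.hyps(1)[OF _ idN m(1,3) r1 r2] Suc.hyps(2) xs by simp
    thus ?thesis unfolding xs zs by simp
  qed
qed

end

section \<open>Chains of primes below a regular sequence\<close>

text \<open>No product \<open>x\<^sup>n s\<close> with \<open>s \<notin> Q\<close> lies in \<open>N\<close>, as \<open>x\<close> can be cancelled and \<open>N \<subseteq> Q\<close>. These products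
  form a multiplicative set, and an ideal that contains \<open>N\<close> and is maximal among those disjoint from the
  set is prime.\<close>

lemma (in noetherian_ring) exists_smaller_prime:
  assumes cring: "cring R" and N: "ideal N R" and Q: "primeideal Q R" and NQ: "N \<subseteq> Q"
    and x: "x \<in> carrier R" and nzd: "\<forall>v\<in>carrier R. x \<otimes> v \<in> N \<longrightarrow> v \<in> N"
  obtains P where "primeideal P R" "N \<subseteq> P" "P \<subseteq> Q" "x \<notin> P"
proof -
  interpret cring R by fact
  interpret Q: ideal Q R using Q by (rule primeideal.axioms(1))
  let ?F = "{L. ideal L R \<and> N \<subseteq> L \<and> (\<forall>s\<in>carrier R. \<forall>n::nat. s \<notin> Q \<longrightarrow> x [^] n \<otimes> s \<notin> L)}"
  have "x [^] n \<otimes> s \<notin> N" if "s \<in> carrier R" "s \<notin> Q" for s and n :: nat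
  proof (induction n)
    case 0 thus ?case using that NQ by auto
  next
    case (Suc n)
    have "x [^] Suc n \<otimes> s = x \<otimes> (x [^] n \<otimes> s)" using x that by (simp add: m_assoc m_comm m_lcomm)
    thus ?case using Suc nzd x that by auto
  qed
  hence ne: "?F \<noteq> {}" using N by blast
  have id: "ideal L R" if "L \<in> ?F" for L using that by blast
  from exists_maximal_ideal_of[OF ne id]
  obtain M where M: "M \<in> ?F" "\<forall>L\<in>?F. M \<subseteq> L \<longrightarrow> L = M" by (rule bexE)
  have M': "ideal M R" "N \<subseteq> M" "\<And>s n::nat. s \<in> carrier R \<Longrightarrow> s \<notin> Q \<Longrightarrow> x [^] n \<otimes> s \<notin> M"
    using M(1) by blast+
  interpret M: ideal M R by fact
  have one: "\<one> \<notin> Q" using Q.one_imp_carrier primeideal.I_notcarr[OF Q] by blast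
  have MQ: "M \<subseteq> Q"
  proof
    fix u assume u: "u \<in> M"
    show "u \<in> Q" using M'(3)[of u "0::nat"] M.Icarr[OF u] u by auto
  qed
  have xM: "x \<notin> M" using M'(3)[of \<one> "1::nat"] one x by auto
  have meet: "\<exists>s\<in>carrier R. \<exists>n::nat. s \<notin> Q \<and> x [^] n \<otimes> s \<in> Idl (insert a M)"
    if a: "a \<in> carrier R" "a \<notin> M" for a
  proof (rule ccontr)
    assume "\<not> ?thesis"
    moreover note I = Idl_ideal_insert[OF M'(1) a(1)]
    ultimately have "Idl (insert a M) \<in> ?F" using M'(2) by blast
    hence "Idl (insert a M) = M" using M(2) I(2) by blast
    thus False using I(3) a(2) by simp
  qed
  have "primeideal M R"
  proof (rule primeidealI[OF M'(1) cring])
    show "carrier R \<noteq> M" using MQ one by auto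
  next
    fix a b assume ab: "a \<in> carrier R" "b \<in> carrier R" "a \<otimes> b \<in> M"
    show "a \<in> M \<or> b \<in> M"
    proof (rule ccontr)
      assume neg: "\<not> (a \<in> M \<or> b \<in> M)"
      obtain s n where s: "s \<in> carrier R" "s \<notin> Q" "x [^] (n::nat) \<otimes> s \<in> Idl (insert a M)"
        using meet[OF ab(1)] neg by blast
      obtain t k where t: "t \<in> carrier R" "t \<notin> Q" "x [^] (k::nat) \<otimes> t \<in> Idl (insert b M)"
        using meet[OF ab(2)] neg by blast
      obtain m r where m: "m \<in> M" "r \<in> carrier R" "x [^] n \<otimes> s = m \<oplus> r \<otimes> a"
        using s(3) unfolding Idl_insert_iff[OF M'(1) ab(1)] by blast
      obtain l q where l: "l \<in> M" "q \<in> carrier R" "x [^] k \<otimes> t = l \<oplus> q \<otimes> b"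
        using t(3) unfolding Idl_insert_iff[OF M'(1) ab(2)] by blast
      note mc = M.Icarr[OF m(1)] M.Icarr[OF l(1)]
      obtain y z where yz: "y = x [^] n" "z = x [^] k" by blast
      have yzc: "y \<in> carrier R" "z \<in> carrier R" using x yz by auto
      have "x [^] (n + k) \<otimes> (s \<otimes> t) = y \<otimes> z \<otimes> (s \<otimes> t)"
        unfolding yz using x by (simp add: nat_pow_mult)
      also have "\<dots> = (y \<otimes> s) \<otimes> (z \<otimes> t)"
        using yzc s(1) t(1) by algebra
      also have "\<dots> = m \<otimes> (l \<oplus> q \<otimes> b) \<oplus> (r \<otimes> a) \<otimes> l \<oplus> r \<otimes> q \<otimes> (a \<otimes> b)"
        unfolding yz m(3) l(3) using mc m(2) l(2) ab(1,2) by algebra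
      also have "\<dots> \<in> M"
        using m(1,2) l(1,2) mc ab M.I_l_closed M.I_r_closed by (intro M.a_closed) auto
      finally have "x [^] (n + k) \<otimes> (s \<otimes> t) \<in> M" .
      moreover have "s \<otimes> t \<notin> Q" using primeideal.I_prime[OF Q s(1) t(1)] s(2) t(2) by blast
      ultimately show False using M'(3)[of "s \<otimes> t" "n + k"] s(1) t(1) by simp
    qed
  qed
  thus ?thesis using that M'(2) MQ xM by blast
qed

text \<open>Each element of a regular sequence allows one step down, to a prime that omits it.\<close>

lemma (in noetherian_ring) prime_chain_below_regular_mod:
  assumes "cring R" "ideal N R" "set xs \<subseteq> carrier R" "regular_mod R N xs"
    and "primeideal Q R" "N \<union> set xs \<subseteq> Q"
  shows "\<exists>P. P (length xs) = Q \<and> (\<forall>i\<le>length xs. primeideal (P i) R) \<and>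
    (\<forall>i<length xs. P i \<subset> P (Suc i))"
  using assms(3-)
proof (induction xs arbitrary: Q rule: rev_induct)
  case Nil thus ?case by auto
next
  case (snoc x xs)
  interpret cring R by fact
  note N = assms(2)
  have c: "set xs \<subseteq> carrier R" "x \<in> carrier R" using snoc.prems(1) by auto
  let ?X = "Idl (N \<union> set xs)"
  have reg: "regular_mod R N xs" "\<forall>v\<in>carrier R. x \<otimes> v \<in> ?X \<longrightarrow> v \<in> ?X"
    using snoc.prems(2) unfolding regular_mod_snoc[OF N c] by blast+
  have XQ: "?X \<subseteq> Q"
    using primeideal.axioms(1)[OF snoc.prems(3)] snoc.prems(4) by (intro genideal_minimal) auto
  obtain P' where P': "primeideal P' R" "?X \<subseteq> P'" "P' \<subseteq> Q" "x \<notin> P'"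
    by (rule exists_smaller_prime[OF assms(1) Idl_ideal_Un(1)[OF N c(1)] snoc.prems(3) XQ c(2) reg(2)])
  have "N \<union> set xs \<subseteq> P'" using P'(2) Idl_ideal_Un(2,3)[OF N c(1)] by blast
  from snoc.IH[OF c(1) reg(1) P'(1) this]
  obtain P where P: "P (length xs) = P'" "\<forall>i\<le>length xs. primeideal (P i) R"
    "\<forall>i<length xs. P i \<subset> P (Suc i)" by blast
  have "x \<in> Q" using snoc.prems(4) by simp
  hence ss: "P' \<subset> Q" using P'(3,4) by blast
  let ?P = "P(Suc (length xs) := Q)"
  have "?P (length (xs @ [x])) = Q" by simp
  moreover have "\<forall>i\<le>length (xs @ [x]). primeideal (?P i) R"
    using P(2) snoc.prems(3) by (auto simp: le_Suc_eq)
  moreover have "\<forall>i<length (xs @ [x]). ?P i \<subset> ?P (Suc i)"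
    using P(1,3) ss by (auto simp: less_Suc_eq)
  ultimately show ?case by blast
qed

context noetherian_local_ring
begin

text \<open>A prime \<open>P \<noteq> \<mm>\<close> above a regular sequence of length \<open>d\<close> would give a chain of length \<open>d + 1\<close>.\<close>

lemma prime_over_full_regular_mod_eq_max:
  assumes "krull_dim R = enat d" "ideal N R" "set xs \<subseteq> \<mm>" "regular_mod R N xs" "length xs = d"
    and P: "primeideal P R" "N \<union> set xs \<subseteq> P"
  shows "P = \<mm>"
proof (rule ccontr)
  assume ne: "P \<noteq> \<mm>"
  have Pm: "P \<subset> \<mm>"
    using proper_ideal_subset_max[OF primeideal.axioms(1)[OF P(1)]] primeideal.I_notcarr[OF P(1)] ne
    by blast
  obtain C where C: "C (length xs) = P" "\<forall>i\<le>length xs. primeideal (C i) R"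
    "\<forall>i<length xs. C i \<subset> C (Suc i)"
    using prime_chain_below_regular_mod[OF is_cring assms(2) set_carrier[OF assms(3)] assms(4) P] by blast
  let ?C = "C(Suc d := \<mm>)"
  have "\<forall>i\<le>Suc d. primeideal (?C i) R"
    using C(2) max_prime assms(5) by (auto simp: le_Suc_eq)
  moreover have "\<forall>i<Suc d. ?C i \<subset> ?C (Suc i)"
    using C(1,3) Pm assms(5) by (auto simp: less_Suc_eq)
  ultimately have "enat (Suc d) \<le> krull_dim R"
    unfolding krull_dim_def by (intro Sup_upper) blast
  thus False using assms(1) by simp
qed

text \<open>Walk along the sequence. As long as \<open>R/A\<close> has no socle, no associated prime of \<open>A\<close> contains the whole
  remaining sequence \<open>x # zs\<close> (such a prime would be \<open>\<mm>\<close>), so some \<open>x + a\<close> with \<open>a \<in> (zs)\<close> avoids them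
  all. Replacing \<open>x\<close> by \<open>x + a\<close> changes neither the ideal generated nor regularity modulo \<open>N\<close>. With
  \<open>N = 0\<close> and \<open>A = I\<close> this makes a given regular sequence on \<open>R\<close> begin with a maximal regular sequence on
  \<open>R/I\<close>.\<close>

lemma regular_mod_adapt:
  assumes "ideal N R" "ideal A R" "N \<subseteq> A" "set zs \<subseteq> \<mm>" "regular_mod R N zs"
    and "A \<noteq> carrier R"
    and "\<And>P. primeideal P R \<Longrightarrow> N \<union> set zs \<subseteq> P \<Longrightarrow> P = \<mm>"
  shows "\<exists>us ws. length (us @ ws) = length zs \<and> set (us @ ws) \<subseteq> \<mm> \<and>
    Idl (N \<union> set (us @ ws)) = Idl (N \<union> set zs) \<and> regular_mod R N (us @ ws) \<and>
    regular_mod R A us \<and> depth_zero_mod R \<mm> (Idl (A \<union> set us))"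
  using assms
proof (induction zs arbitrary: N A)
  case Nil
  have "depth_zero_mod R \<mm> A"
  proof (rule ccontr)
    assume neg: "\<not> ?thesis"
    obtain \<P> where \<P>: "finite \<P>" "zero_divisors_mod R A = \<Union>\<P>"
      "\<And>P. P \<in> \<P> \<Longrightarrow> primeideal P R \<and> A \<subseteq> P \<and> P \<noteq> \<mm>"
      by (rule associated_primes_not_max[OF Nil.prems(2) neg]) blast
    have "\<one> \<notin> A" using ideal.one_imp_carrier[OF Nil.prems(2)] Nil.prems(6) by blast
    moreover have "\<zero> \<in> A"
      using Nil.prems(2) by (simp add: additive_subgroup.zero_closed ideal.axioms(1))
    ultimately have "\<zero> \<in> zero_divisors_mod R A"
      unfolding zero_divisors_mod_def by (auto intro!: bexI[of _ \<one>])
    then obtain P where "P \<in> \<P>" using \<P>(2) by blast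
    thus False using \<P>(3)[of P] Nil.prems(3) Nil.prems(7)[of P] by auto
  qed
  hence "depth_zero_mod R \<mm> (Idl (A \<union> set []))" using Nil.prems(2) by (simp add: Idl_ideal)
  thus ?case by (intro exI[of _ "[]"]) simp
next
  case (Cons x zs)
  note N = Cons.prems(1) and A = Cons.prems(2)
  show ?case
  proof (cases "depth_zero_mod R \<mm> A")
    case True
    hence "depth_zero_mod R \<mm> (Idl (A \<union> set []))" using A by (simp add: Idl_ideal)
    moreover have "regular_mod R A []" by simp
    ultimately show ?thesis using Cons.prems(4,5)
      by (intro exI[of _ "[]"] exI[of _ "x # zs"]) (simp only: append_Nil simp_thms)
  next
    case False
    obtain \<P> where \<P>: "finite \<P>" "zero_divisors_mod R A = \<Union>\<P>"
      "\<And>P. P \<in> \<P> \<Longrightarrow> primeideal P R \<and> A \<subseteq> P \<and> P \<noteq> \<mm>"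
      by (rule associated_primes_not_max[OF A False]) blast
    have m: "x \<in> \<mm>" "set zs \<subseteq> \<mm>" using Cons.prems(4) by auto
    note c = max_carrier[OF m(1)] set_carrier[OF m(2)]
    have "\<exists>a\<in>Idl (set zs). x \<oplus> a \<notin> \<Union>\<P>"
    proof (rule coset_prime_avoidance[OF \<P>(1)])
      show "primeideal P R" if "P \<in> \<P>" for P using \<P>(3)[OF that] by blast
      show "ideal (Idl (set zs)) R" by (rule genideal_ideal[OF c(2)])
      show "x \<in> carrier R" by (rule c(1))
      show "\<not> Idl (set zs) \<subseteq> P" if P: "P \<in> \<P>" "x \<in> P" for P
      proof
        assume "Idl (set zs) \<subseteq> P"
        hence "N \<union> set (x # zs) \<subseteq> P"
          using genideal_self[OF c(2)] P(2) \<P>(3)[OF P(1)] Cons.prems(3) by auto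
        thus False using \<P>(3)[OF P(1)] Cons.prems(7) by blast
      qed
    qed
    then obtain a where a: "a \<in> Idl (set zs)" "x \<oplus> a \<notin> \<Union>\<P>" by blast
    have "Idl (set zs) \<subseteq> \<mm>" using m(2) by (intro genideal_minimal max.is_ideal)
    hence am: "a \<in> \<mm>" using a(1) by blast
    define y where "y = x \<oplus> a"
    have ym: "y \<in> \<mm>" using m(1) am by (simp add: y_def)
    note yc = max_carrier[OF ym] and ac = max_carrier[OF am]
    have regy: "regular_mod R N (y # zs)"
      unfolding y_def using N m a(1) Cons.prems(5) by (rule regular_mod_translate_hd)
    have nzA: "\<forall>v\<in>carrier R. y \<otimes> v \<in> A \<longrightarrow> v \<in> A"
      using a(2) \<P>(2) yc unfolding y_def zero_divisors_mod_def by blast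
    let ?N = "Idl (insert y N)" and ?A = "Idl (insert y A)"
    note IN = Idl_ideal_insert[OF N yc] and IA = Idl_ideal_insert[OF A yc]
    have NA: "?N \<subseteq> ?A" using IA Cons.prems(3) by (intro genideal_minimal) auto
    have "A \<subseteq> \<mm>" by (rule proper_ideal_subset_max[OF A Cons.prems(6)])
    hence "?A \<subseteq> \<mm>" using ym by (intro genideal_minimal max.is_ideal) auto
    hence Ane: "?A \<noteq> carrier R" using one_notin_max by auto
    have x_eq: "x = y \<ominus> a" unfolding y_def using c(1) ac by (simp add: add_minus_cancel)
    have in_L: "x \<in> L \<longleftrightarrow> y \<in> L" if "ideal L R" "set zs \<subseteq> L" for L
    proof -
      interpret L: ideal L R by fact
      have "Idl (set zs) \<subseteq> L" using that by (intro genideal_minimal)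
      hence aL: "a \<in> L" using a(1) by blast
      show ?thesis
      proof
        assume "x \<in> L" thus "y \<in> L" unfolding y_def using aL by (rule L.a_closed)
      next
        assume "y \<in> L" thus "x \<in> L" unfolding x_eq using aL by (simp add: a_minus_def)
      qed
    qed
    have same: "Idl (N \<union> set (y # zs)) = Idl (N \<union> set (x # zs))"
    proof -
      have s: "set (y # zs) \<subseteq> carrier R" "set (x # zs) \<subseteq> carrier R" using yc c by auto
      note Y = Idl_ideal_Un[OF N s(1)] and X = Idl_ideal_Un[OF N s(2)]
      have "x \<in> Idl (N \<union> set (y # zs))" using in_L[OF Y(1)] Y(3) by auto
      moreover have "y \<in> Idl (N \<union> set (x # zs))" using in_L[OF X(1)] X(3) by auto
      ultimately show ?thesis using X Y
        by (intro equalityI genideal_minimal) auto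
    qed
    have "P = \<mm>" if P: "primeideal P R" "?N \<union> set zs \<subseteq> P" for P
    proof (rule Cons.prems(7)[OF P(1)])
      have "x \<in> P" using in_L[OF primeideal.axioms(1)[OF P(1)]] P(2) IN(3) by blast
      thus "N \<union> set (x # zs) \<subseteq> P" using P(2) IN(2) by auto
    qed
    moreover have "regular_mod R ?N zs" using regy unfolding regular_mod.simps by blast
    ultimately obtain us ws where uw: "length (us @ ws) = length zs" "set (us @ ws) \<subseteq> \<mm>"
      "Idl (?N \<union> set (us @ ws)) = Idl (?N \<union> set zs)" "regular_mod R ?N (us @ ws)"
      "regular_mod R ?A us" "depth_zero_mod R \<mm> (Idl (?A \<union> set us))"
      using Cons.IH[OF IN(1) IA(1) NA m(2) _ Ane] by blast
    note uwc = set_carrier[OF uw(2)]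
    have uc: "set us \<subseteq> carrier R" using uwc by simp
    have e: "Idl (N \<union> set ((y # us) @ ws)) = Idl (N \<union> set (x # zs))"
      using uw(3) same unfolding Idl_Idl_insert_Un[OF N uwc yc] Idl_Idl_insert_Un[OF N c(2) yc]
      by simp
    have r: "regular_mod R N ((y # us) @ ws)"
      using uw(4) regy unfolding append_Cons regular_mod.simps by blast
    have rA: "regular_mod R A (y # us)" using uw(5) nzA unfolding regular_mod.simps by blast
    have dz: "depth_zero_mod R \<mm> (Idl (A \<union> set (y # us)))"
      using uw(6) unfolding Idl_Idl_insert_Un[OF A uc yc] by simp
    have l: "length ((y # us) @ ws) = length (x # zs)" "set ((y # us) @ ws) \<subseteq> \<mm>"
      using uw(1,2) ym by simp_all
    show ?thesis using l e r rA dz by blast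
  qed
qed

end

section \<open>Homomorphisms and submodules\<close>

lemma mod_hom_closed: "\<phi> \<in> mod_hom R M N \<Longrightarrow> x \<in> carrier M \<Longrightarrow> \<phi> x \<in> carrier N"
  by (auto simp: mod_hom_def)

lemma mod_hom_add:
  "\<phi> \<in> mod_hom R M N \<Longrightarrow> x \<in> carrier M \<Longrightarrow> y \<in> carrier M \<Longrightarrow>
    \<phi> (x \<oplus>\<^bsub>M\<^esub> y) = \<phi> x \<oplus>\<^bsub>N\<^esub> \<phi> y"
  by (auto simp: mod_hom_def)

lemma mod_hom_smult:
  "\<phi> \<in> mod_hom R M N \<Longrightarrow> r \<in> carrier R \<Longrightarrow> x \<in> carrier M \<Longrightarrow>
    \<phi> (r \<odot>\<^bsub>M\<^esub> x) = r \<odot>\<^bsub>N\<^esub> \<phi> x"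
  by (auto simp: mod_hom_def)

lemma mod_hom_zero:
  assumes "module R M" "module R N" "\<phi> \<in> mod_hom R M N"
  shows "\<phi> \<zero>\<^bsub>M\<^esub> = \<zero>\<^bsub>N\<^esub>"
proof -
  interpret M: module R M by fact
  interpret N: module R N by fact
  have "\<phi> (\<zero>\<^bsub>R\<^esub> \<odot>\<^bsub>M\<^esub> \<zero>\<^bsub>M\<^esub>) = \<zero>\<^bsub>R\<^esub> \<odot>\<^bsub>N\<^esub> \<phi> \<zero>\<^bsub>M\<^esub>"
    using assms(3) by (rule mod_hom_smult) simp_all
  thus ?thesis using mod_hom_closed[OF assms(3), of "\<zero>\<^bsub>M\<^esub>"] by simp
qed

lemma (in module) minus_eq_smult: "x \<in> carrier M \<Longrightarrow> \<ominus>\<^bsub>M\<^esub> x = (\<ominus> \<one>) \<odot>\<^bsub>M\<^esub> x"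
  by (simp add: smult_l_minus)

lemma mod_hom_minus:
  assumes "module R M" "module R N" "\<phi> \<in> mod_hom R M N" "x \<in> carrier M" "y \<in> carrier M"
  shows "\<phi> (x \<ominus>\<^bsub>M\<^esub> y) = \<phi> x \<ominus>\<^bsub>N\<^esub> \<phi> y"
proof -
  interpret M: module R M by fact
  interpret N: module R N by fact
  show ?thesis
    using mod_hom_closed[OF assms(3)] mod_hom_add[OF assms(3)] mod_hom_smult[OF assms(3)] assms(4,5)
    by (simp add: a_minus_def M.minus_eq_smult N.minus_eq_smult)
qed

lemma mod_hom_comp:
  "\<phi> \<in> mod_hom R M N \<Longrightarrow> \<psi> \<in> mod_hom R N P \<Longrightarrow> (\<lambda>x. \<psi> (\<phi> x)) \<in> mod_hom R M P"
  unfolding mod_hom_def Pi_iff by simp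

lemma mod_hom_minus_fun:
  assumes "module R M" "module R N" "\<phi> \<in> mod_hom R M N" "\<psi> \<in> mod_hom R M N"
  shows "(\<lambda>x. \<phi> x \<ominus>\<^bsub>N\<^esub> \<psi> x) \<in> mod_hom R M N"
proof -
  interpret M: module R M by fact
  interpret N: module R N by fact
  note c = mod_hom_closed[OF assms(3)] mod_hom_closed[OF assms(4)]
  have "\<phi> (x \<oplus>\<^bsub>M\<^esub> y) \<ominus>\<^bsub>N\<^esub> \<psi> (x \<oplus>\<^bsub>M\<^esub> y) = (\<phi> x \<ominus>\<^bsub>N\<^esub> \<psi> x) \<oplus>\<^bsub>N\<^esub> (\<phi> y \<ominus>\<^bsub>N\<^esub> \<psi> y)"
    if "x \<in> carrier M" "y \<in> carrier M" for x y
    using mod_hom_add[OF assms(3) that] mod_hom_add[OF assms(4) that] c that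
    by (simp add: a_minus_def N.minus_add N.a_ac)
  moreover have "\<phi> (r \<odot>\<^bsub>M\<^esub> x) \<ominus>\<^bsub>N\<^esub> \<psi> (r \<odot>\<^bsub>M\<^esub> x) = r \<odot>\<^bsub>N\<^esub> (\<phi> x \<ominus>\<^bsub>N\<^esub> \<psi> x)"
    if "r \<in> carrier R" "x \<in> carrier M" for r x
    using mod_hom_smult[OF assms(3) that] mod_hom_smult[OF assms(4) that] c that
    by (simp add: a_minus_def N.smult_r_distr N.smult_r_minus)
  ultimately show ?thesis using c by (auto simp: mod_hom_def)
qed

lemma mod_hom_subset:
  "\<phi> \<in> mod_hom R M N \<Longrightarrow> \<phi> ` carrier M \<subseteq> H \<Longrightarrow> \<phi> \<in> mod_hom R M (N\<lparr>carrier := H\<rparr>)"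
  unfolding mod_hom_def by auto

lemma (in module) submodule_minus:
  assumes "submodule H R M" "x \<in> H" "y \<in> H"
  shows "x \<ominus>\<^bsub>M\<^esub> y \<in> H"
  unfolding a_minus_def using submoduleE[OF assms(1)] assms(2,3) by blast

lemma (in module) submodule_zero: "submodule H R M \<Longrightarrow> \<zero>\<^bsub>M\<^esub> \<in> H"
  using subgroup.one_closed[OF submodule.axioms(1)] by fastforce

lemma (in module) add_minus_cancel:
  assumes "x \<in> carrier M" "y \<in> carrier M"
  shows "(x \<oplus>\<^bsub>M\<^esub> y) \<ominus>\<^bsub>M\<^esub> y = x" "(x \<oplus>\<^bsub>M\<^esub> y) \<ominus>\<^bsub>M\<^esub> x = y" "(x \<ominus>\<^bsub>M\<^esub> y) \<oplus>\<^bsub>M\<^esub> y = x"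
proof -
  have 1: "(x \<oplus>\<^bsub>M\<^esub> y) \<ominus>\<^bsub>M\<^esub> y = x" if "x \<in> carrier M" "y \<in> carrier M" for x y
    using that by (simp add: a_minus_def M.a_assoc M.r_neg)
  show "(x \<oplus>\<^bsub>M\<^esub> y) \<ominus>\<^bsub>M\<^esub> y = x" by (rule 1[OF assms])
  show "(x \<oplus>\<^bsub>M\<^esub> y) \<ominus>\<^bsub>M\<^esub> x = y"
    using 1[OF assms(2,1)] assms by (simp add: M.a_comm)
  show "(x \<ominus>\<^bsub>M\<^esub> y) \<oplus>\<^bsub>M\<^esub> y = x"
    using assms by (simp add: a_minus_def M.a_assoc M.l_neg)
qed

lemma (in module) submodule_add_iff:
  assumes "submodule H R M" "x \<in> carrier M" "y \<in> H"
  shows "x \<oplus>\<^bsub>M\<^esub> y \<in> H \<longleftrightarrow> x \<in> H" "x \<ominus>\<^bsub>M\<^esub> y \<in> H \<longleftrightarrow> x \<in> H"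
proof -
  have y: "y \<in> carrier M" using submoduleE(1)[OF assms(1)] assms(3) by blast
  show "x \<oplus>\<^bsub>M\<^esub> y \<in> H \<longleftrightarrow> x \<in> H"
    using submodule_minus[OF assms(1) _ assms(3), of "x \<oplus>\<^bsub>M\<^esub> y"] submoduleE(5)[OF assms(1) _ assms(3)]
      add_minus_cancel[OF assms(2) y] by auto
  show "x \<ominus>\<^bsub>M\<^esub> y \<in> H \<longleftrightarrow> x \<in> H"
    using submodule_minus[OF assms(1) _ assms(3), of x] submoduleE(5)[OF assms(1) _ assms(3), of "x \<ominus>\<^bsub>M\<^esub> y"]
      add_minus_cancel[OF assms(2) y] by auto
qed

lemma (in module) zero_submodule: "submodule {\<zero>\<^bsub>M\<^esub>} R M"
  by (rule submoduleI) auto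

lemma kernel_submodule:
  assumes "module R M" "module R N" "\<phi> \<in> mod_hom R M N"
  shows "submodule {x \<in> carrier M. \<phi> x = \<zero>\<^bsub>N\<^esub>} R M"
proof -
  interpret M: module R M by fact
  interpret N: module R N by fact
  note [simp] = mod_hom_closed[OF assms(3)] mod_hom_add[OF assms(3)] mod_hom_smult[OF assms(3)]
    mod_hom_zero[OF assms]
  show ?thesis by (rule M.submoduleI) (auto simp: M.minus_eq_smult)
qed

lemma image_submodule:
  assumes "module R M" "module R N" "\<phi> \<in> mod_hom R M N" "submodule H R M"
  shows "submodule (\<phi> ` H) R N"
proof -
  interpret M: module R M by fact
  interpret N: module R N by fact
  note c = mod_hom_closed[OF assms(3)] and E = M.submoduleE[OF assms(4)]
  have Hc: "x \<in> carrier M" if "x \<in> H" for x using that E(1) by blast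
  show ?thesis
  proof (rule N.submoduleI)
    show "\<phi> ` H \<subseteq> carrier N" using c Hc by blast
    show "\<zero>\<^bsub>N\<^esub> \<in> \<phi> ` H"
      using mod_hom_zero[OF assms(1-3)] M.submodule_zero[OF assms(4)] by force
  next
    fix x assume "x \<in> \<phi> ` H"
    then obtain h where h: "h \<in> H" "x = \<phi> h" by blast
    have "\<ominus>\<^bsub>N\<^esub> x = \<phi> (\<ominus>\<^bsub>M\<^esub> h)"
      using h Hc c mod_hom_smult[OF assms(3)] by (simp add: M.minus_eq_smult N.minus_eq_smult)
    thus "\<ominus>\<^bsub>N\<^esub> x \<in> \<phi> ` H" using E(3)[OF h(1)] by blast
  next
    fix x y assume "x \<in> \<phi> ` H" "y \<in> \<phi> ` H"
    then obtain g h where gh: "g \<in> H" "h \<in> H" "x = \<phi> g" "y = \<phi> h" by blast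
    have "x \<oplus>\<^bsub>N\<^esub> y = \<phi> (g \<oplus>\<^bsub>M\<^esub> h)" using gh Hc mod_hom_add[OF assms(3)] by simp
    thus "x \<oplus>\<^bsub>N\<^esub> y \<in> \<phi> ` H" using E(5)[OF gh(1,2)] by blast
  next
    fix r x assume r: "r \<in> carrier R" "x \<in> \<phi> ` H"
    then obtain h where h: "h \<in> H" "x = \<phi> h" by blast
    have "r \<odot>\<^bsub>N\<^esub> x = \<phi> (r \<odot>\<^bsub>M\<^esub> h)" using h r Hc mod_hom_smult[OF assms(3)] by simp
    thus "r \<odot>\<^bsub>N\<^esub> x \<in> \<phi> ` H" using E(4)[OF r(1) h(1)] by blast
  qed
qed

section \<open>Multiples of a submodule by a sequence\<close>

text \<open>The set \<open>W + y\<^sub>0 N + \<dots> + y\<^bsub>k-1\<^esub> N\<close>. With \<open>W = 0\<close> it is \<open>(y\<^sub>0, \<dots>, y\<^bsub>k-1\<^esub>) N\<close>; with a submodule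
  \<open>W\<close> of \<open>N\<close> it represents \<open>(y\<^sub>0, \<dots>, y\<^bsub>k-1\<^esub>) (N/W)\<close>, without a quotient module being formed.\<close>

primrec seq_span ::
  "('a, 'm, 'x) module_scheme \<Rightarrow> (nat \<Rightarrow> 'a) \<Rightarrow> 'm set \<Rightarrow> 'm set \<Rightarrow> nat \<Rightarrow> 'm set" where
  "seq_span M y W N 0 = W"
| "seq_span M y W N (Suc k) = {s \<oplus>\<^bsub>M\<^esub> (y k \<odot>\<^bsub>M\<^esub> n) | s n. s \<in> seq_span M y W N k \<and> n \<in> N}"

context module
begin

lemma seq_span_submodule:
  assumes "submodule W R M" "submodule N R M" "\<forall>j<k. y j \<in> carrier R"
  shows "submodule (seq_span M y W N k) R M"
  using assms(3)
proof (induction k)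
  case 0 thus ?case using assms(1) by simp
next
  case (Suc k)
  let ?S = "seq_span M y W N k"
  have S: "submodule ?S R M" using Suc by simp
  note E = submoduleE[OF S] and F = submoduleE[OF assms(2)]
  have yk: "y k \<in> carrier R" using Suc.prems by simp
  have Sc: "x \<in> carrier M" if "x \<in> ?S" for x using that E(1) by blast
  have Nc: "x \<in> carrier M" if "x \<in> N" for x using that F(1) by blast
  show ?case
  proof (rule submoduleI)
    show "seq_span M y W N (Suc k) \<subseteq> carrier M" using Sc Nc yk by auto
    have "\<zero>\<^bsub>M\<^esub> = \<zero>\<^bsub>M\<^esub> \<oplus>\<^bsub>M\<^esub> y k \<odot>\<^bsub>M\<^esub> \<zero>\<^bsub>M\<^esub>" using yk by simp
    thus "\<zero>\<^bsub>M\<^esub> \<in> seq_span M y W N (Suc k)"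
      using submodule_zero[OF S] submodule_zero[OF assms(2)] by (auto simp del: M.zero_closed)
  next
    fix x assume "x \<in> seq_span M y W N (Suc k)"
    then obtain s n where sn: "s \<in> ?S" "n \<in> N" "x = s \<oplus>\<^bsub>M\<^esub> y k \<odot>\<^bsub>M\<^esub> n" by auto
    have "\<ominus>\<^bsub>M\<^esub> x = (\<ominus>\<^bsub>M\<^esub> s) \<oplus>\<^bsub>M\<^esub> y k \<odot>\<^bsub>M\<^esub> (\<ominus>\<^bsub>M\<^esub> n)"
      using sn Sc Nc yk by (simp add: M.minus_add smult_r_minus)
    thus "\<ominus>\<^bsub>M\<^esub> x \<in> seq_span M y W N (Suc k)" using E(3)[OF sn(1)] F(3)[OF sn(2)] by auto
  next
    fix x z assume "x \<in> seq_span M y W N (Suc k)" "z \<in> seq_span M y W N (Suc k)"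
    then obtain s n t l where sn: "s \<in> ?S" "n \<in> N" "x = s \<oplus>\<^bsub>M\<^esub> y k \<odot>\<^bsub>M\<^esub> n"
      and tl: "t \<in> ?S" "l \<in> N" "z = t \<oplus>\<^bsub>M\<^esub> y k \<odot>\<^bsub>M\<^esub> l" by auto
    have "x \<oplus>\<^bsub>M\<^esub> z = (s \<oplus>\<^bsub>M\<^esub> t) \<oplus>\<^bsub>M\<^esub> y k \<odot>\<^bsub>M\<^esub> (n \<oplus>\<^bsub>M\<^esub> l)"
      unfolding sn(3) tl(3) using sn(1,2) tl(1,2) Sc Nc yk by (simp add: smult_r_distr M.a_ac)
    thus "x \<oplus>\<^bsub>M\<^esub> z \<in> seq_span M y W N (Suc k)" using E(5)[OF sn(1) tl(1)] F(5)[OF sn(2) tl(2)] by auto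
  next
    fix r x assume r: "r \<in> carrier R" "x \<in> seq_span M y W N (Suc k)"
    then obtain s n where sn: "s \<in> ?S" "n \<in> N" "x = s \<oplus>\<^bsub>M\<^esub> y k \<odot>\<^bsub>M\<^esub> n" by auto
    have "r \<odot>\<^bsub>M\<^esub> x = (r \<odot>\<^bsub>M\<^esub> s) \<oplus>\<^bsub>M\<^esub> y k \<odot>\<^bsub>M\<^esub> (r \<odot>\<^bsub>M\<^esub> n)"
      unfolding sn(3) using sn(1,2) Sc Nc yk r
      by (simp add: smult_r_distr smult_assoc1[symmetric] R.m_comm)
    thus "r \<odot>\<^bsub>M\<^esub> x \<in> seq_span M y W N (Suc k)" using E(4)[OF r(1) sn(1)] F(4)[OF r(1) sn(2)] by auto
  qed
qed

lemma seq_span_mono_length: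
  assumes "submodule W R M" "submodule N R M" "\<forall>j<l. y j \<in> carrier R" "k \<le> l"
  shows "seq_span M y W N k \<subseteq> seq_span M y W N l"
  using assms(4,3)
proof (induction l rule: dec_induct)
  case (step l)
  have S: "submodule (seq_span M y W N l) R M"
    using step.prems by (intro seq_span_submodule assms(1,2)) auto
  have "s \<in> seq_span M y W N (Suc l)" if "s \<in> seq_span M y W N l" for s
  proof -
    have "s = s \<oplus>\<^bsub>M\<^esub> y l \<odot>\<^bsub>M\<^esub> \<zero>\<^bsub>M\<^esub>"
      using that submoduleE(1)[OF S] step.prems by (simp add: subset_iff)
    thus ?thesis using that submodule_zero[OF assms(2)] by auto
  qed
  thus ?case using step by fastforce
qed simp

lemma seq_span_base:
  assumes "submodule W R M" "submodule N R M" "\<forall>j<k. y j \<in> carrier R" "w \<in> W"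
  shows "w \<in> seq_span M y W N k"
  using seq_span_mono_length[OF assms(1-3), of 0] assms(4) by auto

lemma seq_span_smult:
  assumes "submodule W R M" "submodule N R M" "\<forall>j<k. y j \<in> carrier R" "j < k" "n \<in> N"
  shows "y j \<odot>\<^bsub>M\<^esub> n \<in> seq_span M y W N k"
proof -
  have nc: "n \<in> carrier M" using submoduleE(1)[OF assms(2)] assms(5) by blast
  have "submodule (seq_span M y W N j) R M"
    using assms(3,4) by (intro seq_span_submodule assms(1,2)) auto
  hence "\<zero>\<^bsub>M\<^esub> \<in> seq_span M y W N j" by (rule submodule_zero)
  moreover have "y j \<odot>\<^bsub>M\<^esub> n = \<zero>\<^bsub>M\<^esub> \<oplus>\<^bsub>M\<^esub> y j \<odot>\<^bsub>M\<^esub> n" using assms(3,4) nc by simp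
  ultimately have "y j \<odot>\<^bsub>M\<^esub> n \<in> seq_span M y W N (Suc j)" unfolding seq_span.simps using assms(5) by blast
  moreover have "seq_span M y W N (Suc j) \<subseteq> seq_span M y W N k"
    using assms(3,4) by (intro seq_span_mono_length assms(1,2)) auto
  ultimately show ?thesis by blast
qed

end

lemma seq_span_mono:
  assumes "W \<subseteq> W'" "N \<subseteq> N'" shows "seq_span M y W N k \<subseteq> seq_span M y W' N' k"
proof (induction k)
  case (Suc k) thus ?case unfolding seq_span.simps using assms(2) by blast
qed (use assms in simp)

lemma (in module) seq_span_split:
  assumes "submodule W R M" "submodule N R M" "\<forall>j<k. y j \<in> carrier R"
  shows "u \<in> seq_span M y W N k \<longleftrightarrow> (\<exists>w\<in>W. \<exists>s\<in>seq_span M y {\<zero>\<^bsub>M\<^esub>} N k. u = w \<oplus>\<^bsub>M\<^esub> s)"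
proof
  show "u \<in> seq_span M y W N k \<Longrightarrow> \<exists>w\<in>W. \<exists>s\<in>seq_span M y {\<zero>\<^bsub>M\<^esub>} N k. u = w \<oplus>\<^bsub>M\<^esub> s"
    using assms(3)
  proof (induction k arbitrary: u)
    case 0
    have "u = u \<oplus>\<^bsub>M\<^esub> \<zero>\<^bsub>M\<^esub>" using 0 submoduleE(1)[OF assms(1)] by auto
    thus ?case using 0 by auto
  next
    case (Suc k)
    then obtain s n where sn: "s \<in> seq_span M y W N k" "n \<in> N" "u = s \<oplus>\<^bsub>M\<^esub> y k \<odot>\<^bsub>M\<^esub> n" by auto
    obtain w t where wt: "w \<in> W" "t \<in> seq_span M y {\<zero>\<^bsub>M\<^esub>} N k" "s = w \<oplus>\<^bsub>M\<^esub> t"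
      using Suc.IH[OF sn(1)] Suc.prems(2) by auto
    have "submodule (seq_span M y {\<zero>\<^bsub>M\<^esub>} N k) R M"
      using Suc.prems(2) by (intro seq_span_submodule zero_submodule assms(2)) auto
    hence tc: "t \<in> carrier M" using wt(2) submoduleE(1) by blast
    have nc: "n \<in> carrier M" "w \<in> carrier M"
      using submoduleE(1)[OF assms(2)] submoduleE(1)[OF assms(1)] sn(2) wt(1) by blast+
    have "u = w \<oplus>\<^bsub>M\<^esub> (t \<oplus>\<^bsub>M\<^esub> y k \<odot>\<^bsub>M\<^esub> n)"
      unfolding sn(3) wt(3) using tc nc Suc.prems(2) by (simp add: M.a_assoc)
    thus ?case using wt(1,2) sn(2) by auto
  qed
next
  assume "\<exists>w\<in>W. \<exists>s\<in>seq_span M y {\<zero>\<^bsub>M\<^esub>} N k. u = w \<oplus>\<^bsub>M\<^esub> s"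
  then obtain w s where ws: "w \<in> W" "s \<in> seq_span M y {\<zero>\<^bsub>M\<^esub>} N k" "u = w \<oplus>\<^bsub>M\<^esub> s" by blast
  have "w \<in> seq_span M y W N k"
    using assms(1-3) ws(1) by (rule seq_span_base)
  moreover have "s \<in> seq_span M y W N k"
    using seq_span_mono[of "{\<zero>\<^bsub>M\<^esub>}" W N N M y k] submodule_zero[OF assms(1)] ws(2) by auto
  ultimately show "u \<in> seq_span M y W N k"
    unfolding ws(3) by (intro submoduleE(5)[OF seq_span_submodule[OF assms]])
qed

lemma seq_span_image:
  assumes "module R M" "module R M'" "\<phi> \<in> mod_hom R M M'" "submodule W R M" "submodule N R M"
    "\<forall>j<k. y j \<in> carrier R"
  shows "\<phi> ` seq_span M y W N k = seq_span M' y (\<phi> ` W) (\<phi> ` N) k"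
  using assms(6)
proof (induction k)
  case 0 thus ?case by simp
next
  case (Suc k)
  interpret M: module R M by fact
  have S: "submodule (seq_span M y W N k) R M"
    using Suc.prems by (intro M.seq_span_submodule assms(4,5)) auto
  have Sc: "x \<in> carrier M" if "x \<in> seq_span M y W N k" for x using that M.submoduleE(1)[OF S] by blast
  have Nc: "x \<in> carrier M" if "x \<in> N" for x using that M.submoduleE(1)[OF assms(5)] by blast
  have eq: "\<phi> (s \<oplus>\<^bsub>M\<^esub> y k \<odot>\<^bsub>M\<^esub> n) = \<phi> s \<oplus>\<^bsub>M'\<^esub> y k \<odot>\<^bsub>M'\<^esub> \<phi> n"
    if "s \<in> seq_span M y W N k" "n \<in> N" for s n
    using Sc[OF that(1)] Nc[OF that(2)] Suc.prems mod_hom_add[OF assms(3)] mod_hom_smult[OF assms(3)]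
    by simp
  have IH: "\<phi> ` seq_span M y W N k = seq_span M' y (\<phi> ` W) (\<phi> ` N) k" using Suc by simp
  show ?case unfolding seq_span.simps IH[symmetric]
  proof (intro equalityI subsetI)
    fix x assume "x \<in> \<phi> ` {s \<oplus>\<^bsub>M\<^esub> y k \<odot>\<^bsub>M\<^esub> n |s n. s \<in> seq_span M y W N k \<and> n \<in> N}"
    then obtain s n where "s \<in> seq_span M y W N k" "n \<in> N" "x = \<phi> (s \<oplus>\<^bsub>M\<^esub> y k \<odot>\<^bsub>M\<^esub> n)" by blast
    thus "x \<in> {s \<oplus>\<^bsub>M'\<^esub> y k \<odot>\<^bsub>M'\<^esub> n |s n. s \<in> \<phi> ` seq_span M y W N k \<and> n \<in> \<phi> ` N}"
      using eq by blast
  next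
    fix x assume "x \<in> {s \<oplus>\<^bsub>M'\<^esub> y k \<odot>\<^bsub>M'\<^esub> n |s n. s \<in> \<phi> ` seq_span M y W N k \<and> n \<in> \<phi> ` N}"
    then obtain s n where sn: "s \<in> seq_span M y W N k" "n \<in> N" "x = \<phi> s \<oplus>\<^bsub>M'\<^esub> y k \<odot>\<^bsub>M'\<^esub> \<phi> n" by blast
    show "x \<in> \<phi> ` {s \<oplus>\<^bsub>M\<^esub> y k \<odot>\<^bsub>M\<^esub> n |s n. s \<in> seq_span M y W N k \<and> n \<in> N}"
      unfolding sn(3) eq[OF sn(1,2), symmetric] using sn(1,2) by blast
  qed
qed

text \<open>For \<open>M/Ker \<phi> \<cong> \<phi>(M)\<close> this compares the multiples of both sides by the sequence.\<close>

lemma seq_span_kernel_iff: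
  assumes "module R M" "module R M'" "\<phi> \<in> mod_hom R M M'" "\<forall>j<k. y j \<in> carrier R"
    "u \<in> carrier M"
  shows "\<phi> u \<in> seq_span M' y {\<zero>\<^bsub>M'\<^esub>} (\<phi> ` carrier M) k \<longleftrightarrow>
    u \<in> seq_span M y {x \<in> carrier M. \<phi> x = \<zero>\<^bsub>M'\<^esub>} (carrier M) k"
proof -
  interpret M: module R M by fact
  interpret M': module R M' by fact
  let ?K = "{x \<in> carrier M. \<phi> x = \<zero>\<^bsub>M'\<^esub>}"
  have K: "submodule ?K R M" by (rule kernel_submodule[OF assms(1-3)])
  have "\<zero>\<^bsub>M\<^esub> \<in> ?K" by (rule M.submodule_zero[OF K])
  hence "\<phi> ` ?K = {\<zero>\<^bsub>M'\<^esub>}" by force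
  hence im: "\<phi> ` seq_span M y ?K (carrier M) k = seq_span M' y {\<zero>\<^bsub>M'\<^esub>} (\<phi> ` carrier M) k"
    using seq_span_image[OF assms(1-3) K M.carrier_is_submodule assms(4)] by simp
  have S: "submodule (seq_span M y ?K (carrier M) k) R M"
    using assms(4) by (intro M.seq_span_submodule K M.carrier_is_submodule)
  show ?thesis
  proof
    assume "\<phi> u \<in> seq_span M' y {\<zero>\<^bsub>M'\<^esub>} (\<phi> ` carrier M) k"
    then obtain w where w: "w \<in> seq_span M y ?K (carrier M) k" "\<phi> u = \<phi> w" unfolding im[symmetric] by blast
    have wc: "w \<in> carrier M" using w(1) M.submoduleE(1)[OF S] by blast
    have "\<phi> (u \<ominus>\<^bsub>M\<^esub> w) = \<zero>\<^bsub>M'\<^esub>"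
      using mod_hom_minus[OF assms(1-3) assms(5) wc] w(2) mod_hom_closed[OF assms(3) wc]
      by (simp add: a_minus_def M'.r_neg)
    hence "u \<ominus>\<^bsub>M\<^esub> w \<in> ?K" using assms(5) wc by simp
    hence "u \<ominus>\<^bsub>M\<^esub> w \<in> seq_span M y ?K (carrier M) k"
      by (rule M.seq_span_base[OF K M.carrier_is_submodule assms(4)])
    thus "u \<in> seq_span M y ?K (carrier M) k" using M.submodule_add_iff(2)[OF S assms(5) w(1)] by simp
  next
    assume "u \<in> seq_span M y ?K (carrier M) k"
    thus "\<phi> u \<in> seq_span M' y {\<zero>\<^bsub>M'\<^esub>} (\<phi> ` carrier M) k" unfolding im[symmetric] by blast
  qed
qed

text \<open>The sequence is regular on \<open>M/N\<close>; then \<open>Tor\<^sub>1(M/N, R/(y)) = 0\<close>, which says that \<open>N/(y)N\<close> embeds into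
  \<open>M/(y)M\<close>.\<close>

lemma (in module) seq_span_Int_submodule:
  assumes N: "submodule N R M" and y: "\<forall>j<k. y j \<in> carrier R"
    and reg: "\<And>j v. j < k \<Longrightarrow> v \<in> carrier M \<Longrightarrow> y j \<odot>\<^bsub>M\<^esub> v \<in> seq_span M y N (carrier M) j \<Longrightarrow>
      v \<in> seq_span M y N (carrier M) j"
  shows "N \<inter> seq_span M y {\<zero>\<^bsub>M\<^esub>} (carrier M) k \<subseteq> seq_span M y {\<zero>\<^bsub>M\<^esub>} N k"
  using y reg
proof (induction k)
  case 0 thus ?case by simp
next
  case (Suc k)
  note Fs = carrier_is_submodule and Zs = zero_submodule
  have yk: "y k \<in> carrier R" and y: "\<forall>j<k. y j \<in> carrier R" using Suc.prems(1) by auto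
  have S: "submodule (seq_span M y {\<zero>\<^bsub>M\<^esub>} (carrier M) k) R M"
    "submodule (seq_span M y N (carrier M) k) R M"
    by (rule seq_span_submodule[OF Zs Fs y], rule seq_span_submodule[OF N Fs y])
  have Nc: "x \<in> carrier M" if "x \<in> N" for x using that submoduleE(1)[OF N] by blast
  have Sc: "x \<in> carrier M" if "x \<in> seq_span M y {\<zero>\<^bsub>M\<^esub>} (carrier M) k" for x
    using that submoduleE(1)[OF S(1)] by blast
  have IH: "N \<inter> seq_span M y {\<zero>\<^bsub>M\<^esub>} (carrier M) k \<subseteq> seq_span M y {\<zero>\<^bsub>M\<^esub>} N k"
    using Suc.prems by (intro Suc.IH) auto
  show ?case
  proof
    fix n assume "n \<in> N \<inter> seq_span M y {\<zero>\<^bsub>M\<^esub>} (carrier M) (Suc k)"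
    then obtain s f where n: "n \<in> N" and sf: "s \<in> seq_span M y {\<zero>\<^bsub>M\<^esub>} (carrier M) k" "f \<in> carrier M"
      "n = s \<oplus>\<^bsub>M\<^esub> y k \<odot>\<^bsub>M\<^esub> f" by auto
    have yf: "y k \<odot>\<^bsub>M\<^esub> f = n \<ominus>\<^bsub>M\<^esub> s"
      unfolding sf(3) using Sc[OF sf(1)] sf(2) yk by (simp add: add_minus_cancel)
    have "n \<in> seq_span M y N (carrier M) k"
      by (rule seq_span_base[OF N Fs y n])
    moreover have "s \<in> seq_span M y N (carrier M) k"
      using seq_span_mono[of "{\<zero>\<^bsub>M\<^esub>}" N] submodule_zero[OF N] sf(1) by blast
    ultimately have "y k \<odot>\<^bsub>M\<^esub> f \<in> seq_span M y N (carrier M) k"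
      unfolding yf by (rule submodule_minus[OF S(2)])
    hence "f \<in> seq_span M y N (carrier M) k" using Suc.prems(2)[of k f] sf(2) by simp
    then obtain n' s' where ns: "n' \<in> N" "s' \<in> seq_span M y {\<zero>\<^bsub>M\<^esub>} (carrier M) k" "f = n' \<oplus>\<^bsub>M\<^esub> s'"
      using seq_span_split[OF N Fs y] by blast
    have eq: "n = (s \<oplus>\<^bsub>M\<^esub> y k \<odot>\<^bsub>M\<^esub> s') \<oplus>\<^bsub>M\<^esub> y k \<odot>\<^bsub>M\<^esub> n'"
      unfolding sf(3) ns(3) using Sc[OF sf(1)] Sc[OF ns(2)] Nc[OF ns(1)] yk
      by (simp add: smult_r_distr M.a_ac)
    let ?t = "s \<oplus>\<^bsub>M\<^esub> y k \<odot>\<^bsub>M\<^esub> s'"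
    have t: "?t \<in> seq_span M y {\<zero>\<^bsub>M\<^esub>} (carrier M) k"
      using submoduleE(4,5)[OF S(1)] sf(1) ns(2) yk by blast
    have "y k \<odot>\<^bsub>M\<^esub> n' \<in> N" using submoduleE(4)[OF N yk ns(1)] .
    hence "?t \<in> N" using submodule_add_iff(1)[OF N Sc[OF t]] n eq by simp
    hence "?t \<in> seq_span M y {\<zero>\<^bsub>M\<^esub>} N k" using IH t by blast
    thus "n \<in> seq_span M y {\<zero>\<^bsub>M\<^esub>} N (Suc k)" using eq ns(1) by auto
  qed
qed

section \<open>Free modules of finite rank\<close>

text \<open>Vectors are functions on the natural numbers that vanish from \<open>b\<close> on. All ranks share one type, and
  a free module is a submodule of those of higher rank; so a resolution is a single sequence of
  modules. The multiplication and the unity of the record are placeholders.\<close>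

definition free_mod :: "('a, 'b) ring_scheme \<Rightarrow> nat \<Rightarrow> ('a, nat \<Rightarrow> 'a) module" where
  "free_mod R b = \<lparr>carrier = {f. (\<forall>i. f i \<in> carrier R) \<and> (\<forall>i\<ge>b. f i = \<zero>\<^bsub>R\<^esub>)},
     monoid.mult = (\<lambda>f g. f), one = (\<lambda>i. \<zero>\<^bsub>R\<^esub>),
     ring.zero = (\<lambda>i. \<zero>\<^bsub>R\<^esub>), ring.add = (\<lambda>f g i. f i \<oplus>\<^bsub>R\<^esub> g i),
     smult = (\<lambda>r f i. r \<otimes>\<^bsub>R\<^esub> f i)\<rparr>"

definition unit_vec :: "('a, 'b) ring_scheme \<Rightarrow> nat \<Rightarrow> nat \<Rightarrow> 'a" where
  "unit_vec R j = (\<lambda>i. if i = j then \<one>\<^bsub>R\<^esub> else \<zero>\<^bsub>R\<^esub>)"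

primrec lincomb :: "('a, 'm, 'x) module_scheme \<Rightarrow> (nat \<Rightarrow> 'm) \<Rightarrow> (nat \<Rightarrow> 'a) \<Rightarrow> nat \<Rightarrow> 'm" where
  "lincomb M a f 0 = \<zero>\<^bsub>M\<^esub>"
| "lincomb M a f (Suc c) = lincomb M a f c \<oplus>\<^bsub>M\<^esub> f c \<odot>\<^bsub>M\<^esub> a c"

lemma free_mod_simps:
  "f \<in> carrier (free_mod R b) \<longleftrightarrow> (\<forall>i. f i \<in> carrier R) \<and> (\<forall>i\<ge>b. f i = \<zero>\<^bsub>R\<^esub>)"
  "\<zero>\<^bsub>free_mod R b\<^esub> = (\<lambda>i. \<zero>\<^bsub>R\<^esub>)"
  "f \<oplus>\<^bsub>free_mod R b\<^esub> g = (\<lambda>i. f i \<oplus>\<^bsub>R\<^esub> g i)"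
  "r \<odot>\<^bsub>free_mod R b\<^esub> f = (\<lambda>i. r \<otimes>\<^bsub>R\<^esub> f i)"
  by (simp_all add: free_mod_def)

lemma (in cring) module_free_mod: "module R (free_mod R b)"
proof (rule moduleI[OF is_cring])
  show "abelian_group (free_mod R b)"
  proof (rule abelian_groupI)
    fix f assume f: "f \<in> carrier (free_mod R b)"
    show "\<exists>g\<in>carrier (free_mod R b). g \<oplus>\<^bsub>free_mod R b\<^esub> f = \<zero>\<^bsub>free_mod R b\<^esub>"
      using f by (intro bexI[of _ "\<lambda>i. \<ominus> f i"]) (auto simp: free_mod_simps l_neg)
  qed (auto simp: free_mod_simps a_ac)
qed (auto simp: free_mod_simps l_distr r_distr m_assoc)

lemma (in cring) unit_vec_closed: "j < b \<Longrightarrow> unit_vec R j \<in> carrier (free_mod R b)"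
  by (auto simp: unit_vec_def free_mod_simps)

lemma (in cring) free_mod_minus:
  assumes "f \<in> carrier (free_mod R b)" "g \<in> carrier (free_mod R b)"
  shows "f \<ominus>\<^bsub>free_mod R b\<^esub> g = (\<lambda>i. f i \<ominus> g i)"
proof -
  interpret F: module R "free_mod R b" by (rule module_free_mod)
  show ?thesis using assms
    by (simp add: a_minus_def F.minus_eq_smult) (simp add: free_mod_simps l_minus)
qed

context module
begin

lemma lincomb_closed:
  "(\<And>j. j < c \<Longrightarrow> a j \<in> carrier M) \<Longrightarrow> (\<And>j. f j \<in> carrier R) \<Longrightarrow> lincomb M a f c \<in> carrier M"
  by (induction c) auto

lemma lincomb_submodule:
  assumes "submodule N R M" "\<And>j. j < c \<Longrightarrow> a j \<in> N" "\<And>j. f j \<in> carrier R"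
  shows "lincomb M a f c \<in> N"
  using assms(2)
proof (induction c)
  case 0 thus ?case using submodule_zero[OF assms(1)] by simp
next
  case (Suc c)
  have "f c \<odot>\<^bsub>M\<^esub> a c \<in> N" using submoduleE(4)[OF assms(1) assms(3)] Suc.prems by blast
  thus ?case using Suc submoduleE(5)[OF assms(1)] by auto
qed

lemma lincomb_cong:
  "(\<And>j. j < c \<Longrightarrow> a j = a' j) \<Longrightarrow> lincomb M a f c = lincomb M a' f c"
  by (induction c) auto

lemma lincomb_unit_vec:
  assumes "\<And>j. j < c \<Longrightarrow> a j \<in> carrier M" "i < c"
  shows "lincomb M a (unit_vec R i) c = a i"
proof -
  have "lincomb M a (unit_vec R i) k = (if i < k then a i else \<zero>\<^bsub>M\<^esub>)" if "k \<le> c" for k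
    using that
  proof (induction k)
    case (Suc k)
    thus ?case using assms(1)[of k] assms(1)[of i] by (auto simp: unit_vec_def less_Suc_eq)
  qed simp
  thus ?thesis using assms(2) by simp
qed

end

lemma lincomb_hom:
  fixes R (structure)
  assumes "module R M" "\<And>j. j < c \<Longrightarrow> a j \<in> carrier M"
  shows "(\<lambda>f. lincomb M a f c) \<in> mod_hom R (free_mod R c) M"
proof -
  interpret module R M by fact
  have cl: "lincomb M a f k \<in> carrier M" if "k \<le> c" "\<And>j. f j \<in> carrier R" for f k
    using assms(2) that by (intro lincomb_closed) auto
  have add: "lincomb M a (\<lambda>i. f i \<oplus> g i) k = lincomb M a f k \<oplus>\<^bsub>M\<^esub> lincomb M a g k"
    if "k \<le> c" "\<And>j. f j \<in> carrier R" "\<And>j. g j \<in> carrier R" for f g k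
    using that(1)
  proof (induction k)
    case (Suc k)
    have "a k \<in> carrier M" "lincomb M a f k \<in> carrier M" "lincomb M a g k \<in> carrier M"
      using assms(2) cl that Suc.prems by auto
    thus ?case using Suc that by (simp add: smult_l_distr M.a_ac)
  qed simp
  have sm: "lincomb M a (\<lambda>i. r \<otimes> f i) k = r \<odot>\<^bsub>M\<^esub> lincomb M a f k"
    if "k \<le> c" "\<And>j. f j \<in> carrier R" "r \<in> carrier R" for f r k
    using that(1)
  proof (induction k)
    case (Suc k)
    have "a k \<in> carrier M" "lincomb M a f k \<in> carrier M"
      using assms(2) cl that Suc.prems by auto
    thus ?case using Suc that by (simp add: smult_r_distr smult_assoc1)
  qed (use that in simp)
  show ?thesis using cl[of c] add[of c] sm[of c] by (auto simp: mod_hom_def free_mod_simps)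
qed

lemma mod_hom_lincomb:
  assumes "module R M" "module R N" "\<phi> \<in> mod_hom R M N" "\<And>j. j < c \<Longrightarrow> a j \<in> carrier M"
    "\<And>j. f j \<in> carrier R"
  shows "\<phi> (lincomb M a f c) = lincomb N (\<lambda>j. \<phi> (a j)) f c"
  using assms(4)
proof (induction c)
  case 0 thus ?case using mod_hom_zero[OF assms(1-3)] by simp
next
  case (Suc c)
  interpret M: module R M by fact
  have "lincomb M a f c \<in> carrier M" "a c \<in> carrier M"
    using Suc.prems assms(5) by (auto intro!: M.lincomb_closed)
  thus ?case using Suc mod_hom_add[OF assms(3)] mod_hom_smult[OF assms(3)] assms(5) by simp
qed

lemma (in cring) lincomb_unit_vecs:
  assumes "f \<in> carrier (free_mod R c)"
  shows "lincomb (free_mod R c) (unit_vec R) f c = f"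
proof -
  have fc: "f i \<in> carrier R" for i using assms by (simp add: free_mod_simps)
  have "lincomb (free_mod R c) (unit_vec R) f k = (\<lambda>i. if i < k then f i else \<zero>)" for k
    by (induction k) (auto simp: free_mod_simps unit_vec_def fc less_Suc_eq)
  thus ?thesis using assms by (auto simp: free_mod_simps fun_eq_iff)
qed

text \<open>The components of the multipliers can be chosen independently.\<close>

lemma (in cring) free_mod_seq_span_iff:
  assumes L: "ideal L R" and y: "\<forall>j<k. y j \<in> carrier R"
  shows "f \<in> seq_span (free_mod R c) y {f \<in> carrier (free_mod R c). \<forall>i. f i \<in> L} (carrier (free_mod R c)) k \<longleftrightarrow>
    f \<in> carrier (free_mod R c) \<and> (\<forall>i. f i \<in> Idl (L \<union> y ` {..<k}))"
  using y
proof (induction k arbitrary: f)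
  case 0 thus ?case by (simp add: Idl_ideal L)
next
  case (Suc k)
  let ?L = "Idl (L \<union> y ` {..<k})"
  let ?S = "seq_span (free_mod R c) y {f \<in> carrier (free_mod R c). \<forall>i. f i \<in> L} (carrier (free_mod R c))"
  have yk: "y k \<in> carrier R" and sub: "y ` {..<k} \<subseteq> carrier R" using Suc.prems by auto
  have idL: "ideal ?L R" by (rule Idl_ideal_Un(1)[OF L sub])
  have ins: "Idl (L \<union> y ` {..<Suc k}) = Idl (insert (y k) ?L)"
    unfolding Idl_insert_Idl[OF L sub yk] by (simp add: lessThan_Suc)
  have IH: "g \<in> ?S k \<longleftrightarrow> g \<in> carrier (free_mod R c) \<and> (\<forall>i. g i \<in> ?L)" for g
    using Suc by simp
  show ?case
  proof
    assume "f \<in> ?S (Suc k)"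
    then obtain s n where sn: "s \<in> carrier (free_mod R c)" "\<forall>i. s i \<in> ?L" "n \<in> carrier (free_mod R c)"
      "f = s \<oplus>\<^bsub>free_mod R c\<^esub> y k \<odot>\<^bsub>free_mod R c\<^esub> n" using IH by auto
    have fi: "f i = s i \<oplus> n i \<otimes> y k" for i
      unfolding sn(4) using sn(3) yk by (simp add: free_mod_simps m_comm)
    interpret F: module R "free_mod R c" by (rule module_free_mod)
    have "f \<in> carrier (free_mod R c)" unfolding sn(4) using sn(1,3) yk by simp
    moreover have "n i \<in> carrier R" for i using sn(3) by (simp add: free_mod_simps)
    hence "f i \<in> Idl (L \<union> y ` {..<Suc k})" for i
      unfolding ins Idl_insert_iff[OF idL yk] using fi sn(2) by blast
    ultimately show "f \<in> carrier (free_mod R c) \<and> (\<forall>i. f i \<in> Idl (L \<union> y ` {..<Suc k}))" by blast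
  next
    assume f: "f \<in> carrier (free_mod R c) \<and> (\<forall>i. f i \<in> Idl (L \<union> y ` {..<Suc k}))"
    hence "\<forall>i. \<exists>s r. s \<in> ?L \<and> r \<in> carrier R \<and> f i = s \<oplus> r \<otimes> y k"
      unfolding ins Idl_insert_iff[OF idL yk] by blast
    then obtain s r where sr: "\<And>i. s i \<in> ?L" "\<And>i. r i \<in> carrier R" "\<And>i. f i = s i \<oplus> r i \<otimes> y k"
      by metis
    have sc: "s i \<in> carrier R" for i using sr(1) ideal.Icarr[OF idL] by blast
    have zL: "\<zero> \<in> ?L" using idL by (simp add: additive_subgroup.zero_closed ideal.axioms(1))
    let ?s = "\<lambda>i. if i < c then s i else \<zero>" and ?r = "\<lambda>i. if i < c then r i else \<zero>"
    have "?s \<in> ?S k" unfolding IH using sr(1) sc zL by (auto simp: free_mod_simps)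
    moreover have "?r \<in> carrier (free_mod R c)" using sr(2) by (auto simp: free_mod_simps)
    moreover have "f = ?s \<oplus>\<^bsub>free_mod R c\<^esub> y k \<odot>\<^bsub>free_mod R c\<^esub> ?r"
    proof
      fix i
      show "f i = (?s \<oplus>\<^bsub>free_mod R c\<^esub> y k \<odot>\<^bsub>free_mod R c\<^esub> ?r) i"
        using f sr(2)[of i] sr(3)[of i] yk by (auto simp: free_mod_simps m_comm)
    qed
    ultimately show "f \<in> ?S (Suc k)" by auto
  qed
qed

lemma (in cring) free_mod_zero_span_iff:
  assumes y: "\<forall>j<k. y j \<in> carrier R"
  shows "f \<in> seq_span (free_mod R c) y {\<zero>\<^bsub>free_mod R c\<^esub>} (carrier (free_mod R c)) k \<longleftrightarrow>
    f \<in> carrier (free_mod R c) \<and> (\<forall>i. f i \<in> Idl ({\<zero>} \<union> y ` {..<k}))"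
proof -
  have "{f \<in> carrier (free_mod R c). \<forall>i. f i \<in> {\<zero>}} = {\<zero>\<^bsub>free_mod R c\<^esub>}"
    by (auto simp: free_mod_simps)
  thus ?thesis using free_mod_seq_span_iff[OF zeroideal y, of f c] by (simp only:)
qed

lemma (in cring) free_mod_regular:
  assumes "\<forall>j<d. y j \<in> carrier R" "k < d"
    and "\<And>v. v \<in> carrier R \<Longrightarrow> y k \<otimes> v \<in> Idl ({\<zero>} \<union> y ` {..<k}) \<Longrightarrow> v \<in> Idl ({\<zero>} \<union> y ` {..<k})"
    and "f \<in> carrier (free_mod R c)"
    and "y k \<odot>\<^bsub>free_mod R c\<^esub> f \<in> seq_span (free_mod R c) y {\<zero>\<^bsub>free_mod R c\<^esub>} (carrier (free_mod R c)) k"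
  shows "f \<in> seq_span (free_mod R c) y {\<zero>\<^bsub>free_mod R c\<^esub>} (carrier (free_mod R c)) k"
proof -
  have y: "\<forall>j<k. y j \<in> carrier R" using assms(1,2) by simp
  have "f i \<in> Idl ({\<zero>} \<union> y ` {..<k})" for i
  proof (rule assms(3))
    show "f i \<in> carrier R" using assms(4) by (simp add: free_mod_simps)
    show "y k \<otimes> f i \<in> Idl ({\<zero>} \<union> y ` {..<k})"
      using assms(5) unfolding free_mod_zero_span_iff[OF y] unfolding free_mod_simps(4) by blast
  qed
  thus ?thesis unfolding free_mod_zero_span_iff[OF y] using assms(4) by blast
qed

section \<open>Socles and depth along a minimal free resolution\<close>

text \<open>A minimal free resolution \<open>\<dots> \<rightarrow> F\<^sub>2 \<rightarrow> F\<^sub>1 \<rightarrow> F\<^sub>0 = R \<rightarrow> R/I \<rightarrow> 0\<close> of possibly infinite length. The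
  differential \<open>D i\<close> from \<open>F (Suc i)\<close> to \<open>F i\<close> is kept as the matrix with columns \<open>a i\<close>, because
  Frobenius acts on its entries. The image \<open>N i\<close> of \<open>D i\<close> is a syzygy module; in particular \<open>N 0\<close> is \<open>I\<close>, and \<open>F i / N i\<close> is
  isomorphic to \<open>R/I\<close> for \<open>i = 0\<close> and to the syzygy module in \<open>F (i - 1)\<close> for \<open>i > 0\<close>.\<close>

locale minimal_free_resolution = noetherian_local_ring R \<mm> for R (structure) and \<mm> +
  fixes I :: "'a set" and b :: "nat \<Rightarrow> nat" and a :: "nat \<Rightarrow> nat \<Rightarrow> nat \<Rightarrow> 'a"
    and D :: "nat \<Rightarrow> (nat \<Rightarrow> 'a) \<Rightarrow> nat \<Rightarrow> 'a" and N :: "nat \<Rightarrow> (nat \<Rightarrow> 'a) set"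
  defines "D \<equiv> \<lambda>i f. lincomb (free_mod R (b i)) (a i) f (b (Suc i))"
    and "N \<equiv> \<lambda>i. D i ` carrier (free_mod R (b (Suc i)))"
  assumes ideal_I: "ideal I R" and I_proper: "I \<noteq> carrier R"
    and rank_0: "b 0 = 1"
    and columns: "j < b (Suc i) \<Longrightarrow> a i j \<in> carrier (free_mod R (b i))"
    and N_0: "N 0 = {f \<in> carrier (free_mod R (b 0)). f 0 \<in> I}"
    and exact: "N (Suc i) = {f \<in> carrier (free_mod R (b (Suc i))). D i f = \<zero>\<^bsub>free_mod R (b i)\<^esub>}"
    and minimal: "f \<in> N (Suc i) \<Longrightarrow> f k \<in> \<mm>"
begin

abbreviation F :: "nat \<Rightarrow> ('a, nat \<Rightarrow> 'a) module" where "F i \<equiv> free_mod R (b i)"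

lemma module_F: "module R (F i)"
  by (rule module_free_mod)

lemma D_hom: "D i \<in> mod_hom R (F (Suc i)) (F i)"
  unfolding D_def by (intro lincomb_hom module_F columns)

lemma N_eq: "N i = D i ` carrier (F (Suc i))"
  by (simp add: N_def)

lemma N_submodule: "submodule (N i) R (F i)"
  unfolding N_eq using image_submodule[OF module_F module_F D_hom] module.carrier_is_submodule[OF module_F]
  by blast

text \<open>Components beyond the first vanish on \<open>F 0\<close>.\<close>

lemma F_0_eq: "{f \<in> carrier (F 0). f 0 \<in> L} = {f \<in> carrier (F 0). \<forall>i. f i \<in> L}"
  if "ideal L R"
proof -
  have "\<zero> \<in> L" using that by (simp add: additive_subgroup.zero_closed ideal.axioms(1))
  moreover have "f i = \<zero>" if "f \<in> carrier (F 0)" "i \<noteq> 0" for f i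
    using that rank_0 by (simp add: free_mod_simps)
  ultimately show ?thesis by (auto, metis)
qed

lemma D_unit_vec: "j < b (Suc i) \<Longrightarrow> D i (unit_vec R j) = a i j"
  unfolding D_def by (rule module.lincomb_unit_vec[OF module_F]) (auto intro: columns)

lemma column_in_max:
  assumes "j < b (Suc i)" shows "a i j k \<in> \<mm>"
proof -
  have "D i (unit_vec R j) = a i j" using D_unit_vec assms by blast
  hence n: "a i j \<in> N i" unfolding N_eq using unit_vec_closed[OF assms] by force
  show ?thesis
  proof (cases i)
    case 0
    have "I \<subseteq> \<mm>" using proper_ideal_subset_max[OF ideal_I] I_proper by blast
    moreover have "a i j k \<in> I"
      using n F_0_eq[OF ideal_I] unfolding 0 N_0 by blast
    ultimately show ?thesis by blast
  next
    case (Suc i')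
    thus ?thesis using minimal n by blast
  qed
qed

end

text \<open>A maximal regular sequence on \<open>R\<close> whose first \<open>t\<close> elements form a maximal regular sequence on \<open>R/I\<close>.\<close>

locale adapted_sequence = minimal_free_resolution +
  fixes y :: "nat \<Rightarrow> 'a" and d t :: nat
  assumes y_max: "\<forall>j<d. y j \<in> \<mm>"
    and t_le: "t \<le> d"
    and y_regular: "k < d \<Longrightarrow> v \<in> carrier R \<Longrightarrow> y k \<otimes> v \<in> Idl ({\<zero>} \<union> y ` {..<k}) \<Longrightarrow>
      v \<in> Idl ({\<zero>} \<union> y ` {..<k})"
    and y_regular_I: "k < t \<Longrightarrow> v \<in> carrier R \<Longrightarrow> y k \<otimes> v \<in> Idl (I \<union> y ` {..<k}) \<Longrightarrow>
      v \<in> Idl (I \<union> y ` {..<k})"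
    and depth_I: "depth_zero_mod R \<mm> (Idl (I \<union> y ` {..<t}))"
    and depth_0: "depth_zero_mod R \<mm> (Idl ({\<zero>} \<union> y ` {..<d}))"
begin

definition F_span :: "nat \<Rightarrow> nat \<Rightarrow> (nat \<Rightarrow> 'a) set" where
  "F_span i k = seq_span (F i) y {\<zero>\<^bsub>F i\<^esub>} (carrier (F i)) k"

definition NF_span :: "nat \<Rightarrow> nat \<Rightarrow> (nat \<Rightarrow> 'a) set" where
  "NF_span i k = seq_span (F i) y (N i) (carrier (F i)) k"

definition N_span :: "nat \<Rightarrow> nat \<Rightarrow> (nat \<Rightarrow> 'a) set" where
  "N_span i k = seq_span (F i) y {\<zero>\<^bsub>F i\<^esub>} (N i) k"

lemma y_carrier: "k \<le> d \<Longrightarrow> \<forall>j<k. y j \<in> carrier R"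
  using y_max max_carrier by simp

lemma y_closed: "k < d \<Longrightarrow> y k \<in> carrier R"
  using y_max max_carrier by simp

lemma F_span_submodule: "k \<le> d \<Longrightarrow> submodule (F_span i k) R (F i)"
  unfolding F_span_def using y_carrier
  by (intro module.seq_span_submodule module_F module.zero_submodule module.carrier_is_submodule)

lemma NF_span_submodule: "k \<le> d \<Longrightarrow> submodule (NF_span i k) R (F i)"
  unfolding NF_span_def using y_carrier
  by (intro module.seq_span_submodule module_F N_submodule module.carrier_is_submodule)

lemma F_span_iff: "k \<le> d \<Longrightarrow> f \<in> F_span i k \<longleftrightarrow>
    f \<in> carrier (F i) \<and> (\<forall>j. f j \<in> Idl ({\<zero>} \<union> y ` {..<k}))"
  unfolding F_span_def by (rule free_mod_zero_span_iff[OF y_carrier])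

text \<open>A regular sequence on \<open>R\<close> is regular on free modules.\<close>

lemma F_span_regular:
  assumes "k < d" "f \<in> carrier (F i)" "y k \<odot>\<^bsub>F i\<^esub> f \<in> F_span i k"
  shows "f \<in> F_span i k"
  unfolding F_span_def
proof (rule free_mod_regular[OF y_carrier[OF order_refl] assms(1)])
  show "v \<in> Idl ({\<zero>} \<union> y ` {..<k})"
    if "v \<in> carrier R" "y k \<otimes> v \<in> Idl ({\<zero>} \<union> y ` {..<k})" for v
    using assms(1) that by (rule y_regular)
qed (use assms(2,3) in \<open>simp_all only: F_span_def\<close>)

lemma N_span_subset: "N_span i k \<subseteq> F_span i k"
  unfolding N_span_def F_span_def
  using module.submoduleE(1)[OF module_F N_submodule] by (intro seq_span_mono) auto

lemma F_span_subset: "F_span i k \<subseteq> NF_span i k"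
  unfolding NF_span_def F_span_def
  using module.submodule_zero[OF module_F N_submodule] by (intro seq_span_mono) auto

lemma NF_span_mono: "k \<le> l \<Longrightarrow> l \<le> d \<Longrightarrow> NF_span i k \<subseteq> NF_span i l"
  unfolding NF_span_def
  by (intro module.seq_span_mono_length[OF module_F N_submodule module.carrier_is_submodule[OF module_F]] y_carrier)

lemma NF_span_smult: "j < k \<Longrightarrow> k \<le> d \<Longrightarrow> f \<in> carrier (F i) \<Longrightarrow> y j \<odot>\<^bsub>F i\<^esub> f \<in> NF_span i k"
  unfolding NF_span_def
  by (intro module.seq_span_smult[OF module_F N_submodule module.carrier_is_submodule[OF module_F]] y_carrier)

lemma NF_span_split:
  "k \<le> d \<Longrightarrow> u \<in> NF_span i k \<longleftrightarrow> (\<exists>w\<in>N i. \<exists>s\<in>F_span i k. u = w \<oplus>\<^bsub>F i\<^esub> s)"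
  unfolding NF_span_def F_span_def
  by (intro module.seq_span_split[OF module_F N_submodule module.carrier_is_submodule[OF module_F]] y_carrier)

lemma D_in_N_span_iff:
  assumes "k \<le> d" "f \<in> carrier (F (Suc i))"
  shows "D i f \<in> N_span i k \<longleftrightarrow> f \<in> NF_span (Suc i) k"
  unfolding N_span_def NF_span_def exact N_eq[of i]
  by (rule seq_span_kernel_iff[OF module_F module_F D_hom y_carrier[OF assms(1)] assms(2)])

text \<open>Each syzygy gains one: if \<open>N i/(y)N i\<close> embeds into the free module \<open>F i/(y)F i\<close> for the first
  \<open>t + i\<close> elements, then the next element is regular on it, hence on \<open>F (Suc i)/N (Suc i)\<close>, to which
  \<open>N i\<close> is isomorphic.\<close>

lemma N_Int_F_span: "k \<le> min (t + i) d \<Longrightarrow> N i \<inter> F_span i k \<subseteq> N_span i k"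
proof (induction i arbitrary: k)
  case 0
  have k: "k \<le> t" "k \<le> d" using 0 by auto
  have N0: "N 0 = {f \<in> carrier (F 0). \<forall>i. f i \<in> I}" unfolding N_0 by (rule F_0_eq[OF ideal_I])
  show ?case unfolding N_span_def F_span_def
  proof (rule module.seq_span_Int_submodule[OF module_F N_submodule y_carrier[OF k(2)]])
    fix j f assume j: "j < k" and f: "f \<in> carrier (F 0)"
      and yf: "y j \<odot>\<^bsub>F 0\<^esub> f \<in> seq_span (F 0) y (N 0) (carrier (F 0)) j"
    have yj: "\<forall>l<j. y l \<in> carrier R" using j k by (intro y_carrier) auto
    note iff = free_mod_seq_span_iff[OF ideal_I yj, of _ "b 0", folded N0]
    have "f l \<in> Idl (I \<union> y ` {..<j})" for l
    proof (rule y_regular_I)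
      show "j < t" using j k by simp
      show "f l \<in> carrier R" using f by (simp add: free_mod_simps)
      show "y j \<otimes> f l \<in> Idl (I \<union> y ` {..<j})" using yf unfolding iff unfolding free_mod_simps(4) by blast
    qed
    thus "f \<in> seq_span (F 0) y (N 0) (carrier (F 0)) j" unfolding iff using f by blast
  qed
next
  case (Suc i)
  have kd: "k \<le> d" using Suc.prems by simp
  show ?case unfolding N_span_def F_span_def
  proof (rule module.seq_span_Int_submodule[OF module_F N_submodule y_carrier[OF kd]])
    fix j f assume j: "j < k" and f: "f \<in> carrier (F (Suc i))"
      and yf: "y j \<odot>\<^bsub>F (Suc i)\<^esub> f \<in> seq_span (F (Suc i)) y (N (Suc i)) (carrier (F (Suc i))) j"
    have jd: "j < d" "j \<le> min (t + i) d" using j Suc.prems by auto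
    interpret FS: module R "F (Suc i)" by (rule module_F)
    have c: "y j \<odot>\<^bsub>F (Suc i)\<^esub> f \<in> carrier (F (Suc i))" using f y_closed[OF jd(1)] by simp
    have Df: "D i f \<in> carrier (F i)" using mod_hom_closed[OF D_hom f] .
    have "D i (y j \<odot>\<^bsub>F (Suc i)\<^esub> f) \<in> N_span i j"
      using yf D_in_N_span_iff[OF _ c, of j] jd by (simp add: NF_span_def)
    hence "y j \<odot>\<^bsub>F i\<^esub> D i f \<in> F_span i j"
      using N_span_subset mod_hom_smult[OF D_hom y_closed[OF jd(1)] f] by auto
    hence "D i f \<in> F_span i j" by (rule F_span_regular[OF jd(1) Df])
    hence "D i f \<in> N_span i j" using Suc.IH[OF jd(2)] f unfolding N_eq by blast
    thus "f \<in> seq_span (F (Suc i)) y (N (Suc i)) (carrier (F (Suc i))) j"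
      using D_in_N_span_iff[OF _ f, of j] jd by (simp add: NF_span_def)
  qed
qed

text \<open>The connecting maps embed the elements of \<open>F i / N i\<close> modulo the first \<open>t + i\<close> elements that are killed
  by \<open>y\<close> into those of \<open>F (Suc i) / N (Suc i)\<close> modulo the first \<open>t + i + 1\<close> elements: if
  \<open>y\<^bsub>t+i\<^esub> f = D w + s\<close>, then \<open>f\<close> is sent to \<open>w\<close>. For \<open>i = n\<close> there are none, since \<open>F n\<close> still has
  a further regular element.\<close>

lemma NF_span_killed:
  assumes n: "N n = {\<zero>\<^bsub>F n\<^esub>}" "t + n < d" and "i \<le> n"
    and "f \<in> carrier (F i)" "\<And>j. j < d \<Longrightarrow> y j \<odot>\<^bsub>F i\<^esub> f \<in> NF_span i (t + i)"
  shows "f \<in> NF_span i (t + i)"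
  using assms(3-)
proof (induction i arbitrary: f rule: inc_induct)
  case base
  have "NF_span n (t + n) = F_span n (t + n)" unfolding NF_span_def F_span_def n(1) ..
  thus ?case using F_span_regular[OF n(2) base(1)] base(2)[OF n(2)] by simp
next
  case (step i)
  let ?k = "t + i"
  have k: "?k < d" "?k \<le> d" "Suc ?k \<le> d" "?k \<le> min (t + i) d" using n(2) step.hyps by auto
  interpret F: module R "F i" by (rule module_F)
  interpret FS: module R "F (Suc i)" by (rule module_F)
  note f = \<open>f \<in> carrier (F i)\<close> and yk = y_closed[OF k(1)]
  note S = F_span_submodule[OF k(2), of i] and SE = F.submoduleE[OF F_span_submodule[OF k(2), of i]]
  have Sc: "s \<in> carrier (F i)" if "s \<in> F_span i ?k" for s using that SE(1) by blast
  note Dc = mod_hom_closed[OF D_hom] and Da = mod_hom_add[OF D_hom] and Ds = mod_hom_smult[OF D_hom]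
  have split: "\<exists>w\<in>carrier (F (Suc i)). \<exists>s\<in>F_span i ?k. g = D i w \<oplus>\<^bsub>F i\<^esub> s" if "g \<in> NF_span i ?k" for g
    using that unfolding NF_span_split[OF k(2)] N_eq by blast
  obtain w s where ws: "w \<in> carrier (F (Suc i))" "s \<in> F_span i ?k"
    "y ?k \<odot>\<^bsub>F i\<^esub> f = D i w \<oplus>\<^bsub>F i\<^esub> s"
    using split[OF step.prems(2)[OF k(1)]] by blast
  have "w \<in> NF_span (Suc i) (t + Suc i)"
  proof (rule step.IH[OF ws(1)])
    fix j assume j: "j < d"
    note yj = y_closed[OF j]
    obtain w' s' where ws': "w' \<in> carrier (F (Suc i))" "s' \<in> F_span i ?k"
      "y j \<odot>\<^bsub>F i\<^esub> f = D i w' \<oplus>\<^bsub>F i\<^esub> s'"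
      using split[OF step.prems(2)[OF j]] by blast
    let ?g = "y j \<odot>\<^bsub>F (Suc i)\<^esub> w \<ominus>\<^bsub>F (Suc i)\<^esub> y ?k \<odot>\<^bsub>F (Suc i)\<^esub> w'"
    have gc: "?g \<in> carrier (F (Suc i))" using ws(1) ws'(1) yj yk by simp
    have c: "D i w \<in> carrier (F i)" "D i w' \<in> carrier (F i)" "s \<in> carrier (F i)" "s' \<in> carrier (F i)"
      using Dc ws(1) ws'(1) Sc ws(2) ws'(2) by blast+
    \<comment> \<open>Both sides are \<open>y j y ?k f\<close>; comparing them shows that \<open>D\<close> maps \<open>y j w - y ?k w'\<close> into \<open>F_span i ?k\<close>.\<close>
    have "y j \<odot>\<^bsub>F i\<^esub> (D i w \<oplus>\<^bsub>F i\<^esub> s) = y ?k \<odot>\<^bsub>F i\<^esub> (D i w' \<oplus>\<^bsub>F i\<^esub> s')"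
      unfolding ws(3)[symmetric] ws'(3)[symmetric] using f yj yk
      by (simp add: F.smult_assoc1[symmetric] m_comm)
    hence e: "y j \<odot>\<^bsub>F i\<^esub> D i w \<oplus>\<^bsub>F i\<^esub> y j \<odot>\<^bsub>F i\<^esub> s = y ?k \<odot>\<^bsub>F i\<^esub> D i w' \<oplus>\<^bsub>F i\<^esub> y ?k \<odot>\<^bsub>F i\<^esub> s'"
      using c yj yk by (simp add: F.smult_r_distr)
    have cc: "y j \<odot>\<^bsub>F i\<^esub> D i w \<in> carrier (F i)" "y ?k \<odot>\<^bsub>F i\<^esub> D i w' \<in> carrier (F i)"
      "y j \<odot>\<^bsub>F i\<^esub> s \<in> carrier (F i)" "y ?k \<odot>\<^bsub>F i\<^esub> s' \<in> carrier (F i)"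
      using c yj yk by simp_all
    have rearrange: "p \<ominus>\<^bsub>F i\<^esub> r = u \<ominus>\<^bsub>F i\<^esub> q"
      if "p \<oplus>\<^bsub>F i\<^esub> q = r \<oplus>\<^bsub>F i\<^esub> u" "p \<in> carrier (F i)" "q \<in> carrier (F i)" "r \<in> carrier (F i)" "u \<in> carrier (F i)"
      for p q r u
    proof -
      have "p = (r \<oplus>\<^bsub>F i\<^esub> u) \<ominus>\<^bsub>F i\<^esub> q" using F.add_minus_cancel(1)[OF that(2,3)] that(1) by simp
      thus ?thesis using that(3-5) F.add_minus_cancel(2)[of r "u \<ominus>\<^bsub>F i\<^esub> q"]
        by (simp add: a_minus_def F.M.a_assoc)
    qed
    have "D i ?g = y j \<odot>\<^bsub>F i\<^esub> D i w \<ominus>\<^bsub>F i\<^esub> y ?k \<odot>\<^bsub>F i\<^esub> D i w'"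
      using mod_hom_minus[OF module_F module_F D_hom] ws(1) ws'(1) yj yk Ds by simp
    also have "\<dots> = y ?k \<odot>\<^bsub>F i\<^esub> s' \<ominus>\<^bsub>F i\<^esub> y j \<odot>\<^bsub>F i\<^esub> s"
      by (rule rearrange[OF e cc(1,3,2,4)])
    also have "\<dots> \<in> F_span i ?k"
      using SE(4)[OF yj ws(2)] SE(4)[OF yk ws'(2)] by (intro F.submodule_minus[OF S])
    finally have "D i ?g \<in> N i \<inter> F_span i ?k" using gc unfolding N_eq by blast
    hence "D i ?g \<in> N_span i ?k" using N_Int_F_span[OF k(4)] by blast
    hence "?g \<in> NF_span (Suc i) ?k" using D_in_N_span_iff[OF k(2) gc] by simp
    hence "?g \<in> NF_span (Suc i) (t + Suc i)" using NF_span_mono[of ?k "t + Suc i"] k(3) by auto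
    moreover have "y ?k \<odot>\<^bsub>F (Suc i)\<^esub> w' \<in> NF_span (Suc i) (t + Suc i)"
      using k ws'(1) by (intro NF_span_smult) auto
    ultimately show "y j \<odot>\<^bsub>F (Suc i)\<^esub> w \<in> NF_span (Suc i) (t + Suc i)"
      using FS.submodule_add_iff(2)[OF NF_span_submodule] k(3) ws(1) yj by simp
  qed
  then obtain z g where zg: "z \<in> NF_span (Suc i) ?k" "g \<in> carrier (F (Suc i))"
    "w = z \<oplus>\<^bsub>F (Suc i)\<^esub> y ?k \<odot>\<^bsub>F (Suc i)\<^esub> g" unfolding NF_span_def by auto
  have zc: "z \<in> carrier (F (Suc i))"
    using zg(1) FS.submoduleE(1)[OF NF_span_submodule[OF k(2)]] by blast
  have Dz: "D i z \<in> F_span i ?k"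
    using D_in_N_span_iff[OF k(2) zc] zg(1) N_span_subset by blast
  have gc: "D i g \<in> carrier (F i)" using Dc[OF zg(2)] .
  have Dw: "D i w = D i z \<oplus>\<^bsub>F i\<^esub> y ?k \<odot>\<^bsub>F i\<^esub> D i g"
    unfolding zg(3) using Da Ds zc zg(2) yk by simp
  have "y ?k \<odot>\<^bsub>F i\<^esub> (f \<ominus>\<^bsub>F i\<^esub> D i g) = D i z \<oplus>\<^bsub>F i\<^esub> s"
  proof -
    have "y ?k \<odot>\<^bsub>F i\<^esub> (f \<ominus>\<^bsub>F i\<^esub> D i g) = y ?k \<odot>\<^bsub>F i\<^esub> f \<ominus>\<^bsub>F i\<^esub> y ?k \<odot>\<^bsub>F i\<^esub> D i g"
      using f gc yk by (simp add: a_minus_def F.smult_r_distr F.smult_r_minus)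
    also have "\<dots> = (D i z \<oplus>\<^bsub>F i\<^esub> s \<oplus>\<^bsub>F i\<^esub> y ?k \<odot>\<^bsub>F i\<^esub> D i g) \<ominus>\<^bsub>F i\<^esub> y ?k \<odot>\<^bsub>F i\<^esub> D i g"
      unfolding ws(3) Dw using Sc[OF Dz] Sc[OF ws(2)] gc yk by (simp add: F.M.a_ac)
    also have "\<dots> = D i z \<oplus>\<^bsub>F i\<^esub> s"
      using Sc[OF Dz] Sc[OF ws(2)] gc yk by (intro F.add_minus_cancel) simp_all
    finally show ?thesis .
  qed
  hence "y ?k \<odot>\<^bsub>F i\<^esub> (f \<ominus>\<^bsub>F i\<^esub> D i g) \<in> F_span i ?k" using SE(5)[OF Dz ws(2)] by simp
  hence "f \<ominus>\<^bsub>F i\<^esub> D i g \<in> F_span i ?k"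
    by (rule F_span_regular[OF k(1), rotated]) (use f gc in simp)
  moreover have "f = D i g \<oplus>\<^bsub>F i\<^esub> (f \<ominus>\<^bsub>F i\<^esub> D i g)"
    using F.add_minus_cancel(3)[OF f gc] f gc by (simp add: F.M.a_comm)
  ultimately show ?case unfolding NF_span_split[OF k(2)] N_eq using zg(2) by blast
qed

text \<open>One half of the Auslander-Buchsbaum formula: otherwise a socle element of
  \<open>R/(I, y\<^sub>0, \<dots>, y\<^bsub>t-1\<^esub>)\<close> would vanish by the embeddings above.\<close>

lemma auslander_buchsbaum_ge:
  assumes "N n = {\<zero>\<^bsub>F n\<^esub>}"
  shows "d \<le> t + n"
proof (rule ccontr)
  assume "\<not> d \<le> t + n"
  hence lt: "t + n < d" by simp
  obtain s where s: "s \<in> carrier R" "s \<notin> Idl (I \<union> y ` {..<t})" "\<And>u. u \<in> \<mm> \<Longrightarrow> u \<otimes> s \<in> Idl (I \<union> y ` {..<t})"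
    using depth_I unfolding depth_zero_mod_def by blast
  have N0: "N 0 = {f \<in> carrier (F 0). \<forall>i. f i \<in> I}" unfolding N_0 by (rule F_0_eq[OF ideal_I])
  note iff = free_mod_seq_span_iff[OF ideal_I y_carrier[OF t_le], of _ "b 0", folded N0 NF_span_def]
  have sub: "y ` {..<t} \<subseteq> carrier R" using y_carrier[OF t_le] by auto
  have idJ: "ideal (Idl (I \<union> y ` {..<t})) R" by (rule Idl_ideal_Un(1)[OF ideal_I sub])
  have z: "\<zero> \<in> Idl (I \<union> y ` {..<t})" using idJ by (simp add: additive_subgroup.zero_closed ideal.axioms(1))
  let ?f = "\<lambda>i::nat. if i = 0 then s else \<zero>"
  have fc: "?f \<in> carrier (F 0)" using s(1) rank_0 by (simp add: free_mod_simps)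
  interpret F: module R "F 0" by (rule module_F)
  have "?f \<in> NF_span 0 (t + 0)"
  proof (rule NF_span_killed[OF assms lt le0 fc])
    fix j assume j: "j < d"
    have "y j \<odot>\<^bsub>F 0\<^esub> ?f \<in> carrier (F 0)" using fc y_closed[OF j] by (rule F.smult_closed[rotated])
    moreover have "(y j \<odot>\<^bsub>F 0\<^esub> ?f) i \<in> Idl (I \<union> y ` {..<t})" for i
      using s(3)[of "y j"] z y_max j y_closed[OF j] by (simp add: free_mod_simps)
    ultimately show "y j \<odot>\<^bsub>F 0\<^esub> ?f \<in> NF_span 0 (t + 0)" unfolding add_0_right iff by blast
  qed
  hence "\<forall>i. ?f i \<in> Idl (I \<union> y ` {..<t})" unfolding add_0_right iff by (rule conjunct2)
  from spec[OF this, of 0] show False using s(2) by simp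
qed

text \<open>Entries of a minimal resolution lie in the maximal ideal, so a socle element of \<open>R/(y)\<close> annihilates
  the columns modulo \<open>(y)\<close>.\<close>

lemma column_times_socle:
  assumes v: "v \<in> carrier R" "\<And>u. u \<in> \<mm> \<Longrightarrow> u \<otimes> v \<in> Idl ({\<zero>} \<union> y ` {..<d})" and b: "0 < b (Suc i)"
  shows "D i (v \<odot>\<^bsub>F (Suc i)\<^esub> unit_vec R 0) \<in> F_span i d"
proof -
  have e: "unit_vec R 0 \<in> carrier (F (Suc i))" by (rule unit_vec_closed[OF b])
  have "D i (unit_vec R 0) = a i 0" using D_unit_vec b by blast
  hence eq: "D i (v \<odot>\<^bsub>F (Suc i)\<^esub> unit_vec R 0) = v \<odot>\<^bsub>F i\<^esub> a i 0"
    using mod_hom_smult[OF D_hom v(1) e] by simp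
  have ac: "a i 0 \<in> carrier (F i)" by (rule columns[OF b])
  interpret F: module R "F i" by (rule module_F)
  have "(v \<odot>\<^bsub>F i\<^esub> a i 0) k \<in> Idl ({\<zero>} \<union> y ` {..<d})" for k
    using v(2)[OF column_in_max[OF b, of k]] max_carrier[OF column_in_max[OF b, of k]] v(1)
    by (simp add: free_mod_simps m_comm)
  thus ?thesis unfolding eq F_span_iff[OF order_refl] using v(1) ac by blast
qed

text \<open>The other half. If \<open>n = i + 1\<close> and \<open>t + n > d\<close>, then \<open>N i/(y)N i\<close> embeds into \<open>F i/(y)F i\<close> for the whole
  sequence, and \<open>N i\<close> is isomorphic to \<open>F n\<close>; but a socle element of \<open>R/(y)\<close> times a basis vector of
  \<open>F n\<close> is mapped to zero.\<close>

lemma auslander_buchsbaum_le: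
  assumes n: "N n = {\<zero>\<^bsub>F n\<^esub>}" and b: "0 < b n"
  shows "t + n \<le> d"
proof (cases n)
  case 0 thus ?thesis using t_le by simp
next
  case (Suc i)
  show ?thesis
  proof (rule ccontr)
    assume "\<not> t + n \<le> d"
    hence k: "d \<le> min (t + i) d" using Suc by simp
    obtain v where v: "v \<in> carrier R" "v \<notin> Idl ({\<zero>} \<union> y ` {..<d})"
      "\<And>u. u \<in> \<mm> \<Longrightarrow> u \<otimes> v \<in> Idl ({\<zero>} \<union> y ` {..<d})"
      using depth_0 unfolding depth_zero_mod_def by blast
    interpret F: module R "F (Suc i)" by (rule module_F)
    let ?w = "v \<odot>\<^bsub>F (Suc i)\<^esub> unit_vec R 0"
    have w: "?w \<in> carrier (F (Suc i))" using unit_vec_closed[of 0 "b (Suc i)"] b v(1) Suc by simp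
    have "D i ?w \<in> F_span i d" using b Suc by (intro column_times_socle v(1,3)) auto
    hence "D i ?w \<in> N_span i d" using N_Int_F_span[OF k] w unfolding N_eq by blast
    hence "?w \<in> NF_span (Suc i) d" using D_in_N_span_iff[OF order_refl w] by blast
    hence "?w \<in> F_span (Suc i) d" using n unfolding NF_span_def F_span_def Suc by simp
    hence "?w 0 \<in> Idl ({\<zero>} \<union> y ` {..<d})" unfolding F_span_iff[OF order_refl] by blast
    thus False using v(1,2) by (simp add: free_mod_simps unit_vec_def)
  qed
qed

end

section \<open>The zigzag and its Frobenius power\<close>

text \<open>The entrywise \<open>q\<close>-th power \<open>\<Phi>\<close> is additive and carries \<open>D i\<close> to the map \<open>Dq i\<close> given by the matrix of
  \<open>q\<close>-th powers. The maps \<open>Dq i\<close> form a complex.\<close>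

locale frobenius_adapted_sequence = adapted_sequence +
  fixes q :: nat and \<Phi> :: "(nat \<Rightarrow> 'a) \<Rightarrow> nat \<Rightarrow> 'a"
    and Dq :: "nat \<Rightarrow> (nat \<Rightarrow> 'a) \<Rightarrow> nat \<Rightarrow> 'a" and yq :: "nat \<Rightarrow> 'a"
  defines "\<Phi> \<equiv> \<lambda>f i. f i [^] q"
    and "Dq \<equiv> \<lambda>i f. lincomb (free_mod R (b i)) (\<lambda>j. \<Phi> (a i j)) f (b (Suc i))"
    and "yq \<equiv> \<lambda>j. y j [^] q"
  assumes q_pos: "0 < q"
    and q_add: "x \<in> carrier R \<Longrightarrow> z \<in> carrier R \<Longrightarrow> (x \<oplus> z) [^] q = x [^] q \<oplus> z [^] q"
    and yq_regular: "k < d \<Longrightarrow> v \<in> carrier R \<Longrightarrow> yq k \<otimes> v \<in> Idl ({\<zero>} \<union> yq ` {..<k}) \<Longrightarrow>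
      v \<in> Idl ({\<zero>} \<union> yq ` {..<k})"
begin

lemma zero_pow: "\<zero> [^] q = \<zero>"
  using q_pos by (cases q) simp_all

lemma \<Phi>_closed: "f \<in> carrier (F i) \<Longrightarrow> \<Phi> f \<in> carrier (F i)"
  by (simp add: \<Phi>_def free_mod_simps zero_pow)

lemma \<Phi>_add: "f \<in> carrier (F i) \<Longrightarrow> g \<in> carrier (F i) \<Longrightarrow>
    \<Phi> (f \<oplus>\<^bsub>F i\<^esub> g) = \<Phi> f \<oplus>\<^bsub>F i\<^esub> \<Phi> g"
  by (simp add: \<Phi>_def free_mod_simps q_add)

lemma \<Phi>_smult: "r \<in> carrier R \<Longrightarrow> f \<in> carrier (F i) \<Longrightarrow>
    \<Phi> (r \<odot>\<^bsub>F i\<^esub> f) = (r [^] q) \<odot>\<^bsub>F i\<^esub> \<Phi> f"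
  by (simp add: \<Phi>_def free_mod_simps nat_pow_distrib)

lemma \<Phi>_zero: "\<Phi> \<zero>\<^bsub>F i\<^esub> = \<zero>\<^bsub>F i\<^esub>"
  by (simp add: \<Phi>_def free_mod_simps zero_pow)

lemma Dq_hom: "Dq i \<in> mod_hom R (F (Suc i)) (F i)"
  unfolding Dq_def by (intro lincomb_hom module_F \<Phi>_closed columns)

lemma \<Phi>_D: "f \<in> carrier (F (Suc i)) \<Longrightarrow> \<Phi> (D i f) = Dq i (\<Phi> f)"
proof -
  assume f: "f \<in> carrier (F (Suc i))"
  interpret F: module R "F i" by (rule module_F)
  have fc: "f j \<in> carrier R" for j using f by (simp add: free_mod_simps)
  have "\<Phi> (lincomb (F i) (a i) f k) = lincomb (F i) (\<lambda>j. \<Phi> (a i j)) (\<Phi> f) k" if "k \<le> b (Suc i)" for k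
    using that
  proof (induction k)
    case 0 thus ?case by (simp add: \<Phi>_zero)
  next
    case (Suc k)
    have "lincomb (F i) (a i) f k \<in> carrier (F i)" "a i k \<in> carrier (F i)"
      using Suc.prems by (auto intro!: F.lincomb_closed columns fc)
    hence "\<Phi> (lincomb (F i) (a i) f (Suc k)) =
        \<Phi> (lincomb (F i) (a i) f k) \<oplus>\<^bsub>F i\<^esub> (f k [^] q) \<odot>\<^bsub>F i\<^esub> \<Phi> (a i k)"
      using fc by (simp add: \<Phi>_add \<Phi>_smult)
    also have "f k [^] q = \<Phi> f k" by (simp add: \<Phi>_def)
    finally show ?case using Suc by simp
  qed
  thus ?thesis unfolding D_def Dq_def by blast
qed

lemma Dq_Dq: "f \<in> carrier (F (Suc (Suc i))) \<Longrightarrow> Dq i (Dq (Suc i) f) = \<zero>\<^bsub>F i\<^esub>"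
proof -
  assume f: "f \<in> carrier (F (Suc (Suc i)))"
  interpret F: module R "F i" by (rule module_F)
  have fc: "f j \<in> carrier R" for j using f by (simp add: free_mod_simps)
  have z: "Dq i (\<Phi> (a (Suc i) j)) = \<zero>\<^bsub>F i\<^esub>" if j: "j < b (Suc (Suc i))" for j
  proof -
    have "D (Suc i) (unit_vec R j) = a (Suc i) j" using D_unit_vec j by blast
    hence "a (Suc i) j \<in> N (Suc i)" unfolding N_eq using unit_vec_closed[OF j] by force
    hence "D i (a (Suc i) j) = \<zero>\<^bsub>F i\<^esub>" unfolding exact by blast
    thus ?thesis using \<Phi>_D[OF columns[OF j]] \<Phi>_zero by simp
  qed
  have "Dq i (Dq (Suc i) f) = lincomb (F i) (\<lambda>j. Dq i (\<Phi> (a (Suc i) j))) f (b (Suc (Suc i)))"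
  proof -
    have "Dq (Suc i) f = lincomb (F (Suc i)) (\<lambda>j. \<Phi> (a (Suc i) j)) f (b (Suc (Suc i)))"
      by (simp only: Dq_def)
    thus ?thesis
      using mod_hom_lincomb[OF module_F module_F Dq_hom, where a = "\<lambda>j. \<Phi> (a (Suc i) j)" and f = f
          and c = "b (Suc (Suc i))"] \<Phi>_closed[OF columns] fc by simp
  qed
  also have "\<dots> = lincomb (F i) (\<lambda>j. \<zero>\<^bsub>F i\<^esub>) f (b (Suc (Suc i)))"
    by (rule F.lincomb_cong[OF z])
  also have "\<dots> \<in> {\<zero>\<^bsub>F i\<^esub>}" by (rule F.lincomb_submodule[OF F.zero_submodule _ fc]) simp
  finally show ?thesis by simp
qed

definition Fq_span :: "nat \<Rightarrow> nat \<Rightarrow> (nat \<Rightarrow> 'a) set" where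
  "Fq_span i k = seq_span (F i) yq {\<zero>\<^bsub>F i\<^esub>} (carrier (F i)) k"

definition Nq :: "nat \<Rightarrow> (nat \<Rightarrow> 'a) set" where
  "Nq i = Dq i ` carrier (F (Suc i))"

lemma Nq_submodule: "submodule (Nq i) R (F i)"
  unfolding Nq_def using image_submodule[OF module_F module_F Dq_hom] module.carrier_is_submodule[OF module_F]
  by blast

lemma yq_carrier: "k \<le> d \<Longrightarrow> \<forall>j<k. yq j \<in> carrier R"
  using y_carrier by (simp add: yq_def)

lemma yq_closed: "k < d \<Longrightarrow> yq k \<in> carrier R"
  using y_closed by (simp add: yq_def)

lemma Fq_span_submodule: "k \<le> d \<Longrightarrow> submodule (Fq_span i k) R (F i)"
  unfolding Fq_span_def using yq_carrier
  by (intro module.seq_span_submodule module_F module.zero_submodule module.carrier_is_submodule)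

lemma Fq_span_regular:
  assumes "k < d" "f \<in> carrier (F i)" "yq k \<odot>\<^bsub>F i\<^esub> f \<in> Fq_span i k"
  shows "f \<in> Fq_span i k"
  unfolding Fq_span_def
proof (rule free_mod_regular[OF yq_carrier[OF order_refl] assms(1)])
  show "v \<in> Idl ({\<zero>} \<union> yq ` {..<k})"
    if "v \<in> carrier R" "yq k \<otimes> v \<in> Idl ({\<zero>} \<union> yq ` {..<k})" for v
    using assms(1) that by (rule yq_regular)
qed (use assms(2,3) in \<open>simp_all only: Fq_span_def\<close>)

lemma \<Phi>_F_span: "s \<in> F_span i k \<Longrightarrow> k \<le> d \<Longrightarrow> \<Phi> s \<in> Fq_span i k"
proof (induction k arbitrary: s)
  case 0 thus ?case by (simp add: F_span_def Fq_span_def \<Phi>_zero)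
next
  case (Suc k)
  obtain u n where un: "u \<in> F_span i k" "n \<in> carrier (F i)" "s = u \<oplus>\<^bsub>F i\<^esub> y k \<odot>\<^bsub>F i\<^esub> n"
    using Suc.prems(1) unfolding F_span_def by auto
  interpret F: module R "F i" by (rule module_F)
  have uc: "u \<in> carrier (F i)" using un(1) F.submoduleE(1)[OF F_span_submodule, of k] Suc.prems(2) by auto
  have "\<Phi> s = \<Phi> u \<oplus>\<^bsub>F i\<^esub> yq k \<odot>\<^bsub>F i\<^esub> \<Phi> n"
    unfolding un(3) yq_def using uc un(2) y_closed[of k] Suc.prems by (simp add: \<Phi>_add \<Phi>_smult)
  moreover have "\<Phi> u \<in> Fq_span i k" using Suc un(1) by simp
  ultimately show ?case unfolding Fq_span_def seq_span.simps using \<Phi>_closed[OF un(2)] by blast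
qed

text \<open>Descend from \<open>F n\<close> to \<open>F 0 = R\<close>. If \<open>D w = s + y\<^bsub>t+i\<^esub> f\<close>, with \<open>s\<close> a multiple of the first \<open>t + i\<close>
  elements, then \<open>f\<close> is the next vector. Three properties are preserved. The vector is mapped by the
  differential to a multiple of the elements not yet used, because \<open>D D = 0\<close> and \<open>y\<^bsub>t+i\<^esub>\<close> is regular. It is
  nonzero modulo \<open>N i\<close> and those elements, because the syzygy modules embed modulo the sequence
  (\<open>N_Int_F_span\<close>). Its Frobenius power is zero modulo \<open>Nq i\<close> and the \<open>q\<close>-th powers of those elements: applying \<open>\<Phi>\<close>
  to the equation gives its analogue for \<open>Dq\<close> and \<open>yq\<close>, where \<open>Dq Dq = 0\<close> and \<open>yq\<close> is regular.\<close>

lemma zigzag: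
  assumes dim: "t + n = d" and "i \<le> n"
    and start: "\<exists>w\<in>carrier (F n). (\<forall>l. n = Suc l \<longrightarrow> D l w \<in> F_span l (t + n)) \<and>
      \<Phi> w \<in> seq_span (F n) yq (Nq n) (carrier (F n)) (t + n) \<and> w \<notin> NF_span n (t + n)"
  shows "\<exists>w\<in>carrier (F i). (\<forall>l. i = Suc l \<longrightarrow> D l w \<in> F_span l (t + i)) \<and>
      \<Phi> w \<in> seq_span (F i) yq (Nq i) (carrier (F i)) (t + i) \<and> w \<notin> NF_span i (t + i)"
  using assms(2)
proof (induction i rule: inc_induct)
  case base thus ?case by (rule start)
next
  case (step i)
  let ?k = "t + i"
  have k: "?k < d" "?k \<le> d" "Suc ?k \<le> d" "?k \<le> min (t + i) d" using dim step.hyps by auto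
  interpret F: module R "F i" by (rule module_F)
  interpret FS: module R "F (Suc i)" by (rule module_F)
  note yk = y_closed[OF k(1)] and yqk = yq_closed[OF k(1)]
  note S = F_span_submodule[OF k(2), of i]
  note SE = F.submoduleE[OF S]
  have Sc: "s \<in> carrier (F i)" if "s \<in> F_span i ?k" for s using that SE(1) by blast
  from step.IH obtain w where w: "w \<in> carrier (F (Suc i))" "D i w \<in> F_span i (t + Suc i)"
    "\<Phi> w \<in> seq_span (F (Suc i)) yq (Nq (Suc i)) (carrier (F (Suc i))) (t + Suc i)"
    "w \<notin> NF_span (Suc i) (t + Suc i)" by blast
  obtain s f where sf: "s \<in> F_span i ?k" "f \<in> carrier (F i)" "D i w = s \<oplus>\<^bsub>F i\<^esub> y ?k \<odot>\<^bsub>F i\<^esub> f"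
    using w(2) unfolding F_span_def by auto
  have sc: "s \<in> carrier (F i)" by (rule Sc[OF sf(1)])
  have yf: "y ?k \<odot>\<^bsub>F i\<^esub> f \<in> carrier (F i)" using yk sf(2) by simp
  have P1: "D l f \<in> F_span l ?k" if l: "i = Suc l" for l
  proof (rule F_span_regular[OF k(1)])
    interpret Fl: module R "F l" by (rule module_F)
    have fl: "f \<in> carrier (F (Suc l))" and sl: "s \<in> carrier (F (Suc l))" using sf(2) sc l by auto
    note hom = D_hom[of l]
    show fc: "D l f \<in> carrier (F l)" by (rule mod_hom_closed[OF hom fl])
    have "D i w \<in> N (Suc l)" using w(1) unfolding l N_eq by blast
    hence "D l (D i w) = \<zero>\<^bsub>F l\<^esub>" unfolding exact by blast
    hence "D l (s \<oplus>\<^bsub>F (Suc l)\<^esub> y ?k \<odot>\<^bsub>F (Suc l)\<^esub> f) = \<zero>\<^bsub>F l\<^esub>"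
      unfolding sf(3)[unfolded l] l .
    moreover have "y ?k \<odot>\<^bsub>F (Suc l)\<^esub> f \<in> carrier (F (Suc l))" using yf unfolding l .
    ultimately have z: "D l s \<oplus>\<^bsub>F l\<^esub> y ?k \<odot>\<^bsub>F l\<^esub> D l f = \<zero>\<^bsub>F l\<^esub>"
      using mod_hom_add[OF hom sl] mod_hom_smult[OF hom yk fl] by simp
    have "D l s \<in> F_span l ?k"
    proof -
      have "s \<in> NF_span (Suc l) ?k" using sf(1) F_span_subset l by blast
      hence "D l s \<in> N_span l ?k" using D_in_N_span_iff[OF k(2) sl] by blast
      thus ?thesis using N_span_subset by blast
    qed
    hence "\<ominus>\<^bsub>F l\<^esub> D l s \<in> F_span l ?k" by (rule Fl.submoduleE(3)[OF F_span_submodule[OF k(2)]])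
    moreover have "y ?k \<odot>\<^bsub>F l\<^esub> D l f = \<ominus>\<^bsub>F l\<^esub> D l s"
      using z mod_hom_closed[OF hom sl] fc yk by (intro Fl.M.minus_equality[symmetric]) (simp_all add: Fl.M.a_comm)
    ultimately show "y ?k \<odot>\<^bsub>F l\<^esub> D l f \<in> F_span l ?k" by simp
  qed
  have P2: "\<Phi> f \<in> seq_span (F i) yq (Nq i) (carrier (F i)) ?k"
  proof -
    note Sq = Fq_span_submodule[OF k(2), of i]
    \<comment> \<open>The part of \<open>\<Phi> w\<close> in \<open>Nq (Suc i)\<close> is killed by \<open>Dq i\<close>.\<close>
    have "Dq i ` seq_span (F (Suc i)) yq (Nq (Suc i)) (carrier (F (Suc i))) (t + Suc i)
        = seq_span (F i) yq (Dq i ` Nq (Suc i)) (Dq i ` carrier (F (Suc i))) (t + Suc i)"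
      using k(3) by (intro seq_span_image[OF module_F module_F Dq_hom Nq_submodule FS.carrier_is_submodule] yq_carrier) simp
    also have "Dq i ` Nq (Suc i) = {\<zero>\<^bsub>F i\<^esub>}"
      using Dq_Dq F.zero_closed FS.submodule_zero[OF Nq_submodule] unfolding Nq_def by force
    finally have "Dq i (\<Phi> w) \<in> seq_span (F i) yq {\<zero>\<^bsub>F i\<^esub>} (Nq i) (Suc ?k)"
      using w(3) unfolding Nq_def[of i] by auto
    then obtain u g where ug: "u \<in> seq_span (F i) yq {\<zero>\<^bsub>F i\<^esub>} (Nq i) ?k" "g \<in> Nq i"
      "Dq i (\<Phi> w) = u \<oplus>\<^bsub>F i\<^esub> yq ?k \<odot>\<^bsub>F i\<^esub> g" by auto
    have gc: "g \<in> carrier (F i)" using ug(2) F.submoduleE(1)[OF Nq_submodule] by blast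
    have u: "u \<in> Fq_span i ?k"
      using ug(1) seq_span_mono[of "{\<zero>\<^bsub>F i\<^esub>}" "{\<zero>\<^bsub>F i\<^esub>}" "Nq i" "carrier (F i)"] F.submoduleE(1)[OF Nq_submodule]
      unfolding Fq_span_def by blast
    have uc: "u \<in> carrier (F i)" using u F.submoduleE(1)[OF Sq] by blast
    have ps: "\<Phi> s \<in> Fq_span i ?k" by (rule \<Phi>_F_span[OF sf(1) k(2)])
    note pc = \<Phi>_closed[OF sf(2)] \<Phi>_closed[OF sc]
    have e: "u \<oplus>\<^bsub>F i\<^esub> yq ?k \<odot>\<^bsub>F i\<^esub> g = \<Phi> s \<oplus>\<^bsub>F i\<^esub> yq ?k \<odot>\<^bsub>F i\<^esub> \<Phi> f"
      unfolding ug(3)[symmetric] \<Phi>_D[OF w(1), symmetric] sf(3)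
      using sc yf yk sf(2) by (simp add: \<Phi>_add \<Phi>_smult yq_def)
    have "yq ?k \<odot>\<^bsub>F i\<^esub> (\<Phi> f \<ominus>\<^bsub>F i\<^esub> g) = u \<ominus>\<^bsub>F i\<^esub> \<Phi> s"
    proof -
      have "u \<ominus>\<^bsub>F i\<^esub> \<Phi> s = ((u \<oplus>\<^bsub>F i\<^esub> yq ?k \<odot>\<^bsub>F i\<^esub> g) \<ominus>\<^bsub>F i\<^esub> \<Phi> s) \<ominus>\<^bsub>F i\<^esub> yq ?k \<odot>\<^bsub>F i\<^esub> g"
        using uc pc gc yqk F.add_minus_cancel(1)[of "u \<ominus>\<^bsub>F i\<^esub> \<Phi> s" "yq ?k \<odot>\<^bsub>F i\<^esub> g"]
        by (simp add: a_minus_def F.M.a_ac)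
      also have "\<dots> = yq ?k \<odot>\<^bsub>F i\<^esub> \<Phi> f \<ominus>\<^bsub>F i\<^esub> yq ?k \<odot>\<^bsub>F i\<^esub> g"
        unfolding e using pc yqk by (simp add: F.add_minus_cancel)
      also have "\<dots> = yq ?k \<odot>\<^bsub>F i\<^esub> (\<Phi> f \<ominus>\<^bsub>F i\<^esub> g)"
        using pc gc yqk by (simp add: a_minus_def F.smult_r_distr F.smult_r_minus)
      finally show ?thesis by simp
    qed
    also have "\<dots> \<in> Fq_span i ?k" by (rule F.submodule_minus[OF Sq u ps])
    finally have "\<Phi> f \<ominus>\<^bsub>F i\<^esub> g \<in> Fq_span i ?k"
      by (rule Fq_span_regular[OF k(1), rotated]) (use pc gc in simp)
    moreover have "\<Phi> f = g \<oplus>\<^bsub>F i\<^esub> (\<Phi> f \<ominus>\<^bsub>F i\<^esub> g)"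
      using F.add_minus_cancel(3)[OF pc(1) gc] pc gc by (simp add: F.M.a_comm)
    ultimately show ?thesis
      unfolding F.seq_span_split[OF Nq_submodule F.carrier_is_submodule yq_carrier[OF k(2)]] Fq_span_def
      using ug(2) by blast
  qed
  have P3: "f \<notin> NF_span i ?k"
  proof
    assume "f \<in> NF_span i ?k"
    then obtain g r where gr: "g \<in> carrier (F (Suc i))" "r \<in> F_span i ?k" "f = D i g \<oplus>\<^bsub>F i\<^esub> r"
      unfolding NF_span_split[OF k(2)] N_eq by blast
    have gc: "D i g \<in> carrier (F i)" by (rule mod_hom_closed[OF D_hom gr(1)])
    \<comment> \<open>Correcting \<open>w\<close> by \<open>y ?k g\<close> removes the last element of the sequence from its image.\<close>
    let ?w = "w \<ominus>\<^bsub>F (Suc i)\<^esub> y ?k \<odot>\<^bsub>F (Suc i)\<^esub> g"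
    have wc: "?w \<in> carrier (F (Suc i))" using w(1) gr(1) yk by simp
    have "D i ?w = D i w \<ominus>\<^bsub>F i\<^esub> y ?k \<odot>\<^bsub>F i\<^esub> D i g"
      using mod_hom_minus[OF module_F module_F D_hom w(1)] mod_hom_smult[OF D_hom yk gr(1)] gr(1) yk by simp
    also have "\<dots> = (s \<oplus>\<^bsub>F i\<^esub> y ?k \<odot>\<^bsub>F i\<^esub> r \<oplus>\<^bsub>F i\<^esub> y ?k \<odot>\<^bsub>F i\<^esub> D i g) \<ominus>\<^bsub>F i\<^esub> y ?k \<odot>\<^bsub>F i\<^esub> D i g"
      unfolding sf(3) gr(3) using sc Sc[OF gr(2)] gc yk by (simp add: F.smult_r_distr F.M.a_ac)
    also have "\<dots> = s \<oplus>\<^bsub>F i\<^esub> y ?k \<odot>\<^bsub>F i\<^esub> r"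
      using sc Sc[OF gr(2)] gc yk by (intro F.add_minus_cancel) simp_all
    also have "\<dots> \<in> F_span i ?k" using SE(4)[OF yk gr(2)] by (rule SE(5)[OF sf(1)])
    finally have "D i ?w \<in> N_span i ?k" using N_Int_F_span[OF k(4)] wc unfolding N_eq by blast
    hence "?w \<in> NF_span (Suc i) ?k" using D_in_N_span_iff[OF k(2) wc] by blast
    hence "?w \<in> NF_span (Suc i) (t + Suc i)" using NF_span_mono[of ?k "t + Suc i"] k(3) by auto
    moreover have "y ?k \<odot>\<^bsub>F (Suc i)\<^esub> g \<in> NF_span (Suc i) (t + Suc i)"
      using k gr(1) by (intro NF_span_smult) auto
    ultimately have "w \<in> NF_span (Suc i) (t + Suc i)"
      using FS.submodule_add_iff(2)[OF NF_span_submodule] k(3) w(1) by simp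
    thus False using w(4) by simp
  qed
  show ?case using sf(2) P1 P2 P3 by blast
qed

text \<open>The zigzag starts with \<open>v e\<close>, where \<open>e\<close> is a basis vector of the last nonzero module \<open>F n\<close>. By
  \<open>t + n = d\<close> it ends with a vector in \<open>F 0 = R\<close> modulo exactly the first \<open>t\<close> elements. There the image
  of \<open>Dq 0\<close> is generated by \<open>q\<close>-th powers of elements of \<open>I\<close>, hence contained in \<open>I\<close>.\<close>

lemma frobenius_witness:
  assumes n: "N n = {\<zero>\<^bsub>F n\<^esub>}" and b: "0 < b n"
    and v: "v \<in> carrier R" "v \<notin> Idl ({\<zero>} \<union> y ` {..<d})"
      "\<And>u. u \<in> \<mm> \<Longrightarrow> u \<otimes> v \<in> Idl ({\<zero>} \<union> y ` {..<d})"
      "v [^] q \<in> Idl ({\<zero>} \<union> yq ` {..<d})"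
  shows "\<exists>u\<in>carrier R. u [^] q \<in> Idl (I \<union> yq ` {..<t}) \<and> u \<notin> Idl (I \<union> y ` {..<t})"
proof -
  have dim: "t + n = d" using auslander_buchsbaum_ge[OF n] auslander_buchsbaum_le[OF n b] by simp
  interpret Fn: module R "F n" by (rule module_F)
  let ?w = "v \<odot>\<^bsub>F n\<^esub> unit_vec R 0"
  have w: "?w \<in> carrier (F n)" using unit_vec_closed[OF b] v(1) by simp
  have wi: "?w i = (if i = 0 then v else \<zero>)" for i using v(1) by (simp add: free_mod_simps unit_vec_def)
  have P1: "\<forall>l. n = Suc l \<longrightarrow> D l ?w \<in> F_span l (t + n)"
    using column_times_socle[OF v(1,3)] b dim by auto
  have sub: "yq ` {..<d} \<subseteq> carrier R" using yq_carrier[OF order_refl] by auto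
  have z: "\<zero> \<in> Idl ({\<zero>} \<union> yq ` {..<d})" using Idl_ideal_Un(2)[OF zeroideal sub] by auto
  have "\<Phi> ?w i \<in> Idl ({\<zero>} \<union> yq ` {..<d})" for i
    unfolding \<Phi>_def wi using z v(4) by (simp add: zero_pow)
  hence "\<Phi> ?w \<in> seq_span (F n) yq {\<zero>\<^bsub>F n\<^esub>} (carrier (F n)) d"
    unfolding free_mod_zero_span_iff[OF yq_carrier[OF order_refl]] using \<Phi>_closed[OF w] by blast
  hence P2: "\<Phi> ?w \<in> seq_span (F n) yq (Nq n) (carrier (F n)) (t + n)"
    using seq_span_mono[of "{\<zero>\<^bsub>F n\<^esub>}" "Nq n" "carrier (F n)" "carrier (F n)" "F n" yq d]
      Fn.submodule_zero[OF Nq_submodule] unfolding dim by blast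
  have P3: "?w \<notin> NF_span n (t + n)"
  proof
    assume "?w \<in> NF_span n (t + n)"
    hence "?w \<in> F_span n d" using n unfolding NF_span_def F_span_def dim by simp
    hence "?w 0 \<in> Idl ({\<zero>} \<union> y ` {..<d})" unfolding F_span_iff[OF order_refl] by blast
    thus False using v(2) wi by simp
  qed
  have "\<exists>w\<in>carrier (F 0). (\<forall>l. 0 = Suc l \<longrightarrow> D l w \<in> F_span l (t + 0)) \<and>
      \<Phi> w \<in> seq_span (F 0) yq (Nq 0) (carrier (F 0)) (t + 0) \<and> w \<notin> NF_span 0 (t + 0)"
    using w P1 P2 P3 by (intro zigzag[OF dim le0]) blast
  then obtain f where f: "f \<in> carrier (F 0)" "\<Phi> f \<in> seq_span (F 0) yq (Nq 0) (carrier (F 0)) t"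
    "f \<notin> NF_span 0 t" by auto
  interpret F0: module R "F 0" by (rule module_F)
  have N0: "N 0 = {f \<in> carrier (F 0). \<forall>i. f i \<in> I}" unfolding N_0 by (rule F_0_eq[OF ideal_I])
  have "Nq 0 \<subseteq> N 0"
  proof
    fix g assume "g \<in> Nq 0"
    then obtain h where h: "h \<in> carrier (F 1)" "g = Dq 0 h" unfolding Nq_def by auto
    have hc: "h j \<in> carrier R" for j using h(1) by (simp add: free_mod_simps)
    have "\<Phi> (a 0 j) \<in> N 0" if j: "j < b (Suc 0)" for j
    proof -
      have "D 0 (unit_vec R j) = a 0 j" using D_unit_vec j by blast
      hence aN: "a 0 j \<in> N 0" unfolding N_eq using unit_vec_closed[OF j] by force
      have "a 0 j i [^] q \<in> I" for i
      proof -
        have ai: "a 0 j i \<in> I" "a 0 j i \<in> carrier R" using aN ideal.Icarr[OF ideal_I] unfolding N0 by blast+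
        obtain q' where "q = Suc q'" using q_pos by (cases q) auto
        thus ?thesis using ideal.I_l_closed[OF ideal_I ai(1), of "a 0 j i [^] q'"] ai(2) by simp
      qed
      thus ?thesis using \<Phi>_closed[OF columns[OF j]] unfolding N0 \<Phi>_def by blast
    qed
    thus "g \<in> N 0" unfolding h(2) Dq_def by (intro F0.lincomb_submodule[OF N_submodule] hc) auto
  qed
  hence fq: "\<Phi> f \<in> seq_span (F 0) yq (N 0) (carrier (F 0)) t"
    using seq_span_mono[of "Nq 0" "N 0" "carrier (F 0)" "carrier (F 0)" "F 0" yq t] f(2) by blast
  have "f 0 [^] q \<in> Idl (I \<union> yq ` {..<t})"
    using fq unfolding N0 free_mod_seq_span_iff[OF ideal_I yq_carrier[OF t_le]] \<Phi>_def by blast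
  moreover have "f 0 \<notin> Idl (I \<union> y ` {..<t})"
  proof
    assume f0: "f 0 \<in> Idl (I \<union> y ` {..<t})"
    have sub: "y ` {..<t} \<subseteq> carrier R" using y_carrier[OF t_le] by auto
    have "ideal (Idl (I \<union> y ` {..<t})) R" by (rule Idl_ideal_Un(1)[OF ideal_I sub])
    from F_0_eq[OF this] have "\<forall>i. f i \<in> Idl (I \<union> y ` {..<t})" using f(1) f0 by blast
    hence "f \<in> NF_span 0 t"
      unfolding NF_span_def N0 free_mod_seq_span_iff[OF ideal_I y_carrier[OF t_le]] using f(1) by blast
    thus False using f(3) by simp
  qed
  moreover have "f 0 \<in> carrier R" using f(1) by (simp add: free_mod_simps)
  ultimately show ?thesis by blast
qed

end

section \<open>Submodules of free modules are finitely generated\<close>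

definition submodule_gen :: "('a, 'b) ring_scheme \<Rightarrow> ('a, 'm) module \<Rightarrow> 'm set \<Rightarrow> 'm set" where
  "submodule_gen R M S = \<Inter>{N. submodule N R M \<and> S \<subseteq> N}"

context
  fixes R :: "('a, 'b) ring_scheme" (structure) and M :: "('a, 'm) module"
  assumes M: "module R M"
begin

interpretation M: module R M by (rule M)

lemma submodule_gen_submodule:
  assumes "S \<subseteq> carrier M" shows "submodule (submodule_gen R M S) R M"
proof (rule M.submoduleI)
  show "submodule_gen R M S \<subseteq> carrier M"
    unfolding submodule_gen_def using M.carrier_is_submodule assms by blast
  show "\<zero>\<^bsub>M\<^esub> \<in> submodule_gen R M S"
    unfolding submodule_gen_def using M.submodule_zero by blast
  show "\<ominus>\<^bsub>M\<^esub> x \<in> submodule_gen R M S" if "x \<in> submodule_gen R M S" for x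
    using that M.submoduleE(3) unfolding submodule_gen_def by blast
  show "x \<oplus>\<^bsub>M\<^esub> z \<in> submodule_gen R M S" if "x \<in> submodule_gen R M S" "z \<in> submodule_gen R M S" for x z
    using that M.submoduleE(5) unfolding submodule_gen_def by blast
  show "r \<odot>\<^bsub>M\<^esub> x \<in> submodule_gen R M S" if "r \<in> carrier R" "x \<in> submodule_gen R M S" for r x
    using that M.submoduleE(4) unfolding submodule_gen_def by blast
qed

lemma submodule_gen_self: "S \<subseteq> submodule_gen R M S"
  unfolding submodule_gen_def by blast

lemma submodule_gen_minimal: "submodule N R M \<Longrightarrow> S \<subseteq> N \<Longrightarrow> submodule_gen R M S \<subseteq> N"
  unfolding submodule_gen_def by blast

text \<open>In a linear combination with coefficient \<open>1\<close> at \<open>a k\<close>, the other terms lie in \<open>G\<close>.\<close>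

lemma lincomb_minus_mem:
  assumes "submodule G R M" "\<And>j. j < c \<Longrightarrow> a j \<in> carrier M" "k < c"
    and "\<And>j. j < c \<Longrightarrow> j \<noteq> k \<Longrightarrow> a j \<in> G" "f \<in> carrier (free_mod R c)" "f k = \<one>"
  shows "lincomb M a f c \<ominus>\<^bsub>M\<^esub> a k \<in> G"
proof -
  interpret F: module R "free_mod R c" by (rule M.module_free_mod)
  have e: "unit_vec R k \<in> carrier (free_mod R c)" by (rule M.unit_vec_closed[OF assms(3)])
  define g where "g = f \<ominus>\<^bsub>free_mod R c\<^esub> unit_vec R k"
  have gc: "g \<in> carrier (free_mod R c)" unfolding g_def using assms(5) e by simp
  hence gr: "g j \<in> carrier R" for j by (simp add: free_mod_simps)
  have g0: "g k = \<zero>" unfolding g_def M.free_mod_minus[OF assms(5) e]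
    using assms(6) by (simp add: unit_vec_def a_minus_def M.R.r_neg)
  have mem: "lincomb M a g i \<in> G" if "i \<le> c" for i
    using that
  proof (induction i)
    case 0 thus ?case using M.submodule_zero[OF assms(1)] by simp
  next
    case (Suc i)
    have "g i \<odot>\<^bsub>M\<^esub> a i \<in> G"
    proof (cases "i = k")
      case True thus ?thesis using g0 assms(2,3) M.submodule_zero[OF assms(1)] by simp
    next
      case False thus ?thesis using M.submoduleE(4)[OF assms(1) gr] assms(4) Suc.prems by simp
    qed
    thus ?case using Suc M.submoduleE(5)[OF assms(1)] by simp
  qed
  have "lincomb M a g c = lincomb M a f c \<ominus>\<^bsub>M\<^esub> a k"
    using mod_hom_minus[OF M.module_free_mod M lincomb_hom[OF M, of c a] assms(5) e] assms(2)
      M.lincomb_unit_vec[of c a k] assms(3) unfolding g_def by simp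
  thus ?thesis using mem[of c] by simp
qed

end

text \<open>Take a generating set of least cardinality. A relation with a coefficient outside the maximal ideal
  can be scaled to have a coefficient \<open>1\<close>, and would make that generator redundant.\<close>

lemma (in noetherian_local_ring) minimal_generators:
  assumes M: "module R M" and S: "finite S" "S \<subseteq> carrier M" "N = submodule_gen R M S"
  obtains c a where "\<And>j. j < c \<Longrightarrow> a j \<in> carrier M"
    "N = (\<lambda>f. lincomb M a f c) ` carrier (free_mod R c)"
    "\<And>f k. f \<in> carrier (free_mod R c) \<Longrightarrow> lincomb M a f c = \<zero>\<^bsub>M\<^esub> \<Longrightarrow> f k \<in> \<mm>"
proof -
  interpret M: module R M by fact
  let ?Q = "\<lambda>T. finite T \<and> T \<subseteq> carrier M \<and> submodule_gen R M T = N"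
  have "?Q S" using S by simp
  then obtain T where T: "?Q T" and least: "\<And>U. ?Q U \<Longrightarrow> card T \<le> card U"
    using ex_has_least_nat[of ?Q S card] by blast
  define c where "c = card T"
  obtain a where a: "bij_betw a {0..<c} T"
    using ex_bij_betw_nat_finite[of T] T unfolding c_def by blast
  have aT: "a j \<in> T" if "j < c" for j using a that by (auto simp: bij_betw_def)
  have ac: "a j \<in> carrier M" if "j < c" for j using aT[OF that] T by blast
  have Ngen: "N = submodule_gen R M T" and Tc: "T \<subseteq> carrier M" using T by blast+
  have Nsub: "submodule N R M" unfolding Ngen by (rule submodule_gen_submodule[OF M Tc])
  have TN: "T \<subseteq> N" unfolding Ngen by (rule submodule_gen_self[OF M])
  note hom = lincomb_hom[OF M, of c a, OF ac]
  have im: "N = (\<lambda>f. lincomb M a f c) ` carrier (free_mod R c)"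
  proof
    show "N \<subseteq> (\<lambda>f. lincomb M a f c) ` carrier (free_mod R c)"
      unfolding Ngen
    proof (rule submodule_gen_minimal[OF M])
      show "submodule ((\<lambda>f. lincomb M a f c) ` carrier (free_mod R c)) R M"
        by (rule image_submodule[OF module_free_mod M hom module.carrier_is_submodule[OF module_free_mod]])
      show "T \<subseteq> (\<lambda>f. lincomb M a f c) ` carrier (free_mod R c)"
      proof
        fix x assume "x \<in> T"
        hence "x \<in> a ` {0..<c}" using a by (simp add: bij_betw_def)
        then obtain j where j: "j < c" "x = a j" by auto
        have "lincomb M a (unit_vec R j) c = a j" using ac j(1) by (rule M.lincomb_unit_vec)
        thus "x \<in> (\<lambda>f. lincomb M a f c) ` carrier (free_mod R c)"
          unfolding j(2) by (rule image_eqI[OF sym unit_vec_closed[OF j(1)]])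
      qed
    qed
    show "(\<lambda>f. lincomb M a f c) ` carrier (free_mod R c) \<subseteq> N"
    proof
      fix x assume "x \<in> (\<lambda>f. lincomb M a f c) ` carrier (free_mod R c)"
      then obtain f where f: "f \<in> carrier (free_mod R c)" "x = lincomb M a f c" by blast
      have "f j \<in> carrier R" for j using f(1) by (simp add: free_mod_simps)
      thus "x \<in> N" unfolding f(2) using aT TN by (intro M.lincomb_submodule[OF Nsub]) blast+
    qed
  qed
  have min: "f k \<in> \<mm>" if f: "f \<in> carrier (free_mod R c)" "lincomb M a f c = \<zero>\<^bsub>M\<^esub>" for f k
  proof (rule ccontr)
    assume neg: "f k \<notin> \<mm>"
    have fr: "f j \<in> carrier R" for j using f(1) by (simp add: free_mod_simps)
    have kc: "k < c"
    proof (rule ccontr)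
      assume "\<not> k < c"
      hence "f k = \<zero>" using f(1) by (simp add: free_mod_simps)
      thus False using neg by simp
    qed
    obtain r where r: "r \<in> carrier R" "r \<otimes> f k = \<one>" using unit_if_not_in_max[OF fr neg] by blast
    interpret F: module R "free_mod R c" by (rule module_free_mod)
    let ?U = "T - {a k}" and ?g = "r \<odot>\<^bsub>free_mod R c\<^esub> f"
    let ?G = "submodule_gen R M ?U"
    have Uc: "?U \<subseteq> carrier M" using Tc by blast
    have G: "submodule ?G R M" by (rule submodule_gen_submodule[OF M Uc])
    have gc: "?g \<in> carrier (free_mod R c)" using r(1) f(1) by simp
    have aG: "a j \<in> ?G" if "j < c" "j \<noteq> k" for j
    proof -
      have "a j \<noteq> a k" using inj_on_eq_iff[OF bij_betw_imp_inj_on[OF a], of j k] that kc by simp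
      hence "a j \<in> ?U" using aT[OF that(1)] by simp
      thus ?thesis by (rule subsetD[OF submodule_gen_self[OF M]])
    qed
    have "lincomb M a ?g c \<ominus>\<^bsub>M\<^esub> a k \<in> ?G"
    proof (rule lincomb_minus_mem[OF M G])
      show "?g k = \<one>" using r(2) by (simp add: free_mod_simps)
    qed (fact ac kc aG gc)+
    moreover have "lincomb M a ?g c = \<zero>\<^bsub>M\<^esub>"
      using mod_hom_smult[OF hom r(1) f(1)] f(2) r(1) by simp
    ultimately have "\<ominus>\<^bsub>M\<^esub> a k \<in> ?G" using ac[OF kc] by (simp add: a_minus_def)
    hence "\<ominus>\<^bsub>M\<^esub> (\<ominus>\<^bsub>M\<^esub> a k) \<in> ?G" by (rule M.submoduleE(3)[OF G])
    hence "a k \<in> ?G" using ac[OF kc] by simp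
    moreover have "?U \<subseteq> ?G" by (rule submodule_gen_self[OF M])
    ultimately have "N \<subseteq> ?G" unfolding Ngen by (intro submodule_gen_minimal[OF M G]) auto
    moreover have "?G \<subseteq> N" using TN by (intro submodule_gen_minimal[OF M Nsub]) auto
    ultimately have "card T \<le> card ?U" using T Uc by (intro least) auto
    moreover have "card ?U < card T" using T aT[OF kc] by (intro psubset_card_mono) auto
    ultimately show False by simp
  qed
  show ?thesis
  proof (rule that)
    show "\<And>j. j < c \<Longrightarrow> a j \<in> carrier M" by (rule ac)
    show "N = (\<lambda>f. lincomb M a f c) ` carrier (free_mod R c)" by (rule im)
    show "\<And>f k. f \<in> carrier (free_mod R c) \<Longrightarrow> lincomb M a f c = \<zero>\<^bsub>M\<^esub> \<Longrightarrow> f k \<in> \<mm>" by (rule min)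
  qed
qed

lemma (in cring) free_mod_ops:
  "\<zero>\<^bsub>free_mod R b\<^esub> = \<zero>\<^bsub>free_mod R c\<^esub>" "f \<oplus>\<^bsub>free_mod R b\<^esub> g = f \<oplus>\<^bsub>free_mod R c\<^esub> g"
  "r \<odot>\<^bsub>free_mod R b\<^esub> f = r \<odot>\<^bsub>free_mod R c\<^esub> f"
  by (simp_all add: free_mod_def)

lemma (in cring) free_mod_submodule_restrict:
  assumes N: "submodule N R (free_mod R c)" and bc: "b \<le> c"
  shows "submodule (N \<inter> carrier (free_mod R b)) R (free_mod R b)"
proof -
  interpret B: module R "free_mod R b" by (rule module_free_mod)
  interpret C: module R "free_mod R c" by (rule module_free_mod)
  note E = C.submoduleE[OF N]
  show ?thesis
  proof (rule B.submoduleI)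
    show "\<zero>\<^bsub>free_mod R b\<^esub> \<in> N \<inter> carrier (free_mod R b)"
      using C.submodule_zero[OF N] B.zero_closed free_mod_ops(1)[of b c] by simp
    show "\<ominus>\<^bsub>free_mod R b\<^esub> f \<in> N \<inter> carrier (free_mod R b)" if "f \<in> N \<inter> carrier (free_mod R b)" for f
    proof -
      have f: "f \<in> N" "f \<in> carrier (free_mod R b)" using that by auto
      have "\<ominus>\<^bsub>free_mod R b\<^esub> f = (\<ominus> \<one>) \<odot>\<^bsub>free_mod R c\<^esub> f"
        using B.minus_eq_smult[OF f(2)] free_mod_ops(3)[of b "\<ominus> \<one>" f c] by simp
      hence "\<ominus>\<^bsub>free_mod R b\<^esub> f \<in> N" using E(4)[OF _ f(1), of "\<ominus> \<one>"] by simp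
      thus ?thesis using f(2) by simp
    qed
    show "f \<oplus>\<^bsub>free_mod R b\<^esub> g \<in> N \<inter> carrier (free_mod R b)"
      if "f \<in> N \<inter> carrier (free_mod R b)" "g \<in> N \<inter> carrier (free_mod R b)" for f g
      using that E(5)[of f g] free_mod_ops(2)[of b f g c] B.add.m_closed[of f g] by auto
    show "r \<odot>\<^bsub>free_mod R b\<^esub> f \<in> N \<inter> carrier (free_mod R b)"
      if "r \<in> carrier R" "f \<in> N \<inter> carrier (free_mod R b)" for r f
      using that E(4)[of r f] free_mod_ops(3)[of b r f c] B.smult_closed[of r f] by auto
  qed blast
qed

text \<open>Induction on the rank. The last components of the vectors in \<open>N\<close> form an ideal; lift finitely many
  generators of it to \<open>N\<close> and add generators of the submodule of vectors whose last component is zero.\<close>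

lemma (in noetherian_ring) free_mod_submodule_fg:
  assumes "cring R" "submodule N R (free_mod R b)"
  shows "\<exists>S. finite S \<and> S \<subseteq> carrier (free_mod R b) \<and> N = submodule_gen R (free_mod R b) S"
  using assms(2)
proof (induction b arbitrary: N)
  case 0
  interpret cring R by fact
  interpret F: module R "free_mod R 0" by (rule module_free_mod)
  have c: "carrier (free_mod R 0) = {\<zero>\<^bsub>free_mod R 0\<^esub>}" by (auto simp: free_mod_simps)
  have sub: "H = {\<zero>\<^bsub>free_mod R 0\<^esub>}" if "submodule H R (free_mod R 0)" for H
    using F.submoduleE(1)[OF that] F.submodule_zero[OF that] c by blast
  have "submodule (submodule_gen R (free_mod R 0) {}) R (free_mod R 0)"
    by (rule submodule_gen_submodule[OF F.module_axioms]) simp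
  hence "N = submodule_gen R (free_mod R 0) {}" using sub 0 by metis
  thus ?case by (intro exI[of _ "{}"]) simp
next
  case (Suc b)
  interpret cring R by fact
  interpret F: module R "free_mod R (Suc b)" by (rule module_free_mod)
  interpret Fb: module R "free_mod R b" by (rule module_free_mod)
  note E = F.submoduleE[OF Suc.prems]
  have Nr: "f i \<in> carrier R" if "f \<in> N" for f i using that E(1) by (auto simp: free_mod_simps)
  let ?last = "\<lambda>f::nat \<Rightarrow> 'a. f b"
  have last_ideal: "ideal (?last ` H) R" if H: "submodule H R (free_mod R (Suc b))" for H
  proof -
    note EH = F.submoduleE[OF H]
    have Hr: "f i \<in> carrier R" if "f \<in> H" for f i using that EH(1) by (auto simp: free_mod_simps)
    have sm: "r \<otimes> x \<in> ?last ` H" if r: "r \<in> carrier R" "x \<in> ?last ` H" for r x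
    proof -
      obtain f where f: "f \<in> H" "x = f b" using r by blast
      have "r \<otimes> x = (r \<odot>\<^bsub>free_mod R (Suc b)\<^esub> f) b" using f by (simp add: free_mod_simps)
      thus ?thesis using EH(4)[OF r(1) f(1)] by (rule image_eqI)
    qed
    show ?thesis
    proof (rule idealI[OF ring_axioms])
      show "subgroup (?last ` H) (add_monoid R)"
      proof (rule add.subgroupI)
        show "?last ` H \<subseteq> carrier R" using Hr by blast
        show "?last ` H \<noteq> {}" using F.submodule_zero[OF H] by blast
      next
        fix x assume x: "x \<in> ?last ` H"
        hence "(\<ominus> \<one>) \<otimes> x = \<ominus> x" using Hr by (auto simp: l_minus)
        thus "\<ominus> x \<in> ?last ` H" using sm[OF _ x, of "\<ominus> \<one>"] by simp
      next
        fix x z assume "x \<in> ?last ` H" "z \<in> ?last ` H"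
        then obtain f g where fg: "f \<in> H" "g \<in> H" "x = f b" "z = g b" by blast
        have "x \<oplus> z = (f \<oplus>\<^bsub>free_mod R (Suc b)\<^esub> g) b" using fg by (simp add: free_mod_simps)
        thus "x \<oplus> z \<in> ?last ` H" using EH(5)[OF fg(1,2)] by (rule image_eqI)
      qed
    next
      fix x r assume x: "x \<in> ?last ` H" "r \<in> carrier R"
      show "r \<otimes> x \<in> ?last ` H" by (rule sm[OF x(2,1)])
      thus "x \<otimes> r \<in> ?last ` H" using x Hr by (auto simp: m_comm)
    qed
  qed
  obtain A where A: "A \<subseteq> carrier R" "finite A" "?last ` N = Idl A"
    using finetely_gen[OF last_ideal[OF Suc.prems]] by blast
  have "A \<subseteq> ?last ` N" unfolding A(3) by (rule genideal_self[OF A(1)])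
  then obtain S1 where S1: "S1 \<subseteq> N" "finite S1" "A = ?last ` S1"
    using finite_subset_image[OF A(2)] by blast
  let ?N = "N \<inter> carrier (free_mod R b)"
  have N': "submodule ?N R (free_mod R b)" by (rule free_mod_submodule_restrict[OF Suc.prems]) simp
  obtain S2 where S2: "finite S2" "S2 \<subseteq> carrier (free_mod R b)" "?N = submodule_gen R (free_mod R b) S2"
    using Suc.IH[OF N'] by blast
  have S2N: "S2 \<subseteq> N" using submodule_gen_self[OF module_free_mod, of S2 b] S2(3) by blast
  let ?S = "S1 \<union> S2"
  let ?G = "submodule_gen R (free_mod R (Suc b)) ?S"
  have Sc: "?S \<subseteq> carrier (free_mod R (Suc b))" using S1(1) S2N E(1) by blast
  have G: "submodule ?G R (free_mod R (Suc b))" by (rule submodule_gen_submodule[OF module_free_mod Sc])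
  have SG: "?S \<subseteq> ?G" by (rule submodule_gen_self[OF module_free_mod])
  have GN: "?G \<subseteq> N" using S1(1) S2N by (intro submodule_gen_minimal[OF module_free_mod Suc.prems]) blast
  have N'G: "?N \<subseteq> ?G"
  proof -
    have "submodule (?G \<inter> carrier (free_mod R b)) R (free_mod R b)"
      by (rule free_mod_submodule_restrict[OF G]) simp
    hence "?N \<subseteq> ?G \<inter> carrier (free_mod R b)"
      unfolding S2(3) using SG S2(2) by (intro submodule_gen_minimal[OF module_free_mod]) auto
    thus ?thesis by blast
  qed
  have "N \<subseteq> ?G"
  proof
    fix f assume f: "f \<in> N"
    have "A \<subseteq> ?last ` ?G" unfolding S1(3) using SG by blast
    hence "?last ` N \<subseteq> ?last ` ?G" unfolding A(3) by (rule genideal_minimal[OF last_ideal[OF G]])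
    then obtain g where g: "g \<in> ?G" "f b = g b" using f by blast
    have gN: "g \<in> N" using g(1) GN by blast
    have fg: "f \<in> carrier (free_mod R (Suc b))" "g \<in> carrier (free_mod R (Suc b))"
      using f gN E(1) by blast+
    let ?h = "f \<ominus>\<^bsub>free_mod R (Suc b)\<^esub> g"
    have hN: "?h \<in> N" by (rule F.submodule_minus[OF Suc.prems f gN])
    have "?h b = \<zero>" unfolding free_mod_minus[OF fg] using g(2) Nr[OF gN, of b] by (simp add: a_minus_def r_neg)
    moreover have "?h \<in> carrier (free_mod R (Suc b))" using hN E(1) by blast
    ultimately have "?h \<in> carrier (free_mod R b)"
      unfolding free_mod_simps using le_eq_less_or_eq Suc_le_eq by metis
    hence "?h \<in> ?G" using hN N'G by blast
    thus "f \<in> ?G" using F.submodule_add_iff(2)[OF G fg(1) g(1)] by blast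
  qed
  hence "N = ?G" using GN by blast
  thus ?case using S1(2) S2(1) Sc by (intro exI[of _ ?S]) simp
qed

section \<open>Existence of minimal free resolutions\<close>

text \<open>Iterate the choice of minimal generators, with the module of relations as the next submodule.\<close>

lemma (in noetherian_local_ring) exists_minimal_free_resolution:
  assumes I: "ideal I R" "I \<noteq> carrier R"
  obtains b a where "minimal_free_resolution R \<mm> I b a"
proof -
  let ?F = "free_mod R"
  \<comment> \<open>The columns \<open>a\<close>, \<open>c\<close> in number, minimally generate the submodule \<open>N\<close> of the free module of rank \<open>b\<close>.\<close>
  define good where "good b N c a \<longleftrightarrow> (\<forall>j<c. a j \<in> carrier (?F b)) \<and>
      N = (\<lambda>f. lincomb (?F b) a f c) ` carrier (?F c) \<and>
      (\<forall>f\<in>carrier (?F c). lincomb (?F b) a f c = \<zero>\<^bsub>?F b\<^esub> \<longrightarrow> (\<forall>k. f k \<in> \<mm>))" for b N c a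
  have ex: "\<exists>c a. good b N c a" if H: "submodule N R (?F b)" for b N
  proof -
    obtain S where S: "finite S" "S \<subseteq> carrier (?F b)" "N = submodule_gen R (?F b) S"
      using free_mod_submodule_fg[OF is_cring H] by blast
    obtain c a where "\<And>j. j < c \<Longrightarrow> a j \<in> carrier (?F b)"
      "N = (\<lambda>f. lincomb (?F b) a f c) ` carrier (?F c)"
      "\<And>f k. f \<in> carrier (?F c) \<Longrightarrow> lincomb (?F b) a f c = \<zero>\<^bsub>?F b\<^esub> \<Longrightarrow> f k \<in> \<mm>"
      by (rule minimal_generators[OF module_free_mod S]) blast
    thus ?thesis unfolding good_def by blast
  qed
  let ?N0 = "{f \<in> carrier (?F 1). f 0 \<in> I}"
  let ?ker = "\<lambda>b c a. {f \<in> carrier (?F c). lincomb (?F b) a f c = \<zero>\<^bsub>?F b\<^esub>}"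
  define P where "P i x \<longleftrightarrow> (case x of (b, N, c, a) \<Rightarrow> good b N c a \<and> (i = 0 \<longrightarrow> b = 1 \<and> N = ?N0))"
    for i :: nat and x :: "nat \<times> (nat \<Rightarrow> 'a) set \<times> nat \<times> (nat \<Rightarrow> nat \<Rightarrow> 'a)"
  define Q where "Q x z \<longleftrightarrow> (case x of (b, N, c, a) \<Rightarrow> case z of (b', N', c', a') \<Rightarrow>
      b' = c \<and> N' = ?ker b c a)"
    for x z :: "nat \<times> (nat \<Rightarrow> 'a) set \<times> nat \<times> (nat \<Rightarrow> nat \<Rightarrow> 'a)"
  interpret I: ideal I R by (rule I(1))
  have N0: "submodule ?N0 R (?F 1)"
  proof -
    interpret F: module R "?F 1" by (rule module_free_mod)
    show ?thesis
    proof (rule F.submoduleI)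
      show "\<ominus>\<^bsub>?F 1\<^esub> f \<in> ?N0" if "f \<in> ?N0" for f
      proof -
        have f: "f \<in> carrier (?F 1)" "f 0 \<in> I" using that by auto
        have "\<ominus>\<^bsub>?F 1\<^esub> f \<in> carrier (?F 1)" using f(1) by (rule F.M.a_inv_closed)
        moreover have "(\<ominus>\<^bsub>?F 1\<^esub> f) 0 = (\<ominus> \<one>) \<otimes> f 0"
          using F.minus_eq_smult[OF f(1)] by (simp add: free_mod_simps)
        ultimately show ?thesis using I.I_l_closed[OF f(2), of "\<ominus> \<one>"] by simp
      qed
    qed (auto simp: free_mod_simps I.I_l_closed)
  qed
  have P0: "\<exists>x. P 0 x" using ex[OF N0] unfolding P_def by auto
  have step: "\<exists>z. P (Suc i) z \<and> Q x z" if "P i x" for i x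
  proof -
    obtain b N c a where x: "x = (b, N, c, a)" by (cases x) auto
    have g: "good b N c a" using that unfolding P_def x by simp
    have "submodule (?ker b c a) R (?F c)"
      using g unfolding good_def
      by (intro kernel_submodule[OF module_free_mod module_free_mod] lincomb_hom module_free_mod) blast
    from ex[OF this] obtain c' a' where "good c (?ker b c a) c' a'" by blast
    thus ?thesis unfolding P_def Q_def x by (intro exI[of _ "(c, ?ker b c a, c', a')"]) simp
  qed
  obtain x where x: "\<And>i. P i (x i)" "\<And>i. Q (x i) (x (Suc i))"
    using dependent_nat_choice[of P "\<lambda>_. Q"] P0 step by metis
  define b where "b i = fst (x i)" for i
  define N where "N i = fst (snd (x i))" for i
  define a where "a i = snd (snd (snd (x i)))" for i
  have b_Suc: "b (Suc i) = fst (snd (snd (x i)))" for i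
    using x(2)[of i] unfolding Q_def b_def by (auto split: prod.splits)
  have xi: "x i = (b i, N i, b (Suc i), a i)" for i unfolding b_Suc unfolding b_def N_def a_def by simp
  have g: "good (b i) (N i) (b (Suc i)) (a i)" for i using x(1)[of i] unfolding P_def xi by simp
  have b0: "b 0 = 1" and N0': "N 0 = ?N0" using x(1)[of 0] unfolding P_def xi by simp_all
  have NS: "N (Suc i) = ?ker (b i) (b (Suc i)) (a i)" for i
    using x(2)[of i] unfolding Q_def xi by simp
  have im: "(\<lambda>f. lincomb (?F (b i)) (a i) f (b (Suc i))) ` carrier (?F (b (Suc i))) = N i" for i
    using g[of i] unfolding good_def by blast
  have "minimal_free_resolution R \<mm> I b a"
  proof (unfold_locales, goal_cases)
    case 1 show ?case using I by simp
  next
    case 2 show ?case using b0 by simp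
  next
    case (3 j i) thus ?case using g[of i] unfolding good_def by blast
  next
    case 4 show ?case unfolding im unfolding N0' b0 ..
  next
    case (5 i) show ?case unfolding im NS by simp
  next
    case (6 f i k) thus ?case using g[of i] unfolding im NS good_def by blast
  qed
  thus ?thesis by (rule that)
qed

section \<open>Lifting from projective modules\<close>

text \<open>The free module on \<open>B\<close>, as finitely supported functions. For the carrier of a module \<open>P\<close> it is the test
  module against which \<^const>\<open>projective_module\<close> provides a splitting of the surjection onto \<open>P\<close>.\<close>

definition free_on :: "('a, 'b) ring_scheme \<Rightarrow> 'p set \<Rightarrow> ('a, 'p \<Rightarrow> 'a) module" where
  "free_on R B = \<lparr>carrier = {f. (\<forall>z. f z \<in> carrier R) \<and> finite {z. f z \<noteq> \<zero>\<^bsub>R\<^esub>} \<and>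
       {z. f z \<noteq> \<zero>\<^bsub>R\<^esub>} \<subseteq> B},
     monoid.mult = (\<lambda>f g. f), one = (\<lambda>i. \<zero>\<^bsub>R\<^esub>),
     ring.zero = (\<lambda>i. \<zero>\<^bsub>R\<^esub>), ring.add = (\<lambda>f g i. f i \<oplus>\<^bsub>R\<^esub> g i),
     smult = (\<lambda>r f i. r \<otimes>\<^bsub>R\<^esub> f i)\<rparr>"

lemma free_on_simps:
  "f \<in> carrier (free_on R B) \<longleftrightarrow> (\<forall>z. f z \<in> carrier R) \<and> finite {z. f z \<noteq> \<zero>\<^bsub>R\<^esub>} \<and>
     {z. f z \<noteq> \<zero>\<^bsub>R\<^esub>} \<subseteq> B"
  "\<zero>\<^bsub>free_on R B\<^esub> = (\<lambda>i. \<zero>\<^bsub>R\<^esub>)"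
  "f \<oplus>\<^bsub>free_on R B\<^esub> g = (\<lambda>i. f i \<oplus>\<^bsub>R\<^esub> g i)"
  "r \<odot>\<^bsub>free_on R B\<^esub> f = (\<lambda>i. r \<otimes>\<^bsub>R\<^esub> f i)"
  by (simp_all add: free_on_def)

lemma (in cring) free_on_add_closed:
  assumes "f \<in> carrier (free_on R B)" "g \<in> carrier (free_on R B)"
  shows "f \<oplus>\<^bsub>free_on R B\<^esub> g \<in> carrier (free_on R B)"
proof -
  have sub: "{z. f z \<oplus> g z \<noteq> \<zero>} \<subseteq> {z. f z \<noteq> \<zero>} \<union> {z. g z \<noteq> \<zero>}" by auto
  have "finite ({z. f z \<noteq> \<zero>} \<union> {z. g z \<noteq> \<zero>})" using assms by (simp add: free_on_simps)
  hence "finite {z. f z \<oplus> g z \<noteq> \<zero>}" by (rule finite_subset[OF sub])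
  moreover have "{z. f z \<oplus> g z \<noteq> \<zero>} \<subseteq> B" using sub assms by (auto simp: free_on_simps)
  ultimately show ?thesis using assms by (simp add: free_on_simps)
qed

lemma (in cring) free_on_smult_closed:
  assumes "r \<in> carrier R" "f \<in> carrier (free_on R B)"
  shows "r \<odot>\<^bsub>free_on R B\<^esub> f \<in> carrier (free_on R B)"
proof -
  have sub: "{z. r \<otimes> f z \<noteq> \<zero>} \<subseteq> {z. f z \<noteq> \<zero>}" using assms(1) by auto
  have "finite {z. r \<otimes> f z \<noteq> \<zero>}" by (rule finite_subset[OF sub]) (use assms in \<open>simp add: free_on_simps\<close>)
  moreover have "{z. r \<otimes> f z \<noteq> \<zero>} \<subseteq> B" using sub assms by (auto simp: free_on_simps)
  ultimately show ?thesis using assms by (simp add: free_on_simps)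
qed

lemma (in cring) module_free_on: "module R (free_on R B)"
proof (rule moduleI[OF is_cring])
  show "abelian_group (free_on R B)"
  proof (rule abelian_groupI)
    fix f assume f: "f \<in> carrier (free_on R B)"
    have "(\<ominus> \<one>) \<odot>\<^bsub>free_on R B\<^esub> f \<in> carrier (free_on R B)"
      using f by (intro free_on_smult_closed) simp_all
    moreover have "((\<ominus> \<one>) \<odot>\<^bsub>free_on R B\<^esub> f) \<oplus>\<^bsub>free_on R B\<^esub> f = \<zero>\<^bsub>free_on R B\<^esub>"
      using f by (simp add: free_on_simps l_minus l_neg)
    ultimately show "\<exists>g\<in>carrier (free_on R B). g \<oplus>\<^bsub>free_on R B\<^esub> f = \<zero>\<^bsub>free_on R B\<^esub>" by blast
  next
    fix f g assume "f \<in> carrier (free_on R B)" "g \<in> carrier (free_on R B)"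
    thus "f \<oplus>\<^bsub>free_on R B\<^esub> g \<in> carrier (free_on R B)" by (rule free_on_add_closed)
  qed (auto simp: free_on_simps a_ac)
next
  fix r f assume "r \<in> carrier R" "f \<in> carrier (free_on R B)"
  thus "r \<odot>\<^bsub>free_on R B\<^esub> f \<in> carrier (free_on R B)" by (rule free_on_smult_closed)
qed (auto simp: free_on_simps l_distr r_distr m_assoc)

definition eval_free :: "('a, 'b) ring_scheme \<Rightarrow> ('a, 'm) module \<Rightarrow> ('p \<Rightarrow> 'm) \<Rightarrow> ('p \<Rightarrow> 'a) \<Rightarrow> 'm" where
  "eval_free R M \<phi> f = (\<Oplus>\<^bsub>M\<^esub>z\<in>{z. f z \<noteq> \<zero>\<^bsub>R\<^esub>}. f z \<odot>\<^bsub>M\<^esub> \<phi> z)"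

lemma eval_free_superset:
  fixes R (structure)
  assumes "module R M" "\<And>z. z \<in> B \<Longrightarrow> \<phi> z \<in> carrier M" "f \<in> carrier (free_on R B)"
    "finite T" "{z. f z \<noteq> \<zero>} \<subseteq> T" "T \<subseteq> B"
  shows "eval_free R M \<phi> f = (\<Oplus>\<^bsub>M\<^esub>z\<in>T. f z \<odot>\<^bsub>M\<^esub> \<phi> z)"
proof -
  interpret M: module R M by fact
  show ?thesis unfolding eval_free_def
    using assms(2-) by (intro M.add.finprod_mono_neutral_cong_left) (auto simp: free_on_simps subset_iff)
qed

lemma eval_free_hom:
  fixes R (structure)
  assumes M: "module R M" and \<phi>: "\<And>z. z \<in> B \<Longrightarrow> \<phi> z \<in> carrier M"
  shows "eval_free R M \<phi> \<in> mod_hom R (free_on R B) M"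
proof -
  interpret M: module R M by fact
  let ?supp = "\<lambda>f. {z. f z \<noteq> \<zero>}"
  note sup = eval_free_superset[OF M \<phi>]
  have fin: "finite (?supp f)" "?supp f \<subseteq> B" if "f \<in> carrier (free_on R B)" for f
    using that by (simp_all add: free_on_simps)
  have fr: "f z \<in> carrier R" if "f \<in> carrier (free_on R B)" for f z using that by (simp add: free_on_simps)
  have tm: "(\<lambda>z. f z \<odot>\<^bsub>M\<^esub> \<phi> z) \<in> T \<rightarrow> carrier M" if "f \<in> carrier (free_on R B)" "T \<subseteq> B" for f T
    using fr[OF that(1)] \<phi> that(2) by auto
  have cl: "eval_free R M \<phi> f \<in> carrier M" if "f \<in> carrier (free_on R B)" for f
    unfolding eval_free_def by (rule M.finsum_closed[OF tm[OF that fin(2)[OF that]]])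
  have add: "eval_free R M \<phi> (f \<oplus>\<^bsub>free_on R B\<^esub> g) = eval_free R M \<phi> f \<oplus>\<^bsub>M\<^esub> eval_free R M \<phi> g"
    if f: "f \<in> carrier (free_on R B)" and g: "g \<in> carrier (free_on R B)" for f g
  proof -
    let ?T = "?supp f \<union> ?supp g"
    have T: "finite ?T" "?T \<subseteq> B" using fin f g by auto
    have fg: "f \<oplus>\<^bsub>free_on R B\<^esub> g \<in> carrier (free_on R B)" by (rule M.free_on_add_closed[OF f g])
    have s: "?supp (f \<oplus>\<^bsub>free_on R B\<^esub> g) \<subseteq> ?T" by (auto simp: free_on_simps)
    have "eval_free R M \<phi> (f \<oplus>\<^bsub>free_on R B\<^esub> g) = (\<Oplus>\<^bsub>M\<^esub>z\<in>?T. (f \<oplus>\<^bsub>free_on R B\<^esub> g) z \<odot>\<^bsub>M\<^esub> \<phi> z)"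
      by (rule sup[OF _ fg T(1) s T(2)])
    also have "\<dots> = (\<Oplus>\<^bsub>M\<^esub>z\<in>?T. f z \<odot>\<^bsub>M\<^esub> \<phi> z \<oplus>\<^bsub>M\<^esub> g z \<odot>\<^bsub>M\<^esub> \<phi> z)"
      using T(2) \<phi> fr[OF f] fr[OF g]
      by (intro M.finsum_cong') (auto simp: free_on_simps M.smult_l_distr subset_iff)
    also have "\<dots> = (\<Oplus>\<^bsub>M\<^esub>z\<in>?T. f z \<odot>\<^bsub>M\<^esub> \<phi> z) \<oplus>\<^bsub>M\<^esub> (\<Oplus>\<^bsub>M\<^esub>z\<in>?T. g z \<odot>\<^bsub>M\<^esub> \<phi> z)"
      by (rule M.finsum_addf[OF tm[OF f T(2)] tm[OF g T(2)]])
    also have "\<dots> = eval_free R M \<phi> f \<oplus>\<^bsub>M\<^esub> eval_free R M \<phi> g"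
      using sup[OF _ f T(1) _ T(2)] sup[OF _ g T(1) _ T(2)] by simp
    finally show ?thesis .
  qed
  have sm: "eval_free R M \<phi> (r \<odot>\<^bsub>free_on R B\<^esub> f) = r \<odot>\<^bsub>M\<^esub> eval_free R M \<phi> f"
    if r: "r \<in> carrier R" and f: "f \<in> carrier (free_on R B)" for r f
  proof -
    let ?T = "?supp f"
    note T = fin[OF f]
    have rf: "r \<odot>\<^bsub>free_on R B\<^esub> f \<in> carrier (free_on R B)" by (rule M.free_on_smult_closed[OF r f])
    have s: "?supp (r \<odot>\<^bsub>free_on R B\<^esub> f) \<subseteq> ?T" using r by (auto simp: free_on_simps)
    have "eval_free R M \<phi> (r \<odot>\<^bsub>free_on R B\<^esub> f) = (\<Oplus>\<^bsub>M\<^esub>z\<in>?T. (r \<odot>\<^bsub>free_on R B\<^esub> f) z \<odot>\<^bsub>M\<^esub> \<phi> z)"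
      by (rule sup[OF _ rf T(1) s T(2)])
    also have "\<dots> = (\<Oplus>\<^bsub>M\<^esub>z\<in>?T. r \<odot>\<^bsub>M\<^esub> (f z \<odot>\<^bsub>M\<^esub> \<phi> z))"
      using T(2) \<phi> fr[OF f] r
      by (intro M.finsum_cong') (auto simp: free_on_simps M.smult_assoc1 subset_iff)
    also have "\<dots> = r \<odot>\<^bsub>M\<^esub> eval_free R M \<phi> f"
      unfolding eval_free_def by (rule M.finsum_smult_ldistr[OF T(1) r tm[OF f T(2)], symmetric])
    finally show ?thesis .
  qed
  show ?thesis using cl add sm by (simp add: mod_hom_def)
qed

lemma mod_hom_eval_free:
  fixes R (structure)
  assumes M: "module R M" and N: "module R N" and \<psi>: "\<psi> \<in> mod_hom R M N"
    and \<phi>: "\<And>z. z \<in> B \<Longrightarrow> \<phi> z \<in> carrier M" and f: "f \<in> carrier (free_on R B)"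
  shows "\<psi> (eval_free R M \<phi> f) = eval_free R N (\<lambda>z. \<psi> (\<phi> z)) f"
proof -
  interpret M: module R M by fact
  interpret N: module R N by fact
  have fr: "f z \<in> carrier R" for z using f by (simp add: free_on_simps)
  have "\<psi> (\<Oplus>\<^bsub>M\<^esub>z\<in>T. f z \<odot>\<^bsub>M\<^esub> \<phi> z) = (\<Oplus>\<^bsub>N\<^esub>z\<in>T. f z \<odot>\<^bsub>N\<^esub> \<psi> (\<phi> z))"
    if "finite T" "T \<subseteq> B" for T
    using that
  proof (induction T)
    case empty thus ?case using mod_hom_zero[OF M N \<psi>] by simp
  next
    case (insert z T)
    have c: "f x \<odot>\<^bsub>M\<^esub> \<phi> x \<in> carrier M" "f x \<odot>\<^bsub>N\<^esub> \<psi> (\<phi> x) \<in> carrier N" "\<phi> x \<in> carrier M" if "x \<in> insert z T" for x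
      using insert.prems that fr \<phi> mod_hom_closed[OF \<psi>] by blast+
    have "(\<Oplus>\<^bsub>M\<^esub>z\<in>T. f z \<odot>\<^bsub>M\<^esub> \<phi> z) \<in> carrier M" using c by (intro M.finsum_closed) auto
    thus ?case using insert c mod_hom_add[OF \<psi>] mod_hom_smult[OF \<psi> fr]
      by (simp add: M.finsum_insert N.finsum_insert Pi_iff)
  qed
  thus ?thesis using f unfolding eval_free_def by (simp add: free_on_simps)
qed

text \<open>Split the surjection from the free module on the carrier of \<open>P\<close>. A map from that free module is given by
  arbitrary values on the basis, hence lifts along \<open>d\<close>.\<close>

lemma projective_lift:
  fixes R (structure) and P :: "('a, 'p) module"
  assumes P: "projective_module R P" and G: "module R G" and L: "module R L"
    and d: "d \<in> mod_hom R G L" "d ` carrier G = carrier L" and g: "g \<in> mod_hom R P L"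
  shows "\<exists>h\<in>mod_hom R P G. \<forall>x\<in>carrier P. d (h x) = g x"
proof -
  have MP: "module R P" using P by (simp add: projective_module_def)
  interpret P: module R P by fact
  let ?E = "free_on R (carrier P)"
  have E: "module R ?E" by (rule P.module_free_on)
  let ?e = "eval_free R P (\<lambda>z. z)"
  have e: "?e \<in> mod_hom R ?E P" by (rule eval_free_hom[OF MP])
  have surj: "?e ` carrier ?E = carrier P"
  proof
    show "?e ` carrier ?E \<subseteq> carrier P" using mod_hom_closed[OF e] by blast
    show "carrier P \<subseteq> ?e ` carrier ?E"
    proof
      fix x assume x: "x \<in> carrier P"
      let ?\<delta> = "\<lambda>z. if z = x then \<one> else \<zero>"
      have s: "{z. ?\<delta> z \<noteq> \<zero>} \<subseteq> {x}" by auto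
      have "finite {z. ?\<delta> z \<noteq> \<zero>}" by (rule finite_subset[OF s]) simp
      moreover have "{z. ?\<delta> z \<noteq> \<zero>} \<subseteq> carrier P" using s x by blast
      ultimately have \<delta>: "?\<delta> \<in> carrier ?E" by (simp add: free_on_simps)
      have "?e ?\<delta> = (\<Oplus>\<^bsub>P\<^esub>z\<in>{x}. ?\<delta> z \<odot>\<^bsub>P\<^esub> z)"
        by (rule eval_free_superset[OF MP _ \<delta> _ s]) (use x in auto)
      also have "\<dots> = x" using x by (simp add: P.finsum_insert)
      finally show "x \<in> ?e ` carrier ?E" using \<delta> by force
    qed
  qed
  have "(\<lambda>x. x) \<in> mod_hom R P P" by (simp add: mod_hom_def)
  then obtain s where s: "s \<in> mod_hom R P ?E" "\<And>x. x \<in> carrier P \<Longrightarrow> ?e (s x) = x"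
    using P E MP e surj unfolding projective_module_def by blast
  have "\<forall>z\<in>carrier P. \<exists>x\<in>carrier G. d x = g z" using d(2) mod_hom_closed[OF g] by (metis imageE)
  then obtain \<phi> where \<phi>: "\<And>z. z \<in> carrier P \<Longrightarrow> \<phi> z \<in> carrier G" "\<And>z. z \<in> carrier P \<Longrightarrow> d (\<phi> z) = g z"
    by metis
  let ?h = "\<lambda>x. eval_free R G \<phi> (s x)"
  have h: "?h \<in> mod_hom R P G" by (rule mod_hom_comp[OF s(1) eval_free_hom[OF G \<phi>(1)]])
  have "d (?h x) = g x" if x: "x \<in> carrier P" for x
  proof -
    note sx = mod_hom_closed[OF s(1) x]
    interpret L: module R L by (rule L)
    have "d (?h x) = eval_free R L (\<lambda>z. d (\<phi> z)) (s x)" by (rule mod_hom_eval_free[OF G L d(1) \<phi>(1) sx])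
    also have "\<dots> = eval_free R L (\<lambda>z. g z) (s x)"
      unfolding eval_free_def using sx \<phi>(2) mod_hom_closed[OF g]
      by (intro L.finsum_cong') (auto simp: free_on_simps subset_iff)
    also have "\<dots> = g (?e (s x))" by (rule mod_hom_eval_free[OF MP L g _ sx, symmetric])
    finally show ?thesis using s(2)[OF x] by simp
  qed
  thus ?thesis by (intro bexI[of _ ?h] ballI h)
qed

lemma free_mod_lift:
  fixes R (structure)
  assumes G: "module R G" and L: "module R L" and d: "d \<in> mod_hom R G L"
    and g: "g \<in> mod_hom R (free_mod R c) L" "g ` carrier (free_mod R c) \<subseteq> d ` carrier G"
  shows "\<exists>h\<in>mod_hom R (free_mod R c) G. \<forall>f\<in>carrier (free_mod R c). d (h f) = g f"
proof -
  interpret G: module R G by fact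
  have "\<forall>j\<in>{..<c}. \<exists>x\<in>carrier G. d x = g (unit_vec R j)"
  proof
    fix j assume "j \<in> {..<c}"
    hence "unit_vec R j \<in> carrier (free_mod R c)" by (simp add: G.unit_vec_closed)
    hence "g (unit_vec R j) \<in> d ` carrier G" using g(2) by blast
    thus "\<exists>x\<in>carrier G. d x = g (unit_vec R j)" by (metis imageE)
  qed
  then obtain x where x: "\<And>j. j < c \<Longrightarrow> x j \<in> carrier G" "\<And>j. j < c \<Longrightarrow> d (x j) = g (unit_vec R j)"
    by (metis lessThan_iff)
  have "d (lincomb G x f c) = g f" if f: "f \<in> carrier (free_mod R c)" for f
  proof -
    interpret L: module R L by (rule L)
    have fr: "f j \<in> carrier R" for j using f by (simp add: free_mod_simps)
    have "d (lincomb G x f c) = lincomb L (\<lambda>j. d (x j)) f c" by (rule mod_hom_lincomb[OF G L d x(1) fr])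
    also have "\<dots> = lincomb L (\<lambda>j. g (unit_vec R j)) f c" by (rule L.lincomb_cong[OF x(2)])
    also have "\<dots> = g (lincomb (free_mod R c) (unit_vec R) f c)"
      by (rule mod_hom_lincomb[OF G.module_free_mod L g(1) G.unit_vec_closed fr, symmetric])
    finally show ?thesis using G.lincomb_unit_vecs[OF f] by simp
  qed
  thus ?thesis by (intro bexI[of _ "\<lambda>f. lincomb G x f c"] ballI lincomb_hom[OF G] x(1))
qed

section \<open>Regular sequences on cyclic modules\<close>

lemma (in cring) module_self: "module R (self_module R)"
proof (rule moduleI[OF is_cring])
  show "abelian_group (self_module R)"
    by (rule abelian_groupI) (auto simp: self_module_def a_ac intro: l_neg)
qed (auto simp: self_module_def l_distr r_distr m_assoc)

lemma (in ideal) quot_carrier: "carrier (R Quot I) = (\<lambda>r. I +> r) ` carrier R"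
  unfolding FactRing_def A_RCOSETS_def' by auto

lemma (in cring) module_quot:
  assumes "ideal I R" shows "module R (quot_module R I)"
proof -
  interpret I: ideal I R by fact
  interpret Q: cring "R Quot I" by (rule I.quotient_is_cring[OF is_cring])
  note h = I.rcos_ring_hom
  have c: "I +> r \<in> carrier (R Quot I)" if "r \<in> carrier R" for r by (rule ring_hom_closed[OF h that])
  show ?thesis
  proof (rule moduleI[OF is_cring])
    show "abelian_group (quot_module R I)"
    proof (rule abelian_groupI)
      fix x assume "x \<in> carrier (quot_module R I)"
      thus "\<exists>y\<in>carrier (quot_module R I). y \<oplus>\<^bsub>quot_module R I\<^esub> x = \<zero>\<^bsub>quot_module R I\<^esub>"
        by (intro bexI[of _ "\<ominus>\<^bsub>R Quot I\<^esub> x"]) (simp_all add: quot_module_def Q.l_neg)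
    qed (auto simp: quot_module_def Q.a_ac)
  qed (use c in \<open>auto simp: quot_module_def ring_hom_add[OF h] ring_hom_mult[OF h] ring_hom_one[OF h]
        Q.l_distr Q.r_distr Q.m_assoc\<close>)
qed

lemma (in module) preimage_ideal:
  assumes H: "submodule H R M" and g: "g \<in> carrier M"
  shows "ideal {r \<in> carrier R. r \<odot>\<^bsub>M\<^esub> g \<in> H} R"
proof -
  note E = submoduleE[OF H]
  let ?P = "{r \<in> carrier R. r \<odot>\<^bsub>M\<^esub> g \<in> H}"
  have sm: "s \<otimes> r \<in> ?P" if "s \<in> carrier R" "r \<in> ?P" for s r
    using that E(4)[of s "r \<odot>\<^bsub>M\<^esub> g"] g by (simp add: smult_assoc1)
  show ?thesis
  proof (rule idealI[OF R.ring_axioms])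
    show "subgroup ?P (add_monoid R)"
    proof (rule R.add.subgroupI)
      show "?P \<noteq> {}" using submodule_zero[OF H] g by (auto intro!: exI[of _ \<zero>])
      show "\<ominus> r \<in> ?P" if "r \<in> ?P" for r using that E(3) g by (simp add: smult_l_minus)
      show "r \<oplus> s \<in> ?P" if "r \<in> ?P" "s \<in> ?P" for r s using that E(5) g by (simp add: smult_l_distr)
    qed blast
  next
    fix r s assume r: "r \<in> ?P" "s \<in> carrier R"
    show "s \<otimes> r \<in> ?P" by (rule sm[OF r(2,1)])
    thus "r \<otimes> s \<in> ?P" using r by (simp add: R.m_comm)
  qed
qed

text \<open>For \<open>M \<cong> R/N\<close>, generated by \<open>g\<close>, the submodule \<open>A M\<close> corresponds to the ideal \<open>N + A\<close>.\<close>

lemma ideal_times_cyclic: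
  fixes R (structure)
  assumes M: "module R M" and g: "g \<in> carrier M" "carrier M = (\<lambda>r. r \<odot>\<^bsub>M\<^esub> g) ` carrier R"
    and N: "N = {r \<in> carrier R. r \<odot>\<^bsub>M\<^esub> g = \<zero>\<^bsub>M\<^esub>}" and A: "A \<subseteq> carrier R" and r: "r \<in> carrier R"
  shows "r \<odot>\<^bsub>M\<^esub> g \<in> ideal_times R (Idl A) M \<longleftrightarrow> r \<in> Idl (N \<union> A)"
proof -
  interpret M: module R M by (rule M)
  have "N = {r \<in> carrier R. r \<odot>\<^bsub>M\<^esub> g \<in> {\<zero>\<^bsub>M\<^esub>}}" unfolding N by simp
  hence idN: "ideal N R" using M.preimage_ideal[OF M.zero_submodule g(1)] by simp
  have sub: "N \<union> A \<subseteq> carrier R" using A unfolding N by blast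
  let ?L = "Idl (N \<union> A)"
  interpret L: ideal ?L R by (rule M.genideal_ideal[OF sub])
  have inL: "N \<subseteq> ?L" "A \<subseteq> ?L" using M.genideal_self[OF sub] by blast+
  have AL: "Idl A \<subseteq> ?L" by (rule M.genideal_minimal[OF L.is_ideal inL(2)])
  let ?W = "(\<lambda>r. r \<odot>\<^bsub>M\<^esub> g) ` ?L"
  have W: "submodule ?W R M"
  proof (rule M.submoduleI)
    show "?W \<subseteq> carrier M" using g(1) L.Icarr by blast
    show "\<zero>\<^bsub>M\<^esub> \<in> ?W" by (rule image_eqI[of _ _ \<zero>]) (use g(1) L.zero_closed in simp_all)
    show "\<ominus>\<^bsub>M\<^esub> x \<in> ?W" if x: "x \<in> ?W" for x
    proof -
      obtain l where l: "l \<in> ?L" "x = l \<odot>\<^bsub>M\<^esub> g" using x by blast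
      show ?thesis by (rule image_eqI[of _ _ "\<ominus> l"])
        (use l L.Icarr[OF l(1)] g(1) in \<open>simp_all add: M.smult_l_minus\<close>)
    qed
    show "x \<oplus>\<^bsub>M\<^esub> z \<in> ?W" if x: "x \<in> ?W" and z: "z \<in> ?W" for x z
    proof -
      obtain l where l: "l \<in> ?L" "x = l \<odot>\<^bsub>M\<^esub> g" using x by blast
      obtain k where k: "k \<in> ?L" "z = k \<odot>\<^bsub>M\<^esub> g" using z by blast
      show ?thesis by (rule image_eqI[of _ _ "l \<oplus> k"])
        (use l k L.Icarr[OF l(1)] L.Icarr[OF k(1)] g(1) in \<open>simp_all add: M.smult_l_distr\<close>)
    qed
    show "s \<odot>\<^bsub>M\<^esub> x \<in> ?W" if s: "s \<in> carrier R" and x: "x \<in> ?W" for s x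
    proof -
      obtain l where l: "l \<in> ?L" "x = l \<odot>\<^bsub>M\<^esub> g" using x by blast
      show ?thesis by (rule image_eqI[of _ _ "s \<otimes> l"])
        (use l L.Icarr[OF l(1)] s g(1) in \<open>simp_all add: M.smult_assoc1 L.I_l_closed\<close>)
    qed
  qed
  show ?thesis
  proof
    assume "r \<odot>\<^bsub>M\<^esub> g \<in> ideal_times R (Idl A) M"
    moreover have "a \<odot>\<^bsub>M\<^esub> x \<in> ?W" if a: "a \<in> Idl A" and x: "x \<in> carrier M" for a x
    proof -
      obtain s where s: "s \<in> carrier R" "x = s \<odot>\<^bsub>M\<^esub> g" using x g(2) by blast
      have aL: "a \<in> ?L" using a AL by blast
      show ?thesis by (rule image_eqI[of _ _ "a \<otimes> s"])
        (use s aL L.Icarr[OF aL] g(1) in \<open>simp_all add: M.smult_assoc1 L.I_r_closed\<close>)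
    qed
    ultimately have "r \<odot>\<^bsub>M\<^esub> g \<in> ?W" using W unfolding ideal_times_def by blast
    then obtain l where l: "l \<in> ?L" "r \<odot>\<^bsub>M\<^esub> g = l \<odot>\<^bsub>M\<^esub> g" by blast
    have lc: "l \<in> carrier R" by (rule L.Icarr[OF l(1)])
    have "(r \<ominus> l) \<odot>\<^bsub>M\<^esub> g = \<zero>\<^bsub>M\<^esub>"
      using r lc g(1) l(2) by (simp add: a_minus_def M.smult_l_distr M.smult_l_minus M.M.r_neg)
    hence "r \<ominus> l \<in> ?L" using inL(1) r lc unfolding N by blast
    hence "(r \<ominus> l) \<oplus> l \<in> ?L" using l(1) by (rule L.a_closed)
    thus "r \<in> ?L" using M.R.add_minus_cancel[OF r lc] M.R.is_cring
      by (simp add: a_minus_def M.R.a_assoc M.R.l_neg r lc)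
  next
    assume rL: "r \<in> ?L"
    have "r \<odot>\<^bsub>M\<^esub> g \<in> H" if H: "submodule H R M" "\<forall>a\<in>Idl A. \<forall>x\<in>carrier M. a \<odot>\<^bsub>M\<^esub> x \<in> H" for H
    proof -
      have "?L \<subseteq> {r \<in> carrier R. r \<odot>\<^bsub>M\<^esub> g \<in> H}"
      proof (rule M.genideal_minimal[OF M.preimage_ideal[OF H(1) g(1)]])
        show "N \<union> A \<subseteq> {r \<in> carrier R. r \<odot>\<^bsub>M\<^esub> g \<in> H}"
          using M.submodule_zero[OF H(1)] H(2) g(1) A M.genideal_self[OF A] unfolding N by auto
      qed
      thus ?thesis using rL by blast
    qed
    thus "r \<odot>\<^bsub>M\<^esub> g \<in> ideal_times R (Idl A) M" unfolding ideal_times_def by blast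
  qed
qed

lemma regular_seq_cyclic:
  fixes R (structure)
  assumes M: "module R M" and g: "g \<in> carrier M" "carrier M = (\<lambda>r. r \<odot>\<^bsub>M\<^esub> g) ` carrier R"
    and N: "N = {r \<in> carrier R. r \<odot>\<^bsub>M\<^esub> g = \<zero>\<^bsub>M\<^esub>}" and idN: "ideal N R" and \<mm>: "\<mm> \<subseteq> carrier R"
  shows "regular_seq R \<mm> M xs \<longleftrightarrow>
    set xs \<subseteq> \<mm> \<and> regular_mod R N xs \<and> Idl (N \<union> set xs) \<noteq> carrier R"
proof (cases "set xs \<subseteq> \<mm>")
  case False thus ?thesis by (simp add: regular_seq_def)
next
  case True
  interpret M: module R M by (rule M)
  have c: "set xs \<subseteq> carrier R" using True \<mm> by blast
  have tc: "set (take i xs) \<subseteq> carrier R" for i using c set_take_subset[of i xs] by blast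
  note it = ideal_times_cyclic[OF M g N]
  have "(\<forall>v\<in>carrier M. xs ! i \<odot>\<^bsub>M\<^esub> v \<in> ideal_times R (Idl (set (take i xs))) M \<longrightarrow>
        v \<in> ideal_times R (Idl (set (take i xs))) M) \<longleftrightarrow>
     (\<forall>r\<in>carrier R. xs ! i \<otimes> r \<in> Idl (N \<union> set (take i xs)) \<longrightarrow> r \<in> Idl (N \<union> set (take i xs)))"
    if i: "i < length xs" for i
  proof -
    have x: "xs ! i \<in> carrier R" using c nth_mem[OF i] by blast
    have "xs ! i \<odot>\<^bsub>M\<^esub> (r \<odot>\<^bsub>M\<^esub> g) \<in> ideal_times R (Idl (set (take i xs))) M \<longleftrightarrow>
        xs ! i \<otimes> r \<in> Idl (N \<union> set (take i xs))" if "r \<in> carrier R" for r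
      using it[OF tc, of "xs ! i \<otimes> r" i] that x g(1) by (simp add: M.smult_assoc1)
    thus ?thesis unfolding g(2) using it[OF tc] by simp
  qed
  moreover have "ideal_times R (Idl (set xs)) M = carrier M \<longleftrightarrow> Idl (N \<union> set xs) = carrier R"
  proof -
    have sub: "N \<union> set xs \<subseteq> carrier R" using c unfolding N by blast
    have "Idl (N \<union> set xs) \<subseteq> carrier R" using ideal.Icarr[OF M.genideal_ideal[OF sub]] by blast
    moreover have "ideal_times R (Idl (set xs)) M \<subseteq> carrier M"
    proof -
      have "\<forall>a\<in>Idl (set xs). \<forall>x\<in>carrier M. a \<odot>\<^bsub>M\<^esub> x \<in> carrier M"
        using ideal.Icarr[OF M.genideal_ideal[OF c]] by simp
      thus ?thesis using M.carrier_is_submodule unfolding ideal_times_def by blast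
    qed
    ultimately show ?thesis using it[OF c] unfolding g(2) by blast
  qed
  ultimately show ?thesis
    unfolding regular_seq_def M.regular_mod_nth[OF idN c] using True by simp
qed

lemma (in noetherian_local_ring) regular_seq_self_iff:
  "regular_seq R \<mm> (self_module R) xs \<longleftrightarrow> set xs \<subseteq> \<mm> \<and> regular_mod R {\<zero>} xs"
proof -
  have "regular_seq R \<mm> (self_module R) xs \<longleftrightarrow>
      set xs \<subseteq> \<mm> \<and> regular_mod R {\<zero>} xs \<and> Idl ({\<zero>} \<union> set xs) \<noteq> carrier R"
    by (rule regular_seq_cyclic[OF module_self, where g = \<one>])
      (auto simp: self_module_def zeroideal intro: image_eqI max.Icarr)
  moreover have "Idl ({\<zero>} \<union> set xs) \<noteq> carrier R" if "set xs \<subseteq> \<mm>"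
  proof -
    have "Idl ({\<zero>} \<union> set xs) \<subseteq> \<mm>" using that max.zero_closed by (intro genideal_minimal max.is_ideal) auto
    thus ?thesis using one_notin_max by blast
  qed
  ultimately show ?thesis by blast
qed

lemma (in noetherian_local_ring) regular_seq_quot_iff:
  assumes I: "ideal I R" "I \<noteq> carrier R"
  shows "regular_seq R \<mm> (quot_module R I) xs \<longleftrightarrow> set xs \<subseteq> \<mm> \<and> regular_mod R I xs"
proof -
  interpret I: ideal I R by (rule I(1))
  note h = I.rcos_ring_hom
  have sm: "r \<odot>\<^bsub>quot_module R I\<^esub> (I +> \<one>) = I +> r" if "r \<in> carrier R" for r
    unfolding quot_module_def using ring_hom_mult[OF h that, of \<one>] that by simp
  have z: "\<zero>\<^bsub>quot_module R I\<^esub> = I" by (simp add: quot_module_def FactRing_def)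
  have "regular_seq R \<mm> (quot_module R I) xs \<longleftrightarrow>
      set xs \<subseteq> \<mm> \<and> regular_mod R I xs \<and> Idl (I \<union> set xs) \<noteq> carrier R"
  proof (rule regular_seq_cyclic[OF module_quot[OF I(1)], where g = "I +> \<one>"])
    have c: "carrier (quot_module R I) = (\<lambda>r. I +> r) ` carrier R"
      unfolding quot_module_def using I.quot_carrier by simp
    show "I +> \<one> \<in> carrier (quot_module R I)" unfolding c by simp
    show "carrier (quot_module R I) = (\<lambda>r. r \<odot>\<^bsub>quot_module R I\<^esub> (I +> \<one>)) ` carrier R"
      unfolding c by (rule image_cong[OF refl sm[symmetric]])
    show "I = {r \<in> carrier R. r \<odot>\<^bsub>quot_module R I\<^esub> (I +> \<one>) = \<zero>\<^bsub>quot_module R I\<^esub>}"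
    proof (intro equalityI subsetI)
      fix r assume r: "r \<in> I"
      have rc: "r \<in> carrier R" by (rule I.Icarr[OF r])
      thus "r \<in> {r \<in> carrier R. r \<odot>\<^bsub>quot_module R I\<^esub> (I +> \<one>) = \<zero>\<^bsub>quot_module R I\<^esub>}"
        unfolding z using sm[OF rc] a_rcos_zero[OF I(1) r] by simp
    next
      fix r assume "r \<in> {r \<in> carrier R. r \<odot>\<^bsub>quot_module R I\<^esub> (I +> \<one>) = \<zero>\<^bsub>quot_module R I\<^esub>}"
      hence r: "r \<in> carrier R" "r \<odot>\<^bsub>quot_module R I\<^esub> (I +> \<one>) = I" unfolding z by simp_all
      show "r \<in> I" using I.rcos_const_imp_mem[OF r(1)] sm[OF r(1)] r(2) by simp
    qed
    show "ideal I R" by (rule I(1))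
    show "\<mm> \<subseteq> carrier R" by (rule max.a_subset)
  qed
  moreover have "Idl (I \<union> set xs) \<noteq> carrier R" if "set xs \<subseteq> \<mm>"
  proof -
    have "Idl (I \<union> set xs) \<subseteq> \<mm>"
      using that proper_ideal_subset_max[OF I] by (intro genideal_minimal max.is_ideal) auto
    thus ?thesis using one_notin_max by blast
  qed
  ultimately show ?thesis by blast
qed

section \<open>Additivity of the Frobenius map\<close>

lemma (in cring) binomial_expansion:
  assumes x: "x \<in> carrier R" and y: "y \<in> carrier R"
  shows "(x \<oplus> y) [^] (n::nat) = (\<Oplus>k\<in>{..n}. add_pow R (n choose k) (x [^] k \<otimes> y [^] (n - k)))"
proof (induction n)
  case 0 thus ?case by simp
next
  case (Suc n)
  let ?t = "\<lambda>n k. add_pow R (n choose k) (x [^] k \<otimes> y [^] (n - k))"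
  define v where "v k = x [^] k \<otimes> y [^] (Suc n - k)" for k
  have mono: "x [^] k \<otimes> y [^] l \<in> carrier R" for k l :: nat using x y by simp
  have tx: "x \<otimes> ?t n k = add_pow R (n choose k) (v (Suc k))" for k
  proof -
    have "x \<otimes> (x [^] k \<otimes> y [^] (n - k)) = v (Suc k)"
      unfolding v_def using x y by (simp add: m_ac)
    thus ?thesis using x mono by (simp add: add_pow_rdistr)
  qed
  have ty: "y \<otimes> ?t n k = add_pow R (n choose k) (v k)" if "k \<le> n" for k
  proof -
    have "y \<otimes> (x [^] k \<otimes> y [^] (n - k)) = x [^] k \<otimes> (y [^] (n - k) \<otimes> y)"
      using x y by (simp add: m_ac)
    also have "\<dots> = v k" unfolding v_def using that by (simp add: Suc_diff_le)
    finally show ?thesis using y mono by (simp add: add_pow_rdistr)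
  qed
  have u: "v k \<in> carrier R" for k unfolding v_def by (rule mono)
  have "(x \<oplus> y) [^] Suc n = x \<otimes> (\<Oplus>k\<in>{..n}. ?t n k) \<oplus> y \<otimes> (\<Oplus>k\<in>{..n}. ?t n k)"
  proof -
    have S: "(\<Oplus>k\<in>{..n}. ?t n k) \<in> carrier R" using mono by (intro finsum_closed) auto
    have "(x \<oplus> y) [^] Suc n = (\<Oplus>k\<in>{..n}. ?t n k) \<otimes> (x \<oplus> y)" by (simp only: nat_pow_Suc Suc)
    also have "\<dots> = (x \<oplus> y) \<otimes> (\<Oplus>k\<in>{..n}. ?t n k)" by (rule m_comm[OF S a_closed[OF x y]])
    also have "\<dots> = x \<otimes> (\<Oplus>k\<in>{..n}. ?t n k) \<oplus> y \<otimes> (\<Oplus>k\<in>{..n}. ?t n k)" by (rule l_distr[OF x y S])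
    finally show ?thesis .
  qed
  also have "x \<otimes> (\<Oplus>k\<in>{..n}. ?t n k) = (\<Oplus>k\<in>{..n}. add_pow R (n choose k) (v (Suc k)))"
    using x mono tx by (simp add: finsum_rdistr Pi_iff)
  also have "y \<otimes> (\<Oplus>k\<in>{..n}. ?t n k) = (\<Oplus>k\<in>{..n}. y \<otimes> ?t n k)"
    using y mono by (simp add: finsum_rdistr Pi_iff)
  also have "\<dots> = (\<Oplus>k\<in>{..n}. add_pow R (n choose k) (v k))"
    by (rule finsum_cong') (use ty u in auto)
  also have "\<dots> = (\<Oplus>k\<in>{..Suc n}. add_pow R (n choose k) (v k))"
  proof -
    let ?f = "\<lambda>k. add_pow R (n choose k) (v k)"
    have f: "?f \<in> A \<rightarrow> carrier R" for A using u by (auto)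
    have "(\<Oplus>k\<in>{..Suc n}. ?f k) = ?f (Suc n) \<oplus> (\<Oplus>k\<in>{..n}. ?f k)" by (rule finsum_Suc[OF f])
    also have "n choose Suc n = 0" by simp
    finally show ?thesis using l_zero[OF finsum_closed[OF f[of "{..n}"]]] by (simp only: add.nat_pow_0)
  qed
  also have "\<dots> = (\<Oplus>k\<in>{..n}. add_pow R (n choose Suc k) (v (Suc k))) \<oplus> add_pow R (n choose 0) (v 0)"
    using u by (intro finsum_Suc2) auto
  also have "(\<Oplus>k\<in>{..n}. add_pow R (n choose k) (v (Suc k))) \<oplus> ((\<Oplus>k\<in>{..n}. add_pow R (n choose Suc k) (v (Suc k))) \<oplus> add_pow R (n choose 0) (v 0)) =
     ((\<Oplus>k\<in>{..n}. add_pow R (n choose k) (v (Suc k))) \<oplus> (\<Oplus>k\<in>{..n}. add_pow R (n choose Suc k) (v (Suc k)))) \<oplus> add_pow R (n choose 0) (v 0)"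
    using u by (intro a_assoc[symmetric] finsum_closed) (auto)
  also have "(\<Oplus>k\<in>{..n}. add_pow R (n choose k) (v (Suc k))) \<oplus> (\<Oplus>k\<in>{..n}. add_pow R (n choose Suc k) (v (Suc k))) =
     (\<Oplus>k\<in>{..n}. add_pow R (n choose k) (v (Suc k)) \<oplus> add_pow R (n choose Suc k) (v (Suc k)))"
    using u by (intro finsum_addf[symmetric]) (auto)
  also have "\<dots> = (\<Oplus>k\<in>{..n}. add_pow R (Suc n choose Suc k) (v (Suc k)))"
    using u by (intro finsum_cong') (auto simp: add.nat_pow_mult)
  also have "add_pow R (n choose 0) (v 0) = add_pow R (Suc n choose 0) (v 0)" by simp
  also have "(\<Oplus>k\<in>{..n}. add_pow R (Suc n choose Suc k) (v (Suc k))) \<oplus> add_pow R (Suc n choose 0) (v 0) = (\<Oplus>k\<in>{..Suc n}. add_pow R (Suc n choose k) (v k))"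
    using u by (intro finsum_Suc2[symmetric]) auto
  finally show ?case unfolding v_def .
qed

text \<open>The additive group of the subfield with \<open>p\<close> elements has order \<open>p\<close>, which therefore annihilates \<open>1\<close>.\<close>

lemma (in cring) prime_char_times_eq_zero:
  assumes "has_prime_char R p" "x \<in> carrier R"
  shows "add_pow R p x = \<zero>"
proof -
  obtain K where K: "subfield K R" "card K = p" using assms(1) by (auto simp: has_prime_char_def)
  interpret K: subfield K R by (rule K(1))
  have sg: "subgroup K (add_monoid R)" by (rule K.subgroup_axioms)
  interpret G: group "(add_monoid R)\<lparr>carrier := K\<rparr>"
    by (rule subgroup.subgroup_is_group[OF sg add.group_axioms])
  have "\<one> [^]\<^bsub>(add_monoid R)\<lparr>carrier := K\<rparr>\<^esub> order ((add_monoid R)\<lparr>carrier := K\<rparr>) = \<zero>"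
    using G.pow_order_eq_1[of \<one>] by simp
  hence 1: "add_pow R p \<one> = \<zero>"
    unfolding order_def using K(2) by (simp add: add_pow_def nat_pow_def)
  have "add_pow R p x = (add_pow R p \<one>) \<otimes> x" using assms(2) add_pow_ldistr[of \<one> x p] by simp
  thus ?thesis using 1 assms(2) by simp
qed

lemma (in cring) frobenius_add_prime:
  assumes p: "has_prime_char R p" and x: "x \<in> carrier R" and y: "y \<in> carrier R"
  shows "(x \<oplus> y) [^] p = x [^] p \<oplus> y [^] p"
proof -
  have prime: "Factorial_Ring.prime p" using p by (simp add: has_prime_char_def)
  hence p0: "0 < p" by (rule prime_gt_0_nat)
  let ?t = "\<lambda>k. add_pow R (p choose k) (x [^] k \<otimes> y [^] (p - k))"
  have t: "?t k \<in> carrier R" for k using x y by simp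
  have mid: "?t k = \<zero>" if "k \<in> {..p}" "k \<notin> {0, p}" for k
  proof -
    have "p dvd (p choose k)" using that prime by (intro dvd_choose_prime) auto
    then obtain m where m: "p choose k = p * m" by blast
    have "?t k = add_pow R m (add_pow R p (x [^] k \<otimes> y [^] (p - k)))"
      unfolding m using x y by (simp add: add.nat_pow_pow)
    thus ?thesis using prime_char_times_eq_zero[OF p, of "x [^] k \<otimes> y [^] (p - k)"] x y by simp
  qed
  have "(x \<oplus> y) [^] p = (\<Oplus>k\<in>{..p}. ?t k)" by (rule binomial_expansion[OF x y])
  also have "\<dots> = (\<Oplus>k\<in>{0, p}. ?t k)"
    using t mid by (intro add.finprod_mono_neutral_cong_right) auto
  also have "\<dots> = ?t 0 \<oplus> ?t p"
  proof -
    have "(\<Oplus>k\<in>insert 0 {p}. ?t k) = ?t 0 \<oplus> (\<Oplus>k\<in>{p}. ?t k)"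
      by (rule finsum_insert) (use t p0 in blast)+
    also have "(\<Oplus>k\<in>{p}. ?t k) = ?t p"
    proof -
      have "(\<Oplus>k\<in>{a}. f k) = f a" if "f a \<in> carrier R" for a :: nat and f
        using finsum_insert[of "{}" a f] that by simp
      from this[of ?t p, OF t] show ?thesis .
    qed
    finally show ?thesis .
  qed
  also have "\<dots> = x [^] p \<oplus> y [^] p" using x y by (simp add: a_comm)
  finally show ?thesis .
qed

lemma (in cring) frobenius_add:
  assumes p: "has_prime_char R p" and x: "x \<in> carrier R" and y: "y \<in> carrier R"
  shows "(x \<oplus> y) [^] (p ^ e) = x [^] (p ^ e) \<oplus> y [^] (p ^ e)"
proof (induction e)
  case 0 thus ?case using x y by simp
next
  case (Suc e)
  have pw: "z [^] (p ^ Suc e) = (z [^] (p ^ e)) [^] p" if "z \<in> carrier R" for z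
    using that by (simp add: nat_pow_pow mult.commute)
  show ?case using pw x y Suc frobenius_add_prime[OF p, of "x [^] (p ^ e)" "y [^] (p ^ e)"] by simp
qed

lemma (in cring) frobenius_preimage_ideal:
  fixes q :: nat
  assumes add: "\<And>x y. x \<in> carrier R \<Longrightarrow> y \<in> carrier R \<Longrightarrow> (x \<oplus> y) [^] q = x [^] q \<oplus> y [^] q"
    and q: "0 < q" and L: "ideal L R"
  shows "ideal {x \<in> carrier R. x [^] q \<in> L} R"
proof -
  interpret L: ideal L R by (rule L)
  let ?K = "{x \<in> carrier R. x [^] q \<in> L}"
  have sm: "s \<otimes> x \<in> ?K" if "s \<in> carrier R" "x \<in> ?K" for s x
    using that by (simp add: nat_pow_distrib L.I_l_closed)
  show ?thesis
  proof (rule idealI[OF ring_axioms])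
    show "subgroup ?K (add_monoid R)"
    proof (rule add.subgroupI)
      have "\<zero> [^] q = \<zero>" using q by (cases q) simp_all
      hence "\<zero> \<in> ?K" using L.zero_closed by simp
      thus "?K \<noteq> {}" by blast
      show "\<ominus> x \<in> ?K" if "x \<in> ?K" for x
        using sm[of "\<ominus> \<one>" x] that by (simp add: l_minus)
      show "x \<oplus> y \<in> ?K" if "x \<in> ?K" "y \<in> ?K" for x y using that add by simp
    qed blast
  next
    fix x s assume x: "x \<in> ?K" "s \<in> carrier R"
    show "s \<otimes> x \<in> ?K" by (rule sm[OF x(2,1)])
    thus "x \<otimes> s \<in> ?K" using x by (simp add: m_comm)
  qed
qed

section \<open>Minimal resolutions of modules of finite projective dimension\<close>

lemma (in cring) quot_module_coset:
  assumes "ideal I R" "r \<in> carrier R"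
  shows "I +> r \<in> carrier (quot_module R I)" "I +> r = \<zero>\<^bsub>quot_module R I\<^esub> \<longleftrightarrow> r \<in> I"
    "s \<in> carrier R \<Longrightarrow> (I +> r) \<oplus>\<^bsub>quot_module R I\<^esub> (I +> s) = I +> (r \<oplus> s)"
    "s \<in> carrier R \<Longrightarrow> r \<odot>\<^bsub>quot_module R I\<^esub> (I +> s) = I +> (r \<otimes> s)"
proof -
  interpret I: ideal I R by fact
  note h = I.rcos_ring_hom
  show "I +> r \<in> carrier (quot_module R I)"
    "s \<in> carrier R \<Longrightarrow> (I +> r) \<oplus>\<^bsub>quot_module R I\<^esub> (I +> s) = I +> (r \<oplus> s)"
    "s \<in> carrier R \<Longrightarrow> r \<odot>\<^bsub>quot_module R I\<^esub> (I +> s) = I +> (r \<otimes> s)"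
    using assms ring_hom_add[OF h] ring_hom_mult[OF h] ring_hom_closed[OF h]
    by (simp_all add: quot_module_def)
  have z: "\<zero>\<^bsub>quot_module R I\<^esub> = I" by (simp add: quot_module_def FactRing_def)
  show "I +> r = \<zero>\<^bsub>quot_module R I\<^esub> \<longleftrightarrow> r \<in> I"
    unfolding z using I.rcos_const_imp_mem[OF assms(2)] a_rcos_zero[OF assms(1)] by blast
qed

text \<open>Comparison maps \<open>\<alpha>\<close> and \<open>\<beta>\<close> between the minimal and the projective resolution. In each degree
  \<open>H = id - \<beta> \<alpha> - h D\<close>, where \<open>h\<close> lifts the \<open>H\<close> of the previous degree; lifting is possible because \<open>H\<close> takes
  values in the syzygy module, and that is preserved. On \<open>N i\<close>, the kernel of the preceding differential, the
  last term vanishes.\<close>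

lemma (in minimal_free_resolution) projective_comparison:
  fixes P :: "nat \<Rightarrow> ('a, 'p) module"
  assumes res: "projective_resolution R (quot_module R I) n P \<delta> \<epsilon>"
  defines "B \<equiv> \<lambda>i. \<delta> i ` carrier (P (Suc i))"
  shows "\<exists>\<alpha> \<beta> H. \<alpha> \<in> mod_hom R (F i) (P i) \<and> \<beta> \<in> mod_hom R (P i) (F i) \<and>
    H \<in> mod_hom R (F i) (F i) \<and> H ` carrier (F i) \<subseteq> N i \<and>
    (\<forall>f\<in>N i. H f = f \<ominus>\<^bsub>F i\<^esub> \<beta> (\<alpha> f)) \<and> \<alpha> ` N i \<subseteq> B i \<and> \<beta> ` B i \<subseteq> N i"
proof (induction i)
  have Pproj: "projective_module R (P i)" for i using res by (simp add: projective_resolution_def)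
  have MP: "module R (P i)" for i using Pproj by (simp add: projective_module_def)
  have \<delta>: "\<delta> i \<in> mod_hom R (P (Suc i)) (P i)" for i using res by (simp add: projective_resolution_def)
  have \<epsilon>: "\<epsilon> \<in> mod_hom R (P 0) (quot_module R I)" "\<epsilon> ` carrier (P 0) = carrier (quot_module R I)"
    using res by (simp_all add: projective_resolution_def)
  have B0: "B 0 = {x \<in> carrier (P 0). \<epsilon> x = \<zero>\<^bsub>quot_module R I\<^esub>}"
    using res by (simp add: projective_resolution_def B_def)
  have BS: "B (Suc i) = {x \<in> carrier (P (Suc i)). \<delta> i x = \<zero>\<^bsub>P i\<^esub>}" for i
    using res by (simp add: projective_resolution_def B_def)
  {
    case 0
    let ?Q = "quot_module R I"
    let ?\<pi> = "\<lambda>f. I +> (f 0)"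
    note q = quot_module_coset[OF ideal_I]
    have Q: "module R ?Q" by (rule module_quot[OF ideal_I])
    interpret F0: module R "F 0" by (rule module_F)
    interpret Q: module R ?Q by (rule Q)
    have F0r: "f i \<in> carrier R" if "f \<in> carrier (F 0)" for f i using that by (simp add: free_mod_simps)
    have \<pi>: "?\<pi> \<in> mod_hom R (F 0) ?Q"
      unfolding mod_hom_def Pi_iff using F0r q by (simp add: free_mod_simps)
    have surj: "?\<pi> ` carrier (F 0) = carrier ?Q"
    proof
      show "?\<pi> ` carrier (F 0) \<subseteq> carrier ?Q" using mod_hom_closed[OF \<pi>] by blast
      show "carrier ?Q \<subseteq> ?\<pi> ` carrier (F 0)"
      proof
        fix x assume "x \<in> carrier ?Q"
        hence "x \<in> (\<lambda>r. I +> r) ` carrier R"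
          unfolding quot_module_def using ideal.quot_carrier[OF ideal_I] by simp
        then obtain r where r: "r \<in> carrier R" "x = I +> r" by blast
        show "x \<in> ?\<pi> ` carrier (F 0)"
          by (rule image_eqI[of _ _ "\<lambda>i. if i = 0 then r else \<zero>"])
            (use r rank_0 in \<open>auto simp: free_mod_simps\<close>)
      qed
    qed
    have N0: "N 0 = {f \<in> carrier (F 0). ?\<pi> f = \<zero>\<^bsub>?Q\<^esub>}"
      unfolding N_0 using q(2) F0r by blast
    have "?\<pi> ` carrier (F 0) \<subseteq> \<epsilon> ` carrier (P 0)" using surj \<epsilon>(2) by simp
    from free_mod_lift[OF MP Q \<epsilon>(1) \<pi> this] obtain \<alpha>
      where \<alpha>: "\<alpha> \<in> mod_hom R (F 0) (P 0)" "\<forall>f\<in>carrier (F 0). \<epsilon> (\<alpha> f) = ?\<pi> f" by (rule bexE)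
    note \<alpha> = \<alpha>(1) \<alpha>(2)[rule_format]
    from projective_lift[OF Pproj module_F Q \<pi> surj \<epsilon>(1)] obtain \<beta>
      where \<beta>: "\<beta> \<in> mod_hom R (P 0) (F 0)" "\<forall>x\<in>carrier (P 0). ?\<pi> (\<beta> x) = \<epsilon> x" by (rule bexE)
    note \<beta> = \<beta>(1) \<beta>(2)[rule_format]
    have idh: "(\<lambda>f. f) \<in> mod_hom R (F 0) (F 0)" by (simp add: mod_hom_def)
    let ?H = "\<lambda>f. f \<ominus>\<^bsub>F 0\<^esub> \<beta> (\<alpha> f)"
    have H: "?H \<in> mod_hom R (F 0) (F 0)"
      by (rule mod_hom_minus_fun[OF module_F module_F idh mod_hom_comp[OF \<alpha>(1) \<beta>(1)]])
    have "?H f \<in> N 0" if f: "f \<in> carrier (F 0)" for f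
    proof -
      have ba: "\<alpha> f \<in> carrier (P 0)" "\<beta> (\<alpha> f) \<in> carrier (F 0)"
        using mod_hom_closed[OF \<alpha>(1) f] mod_hom_closed[OF \<beta>(1)] by blast+
      have "?\<pi> (?H f) = ?\<pi> f \<ominus>\<^bsub>?Q\<^esub> ?\<pi> (\<beta> (\<alpha> f))" by (rule mod_hom_minus[OF module_F Q \<pi> f ba(2)])
      also have "\<dots> = \<zero>\<^bsub>?Q\<^esub>"
        unfolding \<beta>(2)[OF ba(1)] \<alpha>(2)[OF f] using mod_hom_closed[OF \<pi> f] by (simp add: a_minus_def Q.M.r_neg)
      finally show ?thesis unfolding N0 using mod_hom_closed[OF H f] by blast
    qed
    moreover have "\<alpha> ` N 0 \<subseteq> B 0" unfolding N0 B0 using \<alpha> mod_hom_closed[OF \<alpha>(1)] by auto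
    moreover have "\<beta> ` B 0 \<subseteq> N 0" unfolding N0 B0 using \<beta> mod_hom_closed[OF \<beta>(1)] by auto
    ultimately show ?case using \<alpha>(1) \<beta>(1) H by blast
  next
    case (Suc i)
    then obtain \<alpha> \<beta> H where \<alpha>: "\<alpha> \<in> mod_hom R (F i) (P i)" and \<beta>: "\<beta> \<in> mod_hom R (P i) (F i)"
      and H: "H \<in> mod_hom R (F i) (F i)" "H ` carrier (F i) \<subseteq> N i"
      "\<forall>f\<in>N i. H f = f \<ominus>\<^bsub>F i\<^esub> \<beta> (\<alpha> f)" and \<alpha>N: "\<alpha> ` N i \<subseteq> B i" and \<beta>B: "\<beta> ` B i \<subseteq> N i"
      by (elim exE conjE) (rule that; assumption)
    let ?F = "F (Suc i)" and ?P = "P (Suc i)"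
    interpret F: module R "F i" by (rule module_F)
    interpret FS: module R ?F by (rule module_F)
    have DN: "D i f \<in> N i" if "f \<in> carrier ?F" for f using that unfolding N_eq by blast
    have \<alpha>D: "(\<lambda>f. \<alpha> (D i f)) \<in> mod_hom R ?F (P i)" by (rule mod_hom_comp[OF D_hom \<alpha>])
    have "(\<lambda>f. \<alpha> (D i f)) ` carrier ?F \<subseteq> \<delta> i ` carrier ?P" using DN \<alpha>N unfolding B_def by blast
    from free_mod_lift[OF MP MP \<delta> \<alpha>D this] obtain \<alpha>'
      where \<alpha>': "\<alpha>' \<in> mod_hom R ?F ?P" "\<forall>f\<in>carrier ?F. \<delta> i (\<alpha>' f) = \<alpha> (D i f)" by (rule bexE)
    note \<alpha>' = \<alpha>'(1) \<alpha>'(2)[rule_format]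
    \<comment> \<open>\<open>D i\<close> is surjective only onto the syzygy module, so \<open>\<beta>\<close> must be lifted with that as target.\<close>
    let ?L = "F i\<lparr>carrier := N i\<rparr>"
    have L: "module R ?L" by (rule submodule.submodule_is_module[OF N_submodule module_F])
    have DL: "D i \<in> mod_hom R ?F ?L" using D_hom DN by (intro mod_hom_subset) auto
    have DLs: "D i ` carrier ?F = carrier ?L" unfolding N_eq by simp
    have "(\<lambda>x. \<beta> (\<delta> i x)) \<in> mod_hom R ?P ?L"
      using mod_hom_comp[OF \<delta> \<beta>] \<beta>B unfolding B_def by (intro mod_hom_subset) auto
    from projective_lift[OF Pproj module_F L DL DLs this] obtain \<beta>'
      where \<beta>': "\<beta>' \<in> mod_hom R ?P ?F" "\<forall>x\<in>carrier ?P. D i (\<beta>' x) = \<beta> (\<delta> i x)" by (rule bexE)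
    note \<beta>' = \<beta>'(1) \<beta>'(2)[rule_format]
    have "H ` carrier (F i) \<subseteq> D i ` carrier ?F" using H(2) unfolding N_eq .
    from free_mod_lift[OF module_F module_F D_hom H(1) this] obtain h
      where h: "h \<in> mod_hom R (F i) ?F" "\<forall>f\<in>carrier (F i). D i (h f) = H f" by (rule bexE)
    note h = h(1) h(2)[rule_format]
    let ?G = "\<lambda>f. f \<ominus>\<^bsub>?F\<^esub> \<beta>' (\<alpha>' f)"
    let ?H = "\<lambda>f. ?G f \<ominus>\<^bsub>?F\<^esub> h (D i f)"
    have idh: "(\<lambda>f. f) \<in> mod_hom R ?F ?F" by (simp add: mod_hom_def)
    have G: "?G \<in> mod_hom R ?F ?F"
      by (rule mod_hom_minus_fun[OF module_F module_F idh mod_hom_comp[OF \<alpha>'(1) \<beta>'(1)]])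
    have H': "?H \<in> mod_hom R ?F ?F"
      by (rule mod_hom_minus_fun[OF module_F module_F G mod_hom_comp[OF D_hom h(1)]])
    have "?H f \<in> N (Suc i)" if f: "f \<in> carrier ?F" for f
    proof -
      note Df = mod_hom_closed[OF D_hom f] and af = mod_hom_closed[OF \<alpha>'(1) f]
      note baf = mod_hom_closed[OF \<beta>'(1) af] and Gf = mod_hom_closed[OF G f]
      note hDf = mod_hom_closed[OF h(1) Df]
      have e: "D i (?G f) = D i f \<ominus>\<^bsub>F i\<^esub> \<beta> (\<alpha> (D i f))"
        unfolding mod_hom_minus[OF module_F module_F D_hom f baf] \<beta>'(2)[OF af] \<alpha>'(2)[OF f] ..
      have "D i (?H f) = D i (?G f) \<ominus>\<^bsub>F i\<^esub> H (D i f)"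
        unfolding mod_hom_minus[OF module_F module_F D_hom Gf hDf] h(2)[OF Df] ..
      also have "H (D i f) = D i (?G f)" using H(3) DN[OF f] e by simp
      finally have "D i (?H f) = \<zero>\<^bsub>F i\<^esub>"
        using mod_hom_closed[OF D_hom Gf] by (simp add: a_minus_def F.M.r_neg)
      thus ?thesis unfolding exact using mod_hom_closed[OF H' f] by blast
    qed
    moreover have "?H f = ?G f" if f: "f \<in> N (Suc i)" for f
    proof -
      have fc: "f \<in> carrier ?F" and z: "D i f = \<zero>\<^bsub>F i\<^esub>" using f unfolding exact by auto
      show ?thesis unfolding z mod_hom_zero[OF module_F module_F h(1)]
        using mod_hom_closed[OF G fc] by (simp add: a_minus_def)
    qed
    moreover have "\<alpha>' ` N (Suc i) \<subseteq> B (Suc i)"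
    proof
      fix x assume "x \<in> \<alpha>' ` N (Suc i)"
      then obtain f where f: "f \<in> carrier ?F" "D i f = \<zero>\<^bsub>F i\<^esub>" "x = \<alpha>' f" unfolding exact by blast
      have "\<delta> i x = \<zero>\<^bsub>P i\<^esub>" unfolding f(3) \<alpha>'(2)[OF f(1)] f(2) by (rule mod_hom_zero[OF module_F MP \<alpha>])
      thus "x \<in> B (Suc i)" unfolding BS using mod_hom_closed[OF \<alpha>'(1) f(1)] f(3) by blast
    qed
    moreover have "\<beta>' ` B (Suc i) \<subseteq> N (Suc i)"
    proof
      fix y assume "y \<in> \<beta>' ` B (Suc i)"
      then obtain x where x: "x \<in> carrier ?P" "\<delta> i x = \<zero>\<^bsub>P i\<^esub>" "y = \<beta>' x" unfolding BS by blast
      have "D i y = \<zero>\<^bsub>F i\<^esub>" unfolding x(3) \<beta>'(2)[OF x(1)] x(2) by (rule mod_hom_zero[OF MP module_F \<beta>])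
      thus "y \<in> N (Suc i)" unfolding exact using mod_hom_closed[OF \<beta>'(1) x(1)] x(3) by blast
    qed
    ultimately show ?case using \<alpha>'(1) \<beta>'(1) H' by blast
  }
qed

text \<open>Beyond the length of the projective resolution \<open>\<alpha> = 0\<close>, so \<open>H\<close> is the identity on \<open>N (Suc n)\<close>. A column
  \<open>D e\<close> has entries in the maximal ideal, so applying \<open>H\<close> to its expansion in unit vectors yields
  \<open>D e = D w\<close> for some \<open>w\<close> with entries in the maximal ideal. By minimality the first component \<open>1\<close> of
  \<open>e\<close> would lie there as well. Hence there are no columns.\<close>

lemma (in minimal_free_resolution) finite_length:
  fixes P :: "nat \<Rightarrow> ('a, 'p) module"
  assumes res: "projective_resolution R (quot_module R I) n P \<delta> \<epsilon>"
  shows "N (Suc n) = {\<zero>\<^bsub>F (Suc n)\<^esub>}"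
proof -
  let ?n = "Suc n"
  obtain \<alpha> \<beta> H where \<alpha>: "\<alpha> \<in> mod_hom R (F ?n) (P ?n)" and \<beta>: "\<beta> \<in> mod_hom R (P ?n) (F ?n)"
    and H: "H \<in> mod_hom R (F ?n) (F ?n)" "H ` carrier (F ?n) \<subseteq> N ?n"
    "\<forall>f\<in>N ?n. H f = f \<ominus>\<^bsub>F ?n\<^esub> \<beta> (\<alpha> f)"
    using projective_comparison[OF res, of ?n] by (elim exE conjE) (rule that; assumption)
  have P0: "carrier (P ?n) = {\<zero>\<^bsub>P ?n\<^esub>}" using res by (simp add: projective_resolution_def)
  have MP: "module R (P ?n)" using res by (simp add: projective_resolution_def projective_module_def)
  interpret F: module R "F ?n" by (rule module_F)
  interpret FS: module R "F (Suc ?n)" by (rule module_F)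
  have Nc: "f \<in> carrier (F ?n)" if "f \<in> N ?n" for f
    using that F.submoduleE(1)[OF N_submodule] by blast
  have Hid: "H f = f" if f: "f \<in> N ?n" for f
  proof -
    have "\<alpha> f = \<zero>\<^bsub>P ?n\<^esub>" using mod_hom_closed[OF \<alpha> Nc[OF f]] P0 by simp
    thus ?thesis using H(3) f mod_hom_zero[OF MP module_F \<beta>] Nc[OF f] by (simp add: a_minus_def)
  qed
  have "b (Suc ?n) = 0"
  proof (rule ccontr)
    assume "b (Suc ?n) \<noteq> 0"
    hence b: "0 < b (Suc ?n)" by simp
    let ?e = "unit_vec R 0" and ?a = "a ?n 0"
    have e: "?e \<in> carrier (F (Suc ?n))" by (rule unit_vec_closed[OF b])
    have De: "D ?n ?e = ?a" by (rule D_unit_vec[OF b])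
    have aN: "?a \<in> N ?n" unfolding N_eq De[symmetric] using e by blast
    have am: "?a j \<in> \<mm>" for j by (rule column_in_max[OF b])
    have ar: "?a j \<in> carrier R" for j using am by (rule max_carrier)
    have "\<forall>j\<in>{..<b ?n}. \<exists>g\<in>carrier (F (Suc ?n)). D ?n g = H (unit_vec R j)"
    proof
      fix j assume "j \<in> {..<b ?n}"
      hence "unit_vec R j \<in> carrier (F ?n)" by (simp add: unit_vec_closed)
      hence "H (unit_vec R j) \<in> D ?n ` carrier (F (Suc ?n))" using H(2) unfolding N_eq by blast
      thus "\<exists>g\<in>carrier (F (Suc ?n)). D ?n g = H (unit_vec R j)" by (metis imageE)
    qed
    then obtain g where g: "\<And>j. j < b ?n \<Longrightarrow> g j \<in> carrier (F (Suc ?n))"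
      "\<And>j. j < b ?n \<Longrightarrow> D ?n (g j) = H (unit_vec R j)" by (metis lessThan_iff)
    let ?w = "lincomb (F (Suc ?n)) g ?a (b ?n)"
    have wc: "?w \<in> carrier (F (Suc ?n))" by (rule FS.lincomb_closed[OF g(1) ar])
    have "D ?n ?w = lincomb (F ?n) (\<lambda>j. D ?n (g j)) ?a (b ?n)"
      by (rule mod_hom_lincomb[OF module_F module_F D_hom g(1) ar])
    also have "\<dots> = lincomb (F ?n) (\<lambda>j. H (unit_vec R j)) ?a (b ?n)" by (rule F.lincomb_cong[OF g(2)])
    also have "\<dots> = H (lincomb (F ?n) (unit_vec R) ?a (b ?n))"
      by (rule mod_hom_lincomb[OF module_F module_F H(1) unit_vec_closed ar, symmetric])
    also have "\<dots> = ?a" using lincomb_unit_vecs[OF Nc[OF aN]] Hid[OF aN] by simp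
    finally have "D ?n (?e \<ominus>\<^bsub>F (Suc ?n)\<^esub> ?w) = \<zero>\<^bsub>F ?n\<^esub>"
      using mod_hom_minus[OF module_F module_F D_hom e wc] De Nc[OF aN] by (simp add: a_minus_def F.M.r_neg)
    hence "?e \<ominus>\<^bsub>F (Suc ?n)\<^esub> ?w \<in> N (Suc ?n)" unfolding exact using e wc by simp
    hence "(?e \<ominus>\<^bsub>F (Suc ?n)\<^esub> ?w) 0 \<in> \<mm>" by (rule minimal)
    hence 1: "\<one> \<ominus> ?w 0 \<in> \<mm>" unfolding free_mod_minus[OF e wc] by (simp add: unit_vec_def)
    \<comment> \<open>The coefficients of \<open>?w\<close> are the entries of a column, which lie in \<open>\<mm>\<close>.\<close>
    have "lincomb (F (Suc ?n)) g ?a k i \<in> \<mm>" if "k \<le> b ?n" for k i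
      using that
    proof (induction k)
      case 0 thus ?case using max.zero_closed by (simp add: free_mod_simps)
    next
      case (Suc k)
      have "g k i \<in> carrier R" using g(1)[of k] Suc.prems by (simp add: free_mod_simps)
      thus ?case using Suc am[of k] by (simp add: free_mod_simps max.I_r_closed)
    qed
    hence w0: "?w 0 \<in> \<mm>" by simp
    have "(\<one> \<ominus> ?w 0) \<oplus> ?w 0 \<in> \<mm>" using 1 w0 by (rule max.a_closed)
    moreover have "(\<one> \<ominus> ?w 0) \<oplus> ?w 0 = \<one>" by (rule add_minus_cancel(2)[OF one_closed max_carrier[OF w0]])
    ultimately show False using one_notin_max by simp
  qed
  hence "carrier (F (Suc ?n)) = {\<zero>\<^bsub>F (Suc ?n)\<^esub>}" by (auto simp: free_mod_simps)
  thus ?thesis unfolding N_eq using mod_hom_zero[OF module_F module_F D_hom] by simp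
qed

text \<open>The least index of a vanishing syzygy module is the length of the resolution.\<close>

lemma (in minimal_free_resolution) exists_length:
  fixes P :: "nat \<Rightarrow> ('a, 'p) module"
  assumes "projective_resolution R (quot_module R I) n P \<delta> \<epsilon>"
  obtains l where "N l = {\<zero>\<^bsub>F l\<^esub>}" "0 < b l"
proof -
  define l where "l = (LEAST l. N l = {\<zero>\<^bsub>F l\<^esub>})"
  have l: "N l = {\<zero>\<^bsub>F l\<^esub>}" unfolding l_def by (rule LeastI, rule finite_length[OF assms])
  have "0 < b l"
  proof (cases l)
    case 0 thus ?thesis using rank_0 by simp
  next
    case (Suc i)
    show ?thesis
    proof (rule ccontr)
      assume "\<not> 0 < b l"
      hence "carrier (F (Suc i)) = {\<zero>\<^bsub>F (Suc i)\<^esub>}" unfolding Suc by (auto simp: free_mod_simps)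
      hence "N i = {\<zero>\<^bsub>F i\<^esub>}" unfolding N_eq using mod_hom_zero[OF module_F module_F D_hom] by simp
      hence "l \<le> i" unfolding l_def by (rule Least_le)
      thus False using Suc by simp
    qed
  qed
  with l show ?thesis by (rule that)
qed

section \<open>Frobenius closed regular sequences\<close>

text \<open>Translation to \<open>R\<close> of the hypothesis on the ring \<open>R/I\<close>. Powers of the given generators witness membership in the
  Frobenius power.\<close>

lemma (in cring) frobenius_closed_quot_imp:
  fixes q p e :: nat
  assumes I: "ideal I R" and us: "set us \<subseteq> carrier R" and q: "q = p ^ e"
    and closed: "frobenius_closed_seq (R Quot I) p (map (\<lambda>x. I +> x) us)"
    and u: "u \<in> carrier R" "u [^] q \<in> Idl (I \<union> (\<lambda>x. x [^] q) ` set us)"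
  shows "u \<in> Idl (I \<union> set us)"
proof -
  have zero: "\<zero>\<^bsub>R Quot I\<^esub> = I" by (simp add: FactRing_def)
  interpret I: ideal I R by (rule I)
  interpret Q: cring "R Quot I" by (rule I.quotient_is_cring[OF is_cring])
  interpret h: ring_hom_ring R "R Quot I" "(+>) I" by (rule I.rcos_ring_hom_ring)
  let ?B = "(\<lambda>x. I +> x) ` set us"
  have B: "?B \<subseteq> carrier (R Quot I)" using us h.hom_closed by blast
  let ?J = "Idl\<^bsub>R Quot I\<^esub> ?B"
  have J: "ideal ?J (R Quot I)" by (rule Q.genideal_ideal[OF B])
  have BJ: "?B \<subseteq> ?J" by (rule Q.genideal_self[OF B])
  have Jc: "x \<in> carrier (R Quot I)" if "x \<in> ?J" for x using ideal.Icarr[OF J that] .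
  let ?W = "(\<lambda>x. x [^]\<^bsub>R Quot I\<^esub> q) ` ?J"
  have W: "?W \<subseteq> carrier (R Quot I)" using Jc by auto
  let ?P = "Idl\<^bsub>R Quot I\<^esub> ?W"
  have P: "ideal ?P (R Quot I)" by (rule Q.genideal_ideal[OF W])
  have WP: "?W \<subseteq> ?P" by (rule Q.genideal_self[OF W])
  have pre: "ideal {r \<in> carrier R. I +> r \<in> ?P} R" by (rule h.ideal_vimage[OF P])
  have "I \<union> (\<lambda>x. x [^] q) ` set us \<subseteq> {r \<in> carrier R. I +> r \<in> ?P}"
  proof
    fix r assume "r \<in> I \<union> (\<lambda>x. x [^] q) ` set us"
    then consider "r \<in> I" | x where "x \<in> set us" "r = x [^] q" by blast
    thus "r \<in> {r \<in> carrier R. I +> r \<in> ?P}"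
    proof cases
      case 1
      have "I +> r = \<zero>\<^bsub>R Quot I\<^esub>" unfolding zero by (rule a_rcos_zero[OF I 1])
      thus ?thesis using I.Icarr[OF 1] additive_subgroup.zero_closed[OF ideal.axioms(1)[OF P]] by simp
    next
      case 2
      have xc: "x \<in> carrier R" using us 2(1) by blast
      have "I +> r = (I +> x) [^]\<^bsub>R Quot I\<^esub> q" unfolding 2(2) by (rule h.hom_nat_pow[OF xc])
      moreover have "(I +> x) [^]\<^bsub>R Quot I\<^esub> q \<in> ?P" using WP BJ 2(1) by blast
      ultimately show ?thesis using xc 2(2) by simp
    qed
  qed
  hence "Idl (I \<union> (\<lambda>x. x [^] q) ` set us) \<subseteq> {r \<in> carrier R. I +> r \<in> ?P}"
    by (rule genideal_minimal[OF pre])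
  hence "I +> (u [^] q) \<in> ?P" using u(2) by blast
  hence "(I +> u) [^]\<^bsub>R Quot I\<^esub> (p ^ e) \<in> frobenius_power (R Quot I) ?J (p ^ e)"
    using h.hom_nat_pow[OF u(1), of q] unfolding q frobenius_power_def by simp
  hence "I +> u \<in> frobenius_closure (R Quot I) p ?J"
    unfolding frobenius_closure_def using h.hom_closed[OF u(1)] by blast
  hence uJ: "I +> u \<in> ?J"
    using closed unfolding frobenius_closed_seq_def frobenius_closed_def by simp
  note L = Idl_ideal_Un[OF I us]
  have "ideal ((+>) I ` (Idl (I \<union> set us))) (R Quot I)" by (rule ring_ideal_imp_quot_ideal[OF I L(1)])
  moreover have "?B \<subseteq> (+>) I ` (Idl (I \<union> set us))" using L(3) by blast
  ultimately have "?J \<subseteq> (+>) I ` (Idl (I \<union> set us))" by (rule Q.genideal_minimal)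
  then obtain r where r: "r \<in> Idl (I \<union> set us)" "I +> u = I +> r" using uJ by blast
  have rc: "r \<in> carrier R" by (rule ideal.Icarr[OF L(1) r(1)])
  have "u \<in> I +> r" using I.a_rcos_self[OF u(1)] r(2) by simp
  then obtain i where i: "i \<in> I" "u = i \<oplus> r" unfolding a_r_coset_def' by blast
  show ?thesis unfolding i(2)
    by (rule additive_subgroup.a_closed[OF ideal.axioms(1)[OF L(1)]]) (use i(1) L(2) r(1) in blast)+
qed

context noetherian_local_ring
begin

lemma Idl_zero_Un: "A \<subseteq> carrier R \<Longrightarrow> Idl ({\<zero>} \<union> A) = Idl A"
proof -
  assume A: "A \<subseteq> carrier R"
  have "\<zero> \<in> Idl A" using genideal_ideal[OF A] by (simp add: additive_subgroup.zero_closed ideal.axioms(1))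
  hence "Idl ({\<zero>} \<union> A) \<subseteq> Idl A" using genideal_self[OF A] by (intro genideal_minimal genideal_ideal A) auto
  moreover have "Idl A \<subseteq> Idl ({\<zero>} \<union> A)" using A by (intro Idl_mono) auto
  ultimately show ?thesis by blast
qed

text \<open>By additivity, the \<open>q\<close>-th powers of generators generate the Frobenius power of an ideal.\<close>

lemma pow_mem_Idl_pow:
  fixes q :: nat
  assumes add: "\<And>x y. x \<in> carrier R \<Longrightarrow> y \<in> carrier R \<Longrightarrow> (x \<oplus> y) [^] q = x [^] q \<oplus> y [^] q"
    and q: "0 < q" and A: "A \<subseteq> carrier R" and x: "x \<in> Idl A"
  shows "x [^] q \<in> Idl ((\<lambda>x. x [^] q) ` A)"
proof -
  have B: "(\<lambda>x. x [^] q) ` A \<subseteq> carrier R" using A by auto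
  have "ideal {x \<in> carrier R. x [^] q \<in> Idl ((\<lambda>x. x [^] q) ` A)} R"
    by (rule frobenius_preimage_ideal[OF add q genideal_ideal[OF B]])
  moreover have "A \<subseteq> {x \<in> carrier R. x [^] q \<in> Idl ((\<lambda>x. x [^] q) ` A)}"
    using genideal_self[OF B] A by blast
  ultimately have "Idl A \<subseteq> {x \<in> carrier R. x [^] q \<in> Idl ((\<lambda>x. x [^] q) ` A)}" by (rule genideal_minimal)
  thus ?thesis using x by blast
qed

text \<open>Let \<open>Y\<close> be the ideal generated by the sequence. Since \<open>\<mm>\<close> is the only prime containing \<open>Y\<close>, a counterexample
  \<open>u\<close> yields one, \<open>v\<close>, that represents a socle element of \<open>R/Y\<close>: a maximal annihilator modulo \<open>Y\<close> within the
  Frobenius closure is a prime containing \<open>Y\<close>. After adapting the sequence to \<open>I\<close>, the zigzag produces an element that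
  contradicts the hypothesis for the maximal regular sequence \<open>us\<close> on \<open>R/I\<close>.\<close>

lemma full_regular_sequence_frobenius_closed:
  fixes q :: nat and P :: "nat \<Rightarrow> ('a, 'p) module"
  assumes p: "has_prime_char R p" and q: "q = p ^ e" and dim: "krull_dim R = enat d"
    and I: "ideal I R" "I \<noteq> carrier R"
    and res: "projective_resolution R (quot_module R I) n P \<delta> \<epsilon>"
    and closed: "\<And>us. maximal_regular_seq R \<mm> (quot_module R I) us \<Longrightarrow>
      frobenius_closed_seq (R Quot I) p (map (\<lambda>x. I +> x) us)"
    and xs: "set xs \<subseteq> \<mm>" "regular_mod R {\<zero>} xs" "length xs = d"
    and u: "u \<in> carrier R" "u [^] q \<in> Idl ((\<lambda>x. x [^] q) ` set xs)"
  shows "u \<in> Idl (set xs)"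
proof (rule ccontr)
  assume "u \<notin> Idl (set xs)"
  have q0: "0 < q" using p by (simp add: q has_prime_char_def prime_gt_0_nat)
  have add: "(x \<oplus> y) [^] q = x [^] q \<oplus> y [^] q" if "x \<in> carrier R" "y \<in> carrier R" for x y
    unfolding q by (rule frobenius_add[OF p that])
  have only: "Q = \<mm>" if "primeideal Q R" "{\<zero>} \<union> set xs \<subseteq> Q" for Q
    by (rule prime_over_full_regular_mod_eq_max[OF dim zeroideal xs that])
  have "\<exists>us ws. length (us @ ws) = length xs \<and> set (us @ ws) \<subseteq> \<mm> \<and>
    Idl ({\<zero>} \<union> set (us @ ws)) = Idl ({\<zero>} \<union> set xs) \<and> regular_mod R {\<zero>} (us @ ws) \<and>
    regular_mod R I us \<and> depth_zero_mod R \<mm> (Idl (I \<union> set us))"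
  proof (rule regular_mod_adapt[OF zeroideal I(1) _ xs(1,2) I(2)])
    show "{\<zero>} \<subseteq> I" using I(1) by (simp add: additive_subgroup.zero_closed ideal.axioms(1))
  qed (rule only)
  then obtain us ws where uw: "length (us @ ws) = length xs" "set (us @ ws) \<subseteq> \<mm>"
    "Idl ({\<zero>} \<union> set (us @ ws)) = Idl ({\<zero>} \<union> set xs)" "regular_mod R {\<zero>} (us @ ws)"
    "regular_mod R I us" "depth_zero_mod R \<mm> (Idl (I \<union> set us))" by blast
  define ys where "ys = us @ ws"
  note xc = set_carrier[OF xs(1)]
  have ysm: "set ys \<subseteq> \<mm>" and usm: "set us \<subseteq> \<mm>" using uw(2) by (auto simp: ys_def)
  note yc = set_carrier[OF ysm] and uc = set_carrier[OF usm]
  have Ieq: "Idl (set ys) = Idl (set xs)"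
    using uw(3) unfolding ys_def[symmetric] Idl_zero_Un[OF yc] Idl_zero_Un[OF xc] .
  let ?Y = "Idl (set ys)" and ?pw = "\<lambda>x. x [^] q"
  have Y: "ideal ?Y R" by (rule genideal_ideal[OF yc])
  have yqc: "?pw ` set ys \<subseteq> carrier R" and xqc: "?pw ` set xs \<subseteq> carrier R" using yc xc by auto
  \<comment> \<open>The Frobenius power depends on the ideal, not on the choice of its generators.\<close>
  have "Idl (?pw ` set xs) \<subseteq> Idl (?pw ` set ys)"
  proof (rule genideal_minimal[OF genideal_ideal[OF yqc]])
    show "?pw ` set xs \<subseteq> Idl (?pw ` set ys)"
      using pow_mem_Idl_pow[OF add q0 yc] Ieq genideal_self[OF xc] by blast
  qed
  hence uq: "u [^] q \<in> Idl (?pw ` set ys)" using u(2) by blast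
  \<comment> \<open>Counterexamples with maximal annihilator are sought in the ideal \<open>?K\<close>.\<close>
  let ?K = "{x \<in> carrier R. x [^] q \<in> Idl (?pw ` set ys)}"
  have K: "ideal ?K R" by (rule frobenius_preimage_ideal[OF add q0 genideal_ideal[OF yqc]])
  have uK: "u \<in> ?K" "u \<notin> ?Y" using u(1) uq \<open>u \<notin> Idl (set xs)\<close> Ieq by auto
  have Kc: "?K \<subseteq> carrier R" by blast
  have "r \<otimes> k \<in> ?K" if "r \<in> carrier R" "k \<in> ?K" for r k by (rule ideal.I_l_closed[OF K that(2,1)])
  then obtain v where v: "v \<in> ?K" "v \<notin> ?Y" "primeideal (colon R ?Y v) R"
    by (rule maximal_annihilator_prime[OF is_cring Y Kc _ uK])
  have vc: "v \<in> carrier R" using v(1) by blast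
  have "{\<zero>} \<union> set xs \<subseteq> colon R ?Y v"
  proof -
    have "set xs \<subseteq> ?Y" using genideal_self[OF xc] Ieq by simp
    hence "{\<zero>} \<union> set xs \<subseteq> ?Y" using Y by (simp add: additive_subgroup.zero_closed ideal.axioms(1))
    thus ?thesis using ideal.I_r_closed[OF Y _ vc] ideal.Icarr[OF Y] unfolding colon_def by blast
  qed
  hence colon: "colon R ?Y v = \<mm>" by (rule only[OF v(3)])
  have socle: "x \<otimes> v \<in> ?Y" if "x \<in> \<mm>" for x using that unfolding colon[symmetric] colon_def by blast
  obtain b a where "minimal_free_resolution R \<mm> I b a" by (rule exists_minimal_free_resolution[OF I])
  then interpret res: minimal_free_resolution R \<mm> I b a
    "\<lambda>i f. lincomb (free_mod R (b i)) (a i) f (b (Suc i))"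
    "\<lambda>i. (\<lambda>f. lincomb (free_mod R (b i)) (a i) f (b (Suc i))) ` carrier (free_mod R (b (Suc i)))" by simp_all
  let ?y = "\<lambda>i. ys ! i" and ?t = "length us"
  have len: "length ys = d" using uw(1) xs(3) by (simp add: ys_def)
  have tk: "?y ` {..<k} = set (take k ys)" if "k \<le> d" for k
    using nth_image[of k ys] that len by (simp add: atLeast0LessThan)
  have tkq: "(\<lambda>i. ys ! i [^] q) ` {..<k} = set (take k (map ?pw ys))" if "k \<le> d" for k
    by (simp only: take_map set_map tk[OF that, symmetric] image_image)
  have tku: "take k ys = take k us" if "k \<le> ?t" for k using that by (simp add: ys_def)
  have t_le: "?t \<le> d" using len by (simp add: ys_def)
  have reg: "regular_mod R {\<zero>} ys" using uw(4) by (simp add: ys_def)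
  have mapc: "set (map ?pw ys) \<subseteq> carrier R" using yqc by simp
  have regq: "regular_mod R {\<zero>} (map ?pw ys)" by (rule regular_mod_pow[OF zeroideal yc reg q0])
  have nth0: "\<forall>i<length ys. \<forall>v\<in>carrier R. ys ! i \<otimes> v \<in> Idl ({\<zero>} \<union> set (take i ys)) \<longrightarrow> v \<in> Idl ({\<zero>} \<union> set (take i ys))"
    using reg unfolding regular_mod_nth[OF zeroideal yc] .
  have nthq: "\<forall>i<length (map ?pw ys). \<forall>v\<in>carrier R. map ?pw ys ! i \<otimes> v \<in> Idl ({\<zero>} \<union> set (take i (map ?pw ys))) \<longrightarrow>
      v \<in> Idl ({\<zero>} \<union> set (take i (map ?pw ys)))"
    using regq unfolding regular_mod_nth[OF zeroideal mapc] .
  have nthI: "\<forall>i<?t. \<forall>v\<in>carrier R. us ! i \<otimes> v \<in> Idl (I \<union> set (take i us)) \<longrightarrow> v \<in> Idl (I \<union> set (take i us))"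
    using uw(5) unfolding regular_mod_nth[OF I(1) uc] .
  have dz0: "depth_zero_mod R \<mm> (Idl ({\<zero>} \<union> ?y ` {..<d}))"
    unfolding depth_zero_mod_def using tk[of d] len Idl_zero_Un[OF yc] v(2) vc socle by auto
  have frob: "frobenius_adapted_sequence R \<mm> I b a ?y d ?t q"
  proof (intro frobenius_adapted_sequence.intro adapted_sequence.intro adapted_sequence_axioms.intro
      frobenius_adapted_sequence_axioms.intro)
    show "minimal_free_resolution R \<mm> I b a" by (rule res.minimal_free_resolution_axioms)
    show "\<forall>j<d. ys ! j \<in> \<mm>" using ysm len by (auto simp: subset_iff)
    show "?t \<le> d" by (rule t_le)
    show "0 < q" by (rule q0)
    show "depth_zero_mod R \<mm> (Idl ({\<zero>} \<union> ?y ` {..<d}))" by (rule dz0)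
    show "depth_zero_mod R \<mm> (Idl (I \<union> ?y ` {..<?t}))" using uw(6) tk[OF t_le] tku[of ?t] by simp
    show "(x \<oplus> z) [^] q = x [^] q \<oplus> z [^] q" if "x \<in> carrier R" "z \<in> carrier R" for x z
      by (rule add[OF that])
  next
    fix k v assume k: "k < d" and v: "v \<in> carrier R" "ys ! k \<otimes> v \<in> Idl ({\<zero>} \<union> ?y ` {..<k})"
    show "v \<in> Idl ({\<zero>} \<union> ?y ` {..<k})"
      using nth0 k len v tk[of k] by simp
  next
    fix k v assume k: "k < ?t" and v: "v \<in> carrier R" "ys ! k \<otimes> v \<in> Idl (I \<union> ?y ` {..<k})"
    have "ys ! k = us ! k" using k by (simp add: ys_def nth_append)
    thus "v \<in> Idl (I \<union> ?y ` {..<k})"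
      using nthI k v tk[of k] tku[of k] t_le by simp
  next
    fix k v assume k: "k < d" and v: "v \<in> carrier R"
      "ys ! k [^] q \<otimes> v \<in> Idl ({\<zero>} \<union> (\<lambda>j. ys ! j [^] q) ` {..<k})"
    show "v \<in> Idl ({\<zero>} \<union> (\<lambda>j. ys ! j [^] q) ` {..<k})"
      using nthq k len v tkq[of k] by simp
  qed
  obtain l where l: "(\<lambda>f. lincomb (free_mod R (b l)) (a l) f (b (Suc l))) ` carrier (free_mod R (b (Suc l))) =
      {\<zero>\<^bsub>free_mod R (b l)\<^esub>}" "0 < b l"
    by (rule res.exists_length[OF res])
  have "\<exists>w\<in>carrier R. w [^] q \<in> Idl (I \<union> (\<lambda>j. ys ! j [^] q) ` {..<?t}) \<and> w \<notin> Idl (I \<union> ?y ` {..<?t})"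
  proof (rule frobenius_adapted_sequence.frobenius_witness[OF frob l vc])
    show "v \<notin> Idl ({\<zero>} \<union> ?y ` {..<d})" using tk[of d] len Idl_zero_Un[OF yc] v(2) by simp
    show "x \<otimes> v \<in> Idl ({\<zero>} \<union> ?y ` {..<d})" if "x \<in> \<mm>" for x
      using tk[of d] len Idl_zero_Un[OF yc] socle[OF that] by simp
    show "v [^] q \<in> Idl ({\<zero>} \<union> (\<lambda>j. ys ! j [^] q) ` {..<d})"
      using tkq[of d] len Idl_zero_Un[OF yqc] v(1) by simp
  qed
  then obtain w where w: "w \<in> carrier R" "w [^] q \<in> Idl (I \<union> ?pw ` set us)" "w \<notin> Idl (I \<union> set us)"
    using tk[OF t_le] tkq[OF t_le] tku[of ?t] by (auto simp: take_map)
  have "maximal_regular_seq R \<mm> (quot_module R I) us"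
    unfolding maximal_regular_seq_def regular_seq_quot_iff[OF I]
  proof (intro conjI allI notI)
    show "set us \<subseteq> \<mm>" "regular_mod R I us" using usm uw(5) by blast+
    fix z assume z: "set (us @ [z]) \<subseteq> \<mm> \<and> regular_mod R I (us @ [z])"
    hence zm: "z \<in> \<mm>" by simp
    have "\<forall>v\<in>carrier R. z \<otimes> v \<in> Idl (I \<union> set us) \<longrightarrow> v \<in> Idl (I \<union> set us)"
      using z unfolding regular_mod_snoc[OF I(1) uc max_carrier[OF zm]] by blast
    thus False using not_depth_zero_mod[OF zm] uw(6) by blast
  qed
  from frobenius_closed_quot_imp[OF I(1) uc q closed[OF this] w(1,2)] show False using w(3) by simp
qed

text \<open>Descending induction on the length. A shorter sequence extends by some \<open>z\<close>. If \<open>k\<close> lies in the Frobenius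
  closure \<open>K\<close> of \<open>Y = (xs)\<close>, it lies in that of \<open>(xs, z)\<close>, so \<open>k = n + r z\<close> with \<open>n \<in> Y\<close>. Cancelling \<open>z\<^sup>q\<close> modulo
  the \<open>q\<close>-th powers of \<open>xs\<close> shows \<open>r \<in> K\<close>. So \<open>K = Y + z K\<close>, and Nakayama's lemma gives \<open>K = Y\<close>.\<close>

lemma regular_sequence_frobenius_closed:
  fixes q :: nat
  assumes add: "\<And>x y. x \<in> carrier R \<Longrightarrow> y \<in> carrier R \<Longrightarrow> (x \<oplus> y) [^] q = x [^] q \<oplus> y [^] q"
    and q: "0 < q"
    and zs: "set zs \<subseteq> \<mm>" "regular_mod R {\<zero>} zs"
    and longest: "\<And>xs. set xs \<subseteq> \<mm> \<Longrightarrow> regular_mod R {\<zero>} xs \<Longrightarrow> length xs \<le> length zs"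
    and full: "\<And>xs u. set xs \<subseteq> \<mm> \<Longrightarrow> regular_mod R {\<zero>} xs \<Longrightarrow> length xs = length zs \<Longrightarrow> u \<in> carrier R \<Longrightarrow>
      u [^] q \<in> Idl ((\<lambda>x. x [^] q) ` set xs) \<Longrightarrow> u \<in> Idl (set xs)"
    and xs: "set xs \<subseteq> \<mm>" "regular_mod R {\<zero>} xs"
    and u: "u \<in> carrier R" "u [^] q \<in> Idl ((\<lambda>x. x [^] q) ` set xs)"
  shows "u \<in> Idl (set xs)"
  using xs u
proof (induction "length zs - length xs" arbitrary: xs u)
  case 0
  have "length xs = length zs" using longest[OF 0(2,3)] 0(1) by simp
  thus ?case using full 0 by blast
next
  case (Suc k)
  let ?pw = "\<lambda>x. x [^] q"
  note xm = Suc.prems(1)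
  note xc = set_carrier[OF xm]
  let ?Y = "Idl (set xs)" and ?Yq = "Idl (?pw ` set xs)"
  have xqc: "?pw ` set xs \<subseteq> carrier R" using xc by auto
  have Y: "ideal ?Y R" and Yq: "ideal ?Yq R" by (rule genideal_ideal[OF xc], rule genideal_ideal[OF xqc])
  have nd: "\<not> depth_zero_mod R \<mm> ?Y"
  proof
    assume "depth_zero_mod R \<mm> ?Y"
    hence "length zs \<le> length xs"
      using regular_mod_length_le[OF zeroideal xm zs(1) Suc.prems(2) zs(2)] Idl_zero_Un[OF xc] by simp
    thus False using Suc.hyps(2) by simp
  qed
  obtain z where z: "z \<in> \<mm>" "\<forall>v\<in>carrier R. z \<otimes> v \<in> ?Y \<longrightarrow> v \<in> ?Y"
    by (rule exists_common_nonzerodivisor[OF Y nd Y nd])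
  have zc: "z \<in> carrier R" by (rule max_carrier[OF z(1)])
  have reg: "regular_mod R {\<zero>} (xs @ [z])"
    unfolding regular_mod_snoc[OF zeroideal xc zc] Idl_zero_Un[OF xc] using Suc.prems(2) z(2) by blast
  have xzm: "set (xs @ [z]) \<subseteq> \<mm>" using xm z(1) by simp
  have regq: "regular_mod R {\<zero>} (map ?pw xs @ [z [^] q])"
    using regular_mod_pow[OF zeroideal set_carrier[OF xzm] reg q] by simp
  have mapc: "set (map ?pw xs) \<subseteq> carrier R" using xqc by simp
  have zq: "\<forall>v\<in>carrier R. z [^] q \<otimes> v \<in> ?Yq \<longrightarrow> v \<in> ?Yq"
    using regq unfolding regular_mod_snoc[OF zeroideal mapc nat_pow_closed[OF zc]] set_map Idl_zero_Un[OF xqc]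
    by blast
  let ?K = "{x \<in> carrier R. x [^] q \<in> ?Yq}"
  have K: "ideal ?K R" by (rule frobenius_preimage_ideal[OF add q Yq])
  have "?K = ?Y"
  proof (rule nakayama_principal[OF Y K _ z(1)])
    show "?Y \<subseteq> ?K" using pow_mem_Idl_pow[OF add q xc] ideal.Icarr[OF Y] by blast
  next
    fix k' assume k: "k' \<in> ?K"
    hence kc: "k' \<in> carrier R" "k' [^] q \<in> ?Yq" by auto
    have xzqc: "?pw ` set (xs @ [z]) \<subseteq> carrier R" using xqc zc by auto
    have "?Yq \<subseteq> Idl (?pw ` set (xs @ [z]))" by (rule Idl_mono[OF _ xzqc]) auto
    hence kq: "k' [^] q \<in> Idl (?pw ` set (xs @ [z]))" using kc(2) by blast
    have "k' \<in> Idl (set (xs @ [z]))"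
      by (rule Suc.hyps(1)[OF _ xzm reg kc(1) kq]) (use Suc.hyps(2) in simp)
    also have "Idl (set (xs @ [z])) = Idl (insert z ?Y)"
      using Idl_Un_Idl[of "{z}" "set xs"] xc zc by simp
    finally obtain n r where nr: "n \<in> ?Y" "r \<in> carrier R" "k' = n \<oplus> r \<otimes> z"
      unfolding Idl_insert_iff[OF Y zc] by blast
    have nc: "n \<in> carrier R" by (rule ideal.Icarr[OF Y nr(1)])
    have nq: "n [^] q \<in> ?Yq" by (rule pow_mem_Idl_pow[OF add q xc nr(1)])
    have e: "k' [^] q = n [^] q \<oplus> z [^] q \<otimes> r [^] q"
      unfolding nr(3) using add nc nr(2) zc by (simp add: nat_pow_distrib m_comm)
    interpret Yq: ideal ?Yq R by (rule Yq)
    have "k' [^] q \<ominus> n [^] q \<in> ?Yq" using kc(2) nq by (simp add: a_minus_def)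
    moreover have "k' [^] q \<ominus> n [^] q = z [^] q \<otimes> r [^] q"
    proof -
      have "k' [^] q \<ominus> n [^] q = (z [^] q \<otimes> r [^] q \<oplus> n [^] q) \<ominus> n [^] q"
        unfolding e using nc nr(2) zc by (simp add: a_comm)
      thus ?thesis using add_minus_cancel(1)[of "z [^] q \<otimes> r [^] q" "n [^] q"] nc nr(2) zc by simp
    qed
    ultimately have "r [^] q \<in> ?Yq" using zq nr(2) by simp
    hence "r \<in> ?K" using nr(2) by blast
    moreover have "k' = n \<oplus> z \<otimes> r" using nr(3) m_comm[OF nr(2) zc] by simp
    ultimately show "\<exists>n\<in>?Y. \<exists>l\<in>?K. k' = n \<oplus> z \<otimes> l" using nr(1) by blast
  qed
  thus ?case using Suc.prems(3,4) by blast
qed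

lemma exists_regular_sequence_of_depth:
  assumes "depth R \<mm> (self_module R) = enat d"
  obtains zs where "set zs \<subseteq> \<mm>" "regular_mod R {\<zero>} zs" "length zs = d"
    "\<And>xs. set xs \<subseteq> \<mm> \<Longrightarrow> regular_mod R {\<zero>} xs \<Longrightarrow> length xs \<le> d"
proof -
  let ?S = "{enat (length xs) | xs. regular_seq R \<mm> (self_module R) xs}"
  have sup: "Sup ?S = enat d" using assms by (simp add: depth_def)
  have le: "length xs \<le> d" if "set xs \<subseteq> \<mm>" "regular_mod R {\<zero>} xs" for xs
  proof -
    have "enat (length xs) \<in> ?S" using that regular_seq_self_iff by blast
    hence "enat (length xs) \<le> enat d" unfolding sup[symmetric] by (rule Sup_upper)
    thus ?thesis by simp
  qed
  have "\<exists>zs. set zs \<subseteq> \<mm> \<and> regular_mod R {\<zero>} zs \<and> length zs = d"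
  proof (rule ccontr)
    assume neg: "\<not> ?thesis"
    hence "d \<noteq> 0" by (metis empty_subsetI list.set(1) list.size(3) regular_mod.simps(1))
    have "Sup ?S \<le> enat (d - 1)"
    proof (rule Sup_least)
      fix x assume "x \<in> ?S"
      then obtain xs where xs: "x = enat (length xs)" "set xs \<subseteq> \<mm>" "regular_mod R {\<zero>} xs"
        using regular_seq_self_iff by blast
      have "length xs \<noteq> d" using neg xs(2,3) by blast
      thus "x \<le> enat (d - 1)" using le[OF xs(2,3)] xs(1) by simp
    qed
    thus False using sup \<open>d \<noteq> 0\<close> by simp
  qed
  thus ?thesis using that le by blast
qed

text \<open>The exponent \<open>p\<^sup>0 = 1\<close> shows that the closure contains the ideal.\<close>

lemma frobenius_closed_seqI:
  assumes p: "has_prime_char R p" and xc: "set xs \<subseteq> carrier R"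
    and closed: "\<And>e u. u \<in> carrier R \<Longrightarrow> u [^] (p ^ e) \<in> Idl ((\<lambda>x. x [^] (p ^ e)) ` set xs) \<Longrightarrow> u \<in> Idl (set xs)"
  shows "frobenius_closed_seq R p xs"
proof -
  let ?Y = "Idl (set xs)"
  have Y: "ideal ?Y R" by (rule genideal_ideal[OF xc])
  have Yc: "?Y \<subseteq> carrier R" using ideal.Icarr[OF Y] by blast
  have "frobenius_closure R p ?Y \<subseteq> ?Y"
  proof
    fix u assume "u \<in> frobenius_closure R p ?Y"
    then obtain e where u: "u \<in> carrier R" "u [^] (p ^ e) \<in> Idl ((\<lambda>x. x [^] (p ^ e)) ` ?Y)"
      unfolding frobenius_closure_def frobenius_power_def by blast
    let ?q = "p ^ e"
    have q0: "0 < ?q" using p by (simp add: has_prime_char_def prime_gt_0_nat)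
    have xqc: "(\<lambda>x. x [^] ?q) ` set xs \<subseteq> carrier R" using xc by auto
    have "(\<lambda>x. x [^] ?q) ` ?Y \<subseteq> Idl ((\<lambda>x. x [^] ?q) ` set xs)"
      using pow_mem_Idl_pow[OF frobenius_add[OF p] q0 xc] by blast
    hence "Idl ((\<lambda>x. x [^] ?q) ` ?Y) \<subseteq> Idl ((\<lambda>x. x [^] ?q) ` set xs)"
      by (rule genideal_minimal[OF genideal_ideal[OF xqc]])
    thus "u \<in> ?Y" using closed[OF u(1)] u(2) by blast
  qed
  moreover have "?Y \<subseteq> frobenius_closure R p ?Y"
  proof
    fix u assume u: "u \<in> ?Y"
    have im: "(\<lambda>x. x [^] (p ^ 0)) ` ?Y = ?Y"
    proof -
      have "(\<lambda>x. x [^] (p ^ 0)) ` ?Y = (\<lambda>x. x) ` ?Y" using Yc by (intro image_cong) auto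
      thus ?thesis by simp
    qed
    have "u [^] (p ^ 0) \<in> frobenius_power R ?Y (p ^ 0)"
      unfolding frobenius_power_def im Idl_ideal[OF Y] using u Yc by auto
    thus "u \<in> frobenius_closure R p ?Y" unfolding frobenius_closure_def using u Yc by blast
  qed
  ultimately show ?thesis unfolding frobenius_closed_seq_def frobenius_closed_def by blast
qed

end

theorem proposition3p8:
  fixes R :: "('a, 'b) ring_scheme" and \<mm> I :: "'a set" and p d :: nat
  assumes "cohen_macaulay_local R \<mm>"
    and "has_prime_char R p"
    and "krull_dim R = enat d"
    and "ideal I R" and "I \<subset> carrier R"
    and "proj_dim TYPE('p) R (quot_module R I) < \<infinity>"
    and "\<forall>xs. maximal_regular_seq R \<mm> (quot_module R I) xs \<longrightarrow>
           frobenius_closed_seq (R Quot I) p (map (\<lambda>x. I +>\<^bsub>R\<^esub> x) xs)"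
  shows "\<forall>xs. regular_seq R \<mm> (self_module R) xs \<longrightarrow> frobenius_closed_seq R p xs"
proof (intro allI impI)
  fix xs assume xs: "regular_seq R \<mm> (self_module R) xs"
  interpret noetherian_ring R using assms(1) by (simp add: cohen_macaulay_local_def)
  interpret cring R using assms(1) by (simp add: cohen_macaulay_local_def local_ring_def)
  interpret noetherian_local_ring R \<mm>
    by unfold_locales (use assms(1) in \<open>simp add: cohen_macaulay_local_def\<close>)
  have "\<exists>n. \<exists>(P :: nat \<Rightarrow> ('a, 'p) module) \<delta> \<epsilon>. projective_resolution R (quot_module R I) n P \<delta> \<epsilon>"
  proof (rule ccontr)
    assume "\<not> ?thesis"
    hence "{enat n | n. \<exists>(P :: nat \<Rightarrow> ('a, 'p) module) \<delta> \<epsilon>.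
        projective_resolution R (quot_module R I) n P \<delta> \<epsilon>} = {}" by blast
    hence "proj_dim TYPE('p) R (quot_module R I) = Inf {}"
      unfolding proj_dim_def by (rule arg_cong)
    thus False using assms(6) by (simp add: top_enat_def)
  qed
  then obtain n and P :: "nat \<Rightarrow> ('a, 'p) module" and \<delta> \<epsilon>
    where res: "projective_resolution R (quot_module R I) n P \<delta> \<epsilon>" by blast
  have I: "ideal I R" "I \<noteq> carrier R" using assms(4,5) by auto
  have "depth R \<mm> (self_module R) = enat d" using assms(1,3) by (simp add: cohen_macaulay_local_def)
  then obtain zs where zs: "set zs \<subseteq> \<mm>" "regular_mod R {\<zero>\<^bsub>R\<^esub>} zs" "length zs = d"
    "\<And>xs. set xs \<subseteq> \<mm> \<Longrightarrow> regular_mod R {\<zero>\<^bsub>R\<^esub>} xs \<Longrightarrow> length xs \<le> d"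
    by (rule exists_regular_sequence_of_depth) blast
  have x: "set xs \<subseteq> \<mm>" "regular_mod R {\<zero>\<^bsub>R\<^esub>} xs" using xs unfolding regular_seq_self_iff by blast+
  show "frobenius_closed_seq R p xs"
  proof (rule frobenius_closed_seqI[OF assms(2) set_carrier[OF x(1)]])
    fix e u
    let ?q = "p ^ e"
    assume u: "u \<in> carrier R" "u [^]\<^bsub>R\<^esub> ?q \<in> Idl\<^bsub>R\<^esub> ((\<lambda>x. x [^]\<^bsub>R\<^esub> ?q) ` set xs)"
    show "u \<in> Idl\<^bsub>R\<^esub> (set xs)"
    proof (rule regular_sequence_frobenius_closed[where q = ?q and zs = zs])
      show "0 < ?q" using assms(2) by (simp add: has_prime_char_def prime_gt_0_nat)
      fix xs' u' assume "set xs' \<subseteq> \<mm>" "regular_mod R {\<zero>\<^bsub>R\<^esub>} xs'" "length xs' = length zs"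
        "u' \<in> carrier R" "u' [^]\<^bsub>R\<^esub> ?q \<in> Idl\<^bsub>R\<^esub> ((\<lambda>x. x [^]\<^bsub>R\<^esub> ?q) ` set xs')"
      thus "u' \<in> Idl\<^bsub>R\<^esub> (set xs')"
        using full_regular_sequence_frobenius_closed[OF assms(2) refl assms(3) I res] assms(7) zs(3) by blast
    qed (use frobenius_add[OF assms(2)] zs x u in auto)
  qed
qed

end
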